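(* Let $n\ge 2$ and $p>n$. There are constants $\alpha>0$ and $A>0$ such that $$\sup\Big\{|u(x)-u(y)|: x,y\in\mathbb{R}^n\setminus\overline{B_1},\ |x|\ge r,\ |y|\ge r\Big\} \le \frac{A \|u\|_\infty}{r^\alpha}\quad\text{for all } r\ge 1$$ for each function $u$ that is bounded and $p$-harmonic in $\mathbb{R}^n\setminus \overline{B_1}$.
   Context: $B_1$ is the open unit ball of $\mathbb{R}^n$ centered at the origin, so $\mathbb{R}^n\setminus\overline{B_1}=\{|x|>1\}$, and $\|u\|_\infty=\sup_{|x|>1}|u(x)|$. A function $u$ is $p$-harmonic in an open set $\Omega$ if $u\in W^{1,p}_{\mathrm{loc}}(\Omega)$ and $\int_\Omega |Du|^{p-2}Du\cdot D\phi\,dx=0$ for all $\phi\in C_c^\infty(\Omega)$; since $p>n$, $u$ is identified with its continuous representative. The constants $\alpha,A$ do not depend on $u$ or $r$. *)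

theory Defs
  imports "HOL-Analysis.Analysis"
begin

definition partial :: "'n::finite \<Rightarrow> (real ^ 'n \<Rightarrow> real) \<Rightarrow> real ^ 'n \<Rightarrow> real" where
  "partial i f x = frechet_derivative f (at x) (axis i 1)"

definition grad :: "(real ^ 'n::finite \<Rightarrow> real) \<Rightarrow> real ^ 'n \<Rightarrow> real ^ 'n" where
  "grad f x = (\<chi> i. partial i f x)"

text \<open>Differentiability is required explicitly because \<^const>\<open>frechet_derivative\<close> has
  an unspecified value where the derivative does not exist.\<close>

primrec Ck :: "nat \<Rightarrow> (real ^ 'n::finite \<Rightarrow> real) \<Rightarrow> bool" where
  "Ck 0 f \<longleftrightarrow> continuous_on UNIV f"
| "Ck (Suc k) f \<longleftrightarrow> f differentiable_on UNIV \<and> (\<forall>i. Ck k (partial i f))"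

definition smooth :: "(real ^ 'n::finite \<Rightarrow> real) \<Rightarrow> bool" where
  "smooth f \<longleftrightarrow> (\<forall>k. Ck k f)"

text \<open>An element of \<open>C\<^sub>c\<^sup>\<infinity>(\<Omega>)\<close> is represented by its extension by zero to the whole space.\<close>

definition test_functions :: "(real ^ 'n::finite) set \<Rightarrow> (real ^ 'n \<Rightarrow> real) set" where
  "test_functions \<Omega> =
    {\<phi>. smooth \<phi> \<and> compact (closure {x. \<phi> x \<noteq> 0}) \<and> closure {x. \<phi> x \<noteq> 0} \<subseteq> \<Omega>}"

definition Lp_loc ::
  "real \<Rightarrow> (real ^ 'n::finite) set \<Rightarrow> (real ^ 'n \<Rightarrow> 'b::euclidean_space) \<Rightarrow> bool" where
  "Lp_loc p \<Omega> f \<longleftrightarrow>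
    set_borel_measurable lebesgue \<Omega> f \<and>
    (\<forall>K. compact K \<and> K \<subseteq> \<Omega> \<longrightarrow> set_integrable lebesgue K (\<lambda>x. norm (f x) powr p))"

definition weak_gradient ::
  "(real ^ 'n::finite) set \<Rightarrow> (real ^ 'n \<Rightarrow> real) \<Rightarrow> (real ^ 'n \<Rightarrow> real ^ 'n) \<Rightarrow> bool" where
  "weak_gradient \<Omega> u Du \<longleftrightarrow>
    Lp_loc 1 \<Omega> u \<and> Lp_loc 1 \<Omega> Du \<and>
    (\<forall>\<phi> \<in> test_functions \<Omega>. \<forall>i.
      (LINT x:\<Omega>|lebesgue. u x * partial i \<phi> x) = - (LINT x:\<Omega>|lebesgue. (Du x $ i) * \<phi> x))"

text \<open>\<open>W1p_loc p \<Omega> u Du\<close>: the function \<open>u\<close> lies in \<open>W\<^sup>1\<^sup>,\<^sup>p\<close> locally on \<open>\<Omega>\<close> and \<open>Du\<close> is (a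
  representative of) its weak gradient, which is unique up to null sets.\<close>

definition W1p_loc ::
  "real \<Rightarrow> (real ^ 'n::finite) set \<Rightarrow> (real ^ 'n \<Rightarrow> real) \<Rightarrow> (real ^ 'n \<Rightarrow> real ^ 'n) \<Rightarrow> bool" where
  "W1p_loc p \<Omega> u Du \<longleftrightarrow> weak_gradient \<Omega> u Du \<and> Lp_loc p \<Omega> u \<and> Lp_loc p \<Omega> Du"

text \<open>Where \<open>Du x = 0\<close> the integrand below is \<open>0\<close>, as intended.  The definition does not force
  \<open>u\<close> to be the continuous representative of its class.\<close>

definition p_harmonic_on :: "real \<Rightarrow> (real ^ 'n::finite) set \<Rightarrow> (real ^ 'n \<Rightarrow> real) \<Rightarrow> bool" where
  "p_harmonic_on p \<Omega> u \<longleftrightarrow>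
    open \<Omega> \<and>
    (\<exists>Du. W1p_loc p \<Omega> u Du \<and>
      (\<forall>\<phi> \<in> test_functions \<Omega>.
        (LINT x:\<Omega>|lebesgue. (norm (Du x) powr (p - 2) *\<^sub>R Du x) \<bullet> grad \<phi> x) = 0))"

end

theory Submission
  imports Defs
begin

text \<open>
  The proof iterates an oscillation estimate \<open>osc(8 r) \<le> \<theta> osc(r)\<close> over spheres.  Testing the equation
  with \<open>\<eta> \<Phi>(u)\<close> gives a Caccioppoli inequality for \<open>\<Phi>(u)\<close>.  With \<open>\<Phi>\<close> a truncation it yields the maximum
  principle in \<open>{|x| \<ge> r}\<close>: a cutoff at radius \<open>R\<close> costs energy of order \<open>R\<^sup>n\<^sup>-\<^sup>p\<close>, which tends to \<open>0\<close> because
  \<open>p > n\<close>, so nothing is lost at infinity.  With \<open>\<Phi> = (K - u)\<^sup>1\<^sup>-\<^sup>p\<close> it bounds the energy of \<open>ln (K - u)\<close>, and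
  Morrey's inequality (again \<open>p > n\<close>) turns this into a Harnack inequality on spheres, hence into the
  decay.  Mollification is applied to \<open>u\<close> itself, so \<open>\<eta> \<Phi>(u)\<close> is only ever used for smooth \<open>u\<close> and no
  chain rule for Sobolev functions is needed.
\<close>

section \<open>Gradients and mollifiers\<close>

text \<open>Morrey's inequality is available on convex sets, but the exterior of a ball is not
  convex. The sets used instead are truncated half-spaces: two points of the sphere of radius
  \<open>8 * r\<close> with nonnegative inner product lie in one that stays at distance at least
  \<open>2 * r\<close> from the origin, and two arbitrary points are linked through a third one
  orthogonal to the first. This is where the dimension must be at least 2; on the line the exterior
  is disconnected and \<open>u\<close> may be a different constant on each side. The factor 8 leaves
  room for the cutoff to rise from 0 to 1 between \<open>r\<close> and \<open>2 * r\<close>. Both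
  sides of the logarithmic estimate scale with the same power of the radius, so its constant does
  not depend on \<open>r\<close> and the decay is geometric; this gives \<alpha> as minus the
  logarithm of \<theta> to base 8. A shift by a positive \<delta> serves twice: it keeps the
  argument of the logarithm positive, and in the maximum principle it opens a collar around the
  sphere on which the truncation vanishes, so that the inner layer of the cutoff costs
  nothing.\<close>

lemma GDERIV_unique: "GDERIV f x :> D \<Longrightarrow> GDERIV f x :> E \<Longrightarrow> D = E"
  unfolding gderiv_def
  by (metis has_derivative_unique vector_eq_rdot inner_commute)

lemma partial_GDERIV: "GDERIV f x :> D \<Longrightarrow> partial i f x = D $ i"
  unfolding gderiv_def partial_def
  by (metis frechet_derivative_at inner_axis inner_commute inner_real_def mult.right_neutral)

lemma grad_GDERIV: "GDERIV f x :> D \<Longrightarrow> grad f x = D"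
  by (simp add: grad_def vec_eq_iff partial_GDERIV)

lemma GDERIV_continuous: "GDERIV f x :> D \<Longrightarrow> isCont f x"
  unfolding gderiv_def by (rule has_derivative_continuous)

lemma GDERIV_continuous_on: "(\<And>x. GDERIV f x :> D x) \<Longrightarrow> continuous_on UNIV f"
  by (metis GDERIV_continuous continuous_at_imp_continuous_on)

lemma DERIV_continuous_on_UNIV: "(\<And>t. DERIV f t :> f' t) \<Longrightarrow> continuous_on UNIV f"
  by (metis DERIV_isCont continuous_at_imp_continuous_on)

text \<open>Links \<open>partial\<close> and \<open>grad\<close>, defined through
  \<open>frechet_derivative\<close>, with \<open>GDERIV\<close>, the form in which all later
  calculus is carried out; a linear functional is determined by its values on the coordinate
  axes.\<close>

lemma differentiable_GDERIV_grad:
  assumes "f differentiable (at x)" shows "GDERIV f x :> grad f x"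
proof -
  have d: "(f has_derivative frechet_derivative f (at x)) (at x)"
    using assms frechet_derivative_works by blast
  have lin: "linear (frechet_derivative f (at x))"
    using d has_derivative_linear by blast
  have "frechet_derivative f (at x) h = inner h (grad f x)" for h
  proof -
    have "frechet_derivative f (at x) h = frechet_derivative f (at x) (\<Sum>i\<in>UNIV. h $ i *\<^sub>R axis i 1)"
      by (metis basis_expansion scalar_mult_eq_scaleR)
    also have "\<dots> = (\<Sum>i\<in>UNIV. h $ i * partial i f x)"
      using lin by (simp add: linear_sum linear_scale partial_def)
    finally show ?thesis by (simp add: inner_vec_def grad_def)
  qed
  then show ?thesis using d unfolding gderiv_def by presburger
qed

lemma smooth_GDERIV: "smooth f \<Longrightarrow> GDERIV f x :> grad f x"
  unfolding smooth_def
  by (metis Ck.simps(2) differentiable_on_def UNIV_I differentiable_GDERIV_grad)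

lemma smooth_partial: "smooth f \<Longrightarrow> smooth (partial i f)"
  unfolding smooth_def by (metis Ck.simps(2))

lemma smooth_continuous: "smooth f \<Longrightarrow> continuous_on UNIV f"
  unfolding smooth_def by (metis Ck.simps(1))

text \<open>The case \<open>k = 0\<close> is the classical smooth function exp(-1/t). The powers of
  \<open>t\<close> in the denominator are there because differentiation raises them: the whole
  family in \<open>k\<close> is closed under derivatives up to linear combinations.\<close>

definition flat :: "nat \<Rightarrow> real \<Rightarrow> real" where
  "flat k t = (if t > 0 then exp (- (1 / t)) / t ^ k else 0)"

text \<open>The bound exp s >= s at s = 1 / ((m + 1) t), raised to the power m + 1, bounds exp(1/t)
  from below.\<close>

lemma exp_minus_inverse_le:
  assumes "t > 0" shows "exp (- (1 / t)) \<le> (real (Suc m) * t) ^ Suc m"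
proof -
  let ?m = "real (Suc m)"
  have "(1 / (?m * t)) ^ Suc m \<le> exp (1 / (?m * t)) ^ Suc m"
    using assms by (intro power_mono) (auto intro: order_trans[OF _ exp_ge_add_one_self])
  also have "\<dots> = exp (?m * (1 / (?m * t)))" by (rule exp_of_nat_mult[symmetric])
  also have "?m * (1 / (?m * t)) = 1 / t" using assms by simp
  finally have "1 / ((?m * t) ^ Suc m) \<le> exp (1 / t)" by (simp only: power_one_over)
  moreover have "(?m * t) ^ Suc m > 0" using assms by simp
  ultimately have "1 \<le> exp (1 / t) * (?m * t) ^ Suc m" by (simp only: pos_divide_le_eq)
  then show ?thesis by (simp add: exp_minus field_simps)
qed

text \<open>Flatness at the origin: exp(-1/t) beats t^(k + 2), and the two powers left over make the
  difference quotient at 0 tend to 0.\<close>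

lemma flat_le_square: "\<bar>flat k t\<bar> \<le> (real (k + 2)) ^ (k + 2) * t\<^sup>2"
proof (cases "t > 0")
  case True
  have "exp (- (1 / t)) \<le> (real (k + 2) * t) ^ (k + 2)"
    using exp_minus_inverse_le[OF True, of "Suc k"] by simp
  also have "\<dots> = real (k + 2) ^ (k + 2) * t\<^sup>2 * t ^ k"
    by (metis (no_types) power_mult_distrib power_add mult.assoc mult.commute)
  finally show ?thesis using True
    by (simp add: flat_def pos_divide_le_eq)
qed (simp add: flat_def)

lemma DERIV_flat: "DERIV (flat k) t :> flat (k + 2) t - real k * flat (k + 1) t"
proof -
  consider "t > 0" | "t < 0" | "t = 0" by linarith
  then show ?thesis
  proof cases
    case 1
    have "DERIV (\<lambda>t. exp (- (1 / t)) / t ^ k) t :> flat (k + 2) t - real k * flat (k + 1) t"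
    proof (cases k)
      case 0
      then show ?thesis using 1
        by (auto intro!: derivative_eq_intros simp: flat_def field_simps power2_eq_square)
    next
      case (Suc m)
      have "DERIV (\<lambda>t. exp (- (1 / t))) t :> exp (- (1 / t)) / t\<^sup>2"
        using 1 by (auto intro!: derivative_eq_intros simp: power2_eq_square)
      moreover have "DERIV (\<lambda>t. t ^ Suc m) t :> real (Suc m) * t ^ m"
        using DERIV_pow[of "Suc m" t] by simp
      ultimately have "DERIV (\<lambda>t. exp (- (1 / t)) / t ^ Suc m) t :>
          (exp (- (1 / t)) / t\<^sup>2 * t ^ Suc m - exp (- (1 / t)) * (real (Suc m) * t ^ m)) / (t ^ Suc m * t ^ Suc m)"
        using 1 by (intro DERIV_divide) auto
      moreover have "(exp (- (1 / t)) / t\<^sup>2 * t ^ Suc m - exp (- (1 / t)) * (real (Suc m) * t ^ m)) / (t ^ Suc m * t ^ Suc m)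
          = flat (k + 2) t - real k * flat (k + 1) t"
      proof -
        \<comment> \<open>Abstracting exp(-1/t), t^m and k to \<open>E\<close>, \<open>T\<close> and
          \<open>K\<close> leaves a purely rational identity.\<close>
        have "(E / (t * t) * (t * T) - E * (K * T)) / ((t * T) * (t * T)) = E / (t * (t * (t * T))) - K * (E / (t * (t * T)))"
          if "T > 0" for E K T :: real
          using that 1 by (simp add: field_simps)
        from this[of "t ^ m"] show ?thesis
          using 1 Suc by (simp add: flat_def power2_eq_square)
      qed
      ultimately show ?thesis using Suc by simp
    qed
    then show ?thesis
      by (rule has_field_derivative_transform_within_open[where S="{0<..}"]) (use 1 in \<open>auto simp: flat_def\<close>)
  next
    case 2
    have "DERIV (\<lambda>t. 0) t :> flat (k + 2) t - real k * flat (k + 1) t"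
      using 2 by (simp add: flat_def)
    then show ?thesis
      by (rule has_field_derivative_transform_within_open[where S="{..<0}"]) (use 2 in \<open>auto simp: flat_def\<close>)
  next
    case 3
    let ?C = "(real (k + 2)) ^ (k + 2)"
    \<comment> \<open>At the junction of the two branches the quadratic bound makes the difference
      quotient at most a multiple of the modulus of \<open>h\<close>.\<close>
    have "((\<lambda>h. flat k h / h) \<longlongrightarrow> 0) (at 0)"
    proof (rule tendsto_0_le[where K="?C" and f="\<lambda>h. h"])
      have "norm (flat k h / h) \<le> norm h * ?C" if "h \<noteq> 0" for h
      proof -
        have "\<bar>flat k h\<bar> \<le> ?C * \<bar>h\<bar> * \<bar>h\<bar>"
          using flat_le_square[of k h] by (simp add: power2_eq_square mult.assoc)
        then show ?thesis using that by (simp only: real_norm_def abs_divide) (simp add: pos_divide_le_eq ac_simps)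
      qed
      then show "\<forall>\<^sub>F h in at 0. norm (flat k h / h) \<le> norm h * ?C"
        by (auto simp: eventually_at_filter)
    qed (rule tendsto_ident_at)
    then show ?thesis using 3 by (simp add: DERIV_def flat_def)
  qed
qed

text \<open>Closed under partial derivatives, so that smoothness follows by induction on the order.\<close>

inductive bump_class :: "(real ^ 'n::finite \<Rightarrow> real) \<Rightarrow> bool" where
  flat: "bump_class (\<lambda>x. flat k (c - (x - a) \<bullet> (x - a)))"
| coord: "bump_class (\<lambda>x. x $ i)"
| const: "bump_class (\<lambda>x. c)"
| add: "bump_class f \<Longrightarrow> bump_class g \<Longrightarrow> bump_class (\<lambda>x. f x + g x)"
| mult: "bump_class f \<Longrightarrow> bump_class g \<Longrightarrow> bump_class (\<lambda>x. f x * g x)"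

lemma GDERIV_square_dist: "GDERIV (\<lambda>x. (x - a) \<bullet> (x - a)) x :> 2 *\<^sub>R (x - a)"
  unfolding gderiv_def
  by (auto intro!: derivative_eq_intros simp: inner_commute algebra_simps)

lemma GDERIV_coord: "GDERIV (\<lambda>x::real^'n::finite. x $ i) x :> axis i 1"
proof -
  have "((\<lambda>x::real^'n. x $ i) has_derivative (\<lambda>h. h $ i)) (at x)"
    by (rule bounded_linear_imp_has_derivative[OF bounded_linear_vec_nth])
  then show ?thesis by (simp add: gderiv_def inner_axis)
qed

lemma bump_class_GDERIV:
  "bump_class f \<Longrightarrow> \<exists>D. (\<forall>x. GDERIV f x :> D x) \<and> (\<forall>i. bump_class (\<lambda>x. D x $ i))"
proof (induction rule: bump_class.induct)
  case (flat k c a)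
  let ?s = "\<lambda>x. c - (x - a) \<bullet> (x - a)"
  let ?D = "\<lambda>x. (flat (k + 2) (?s x) - real k * flat (k + 1) (?s x)) *\<^sub>R (0 - 2 *\<^sub>R (x - a))"
  have "GDERIV (\<lambda>x. flat k (?s x)) x :> ?D x" for x
    by (rule GDERIV_DERIV_compose[OF GDERIV_diff[OF GDERIV_const GDERIV_square_dist] DERIV_flat])
  moreover have "bump_class (\<lambda>x. ?D x $ i)" for i
  proof -
    \<comment> \<open>The gradient is rewritten with sums and products only, since the class has no
      rule for differences or scalar multiples.\<close>
    have "bump_class (\<lambda>x. (flat (k + 2) (?s x) + (- real k) * flat (k + 1) (?s x)) * ((-2) * x $ i + 2 * a $ i))"
      by (intro bump_class.intros)
    then show ?thesis by (simp add: algebra_simps)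
  qed
  ultimately show ?case by (intro exI[of _ ?D] conjI allI)
next
  case (coord i)
  have "bump_class (\<lambda>x::real^'a. (axis i 1 :: real^'a) $ j)" for j by (rule bump_class.const)
  then show ?case by (intro exI[of _ "\<lambda>x. axis i 1"] conjI allI) (simp_all add: GDERIV_coord)
next
  case (const c)
  show ?case by (intro exI[of _ "\<lambda>x. 0"] conjI allI) (simp_all add: GDERIV_const bump_class.const)
next
  case (add f g)
  then obtain D E where "\<forall>x. GDERIV f x :> D x" "\<forall>i. bump_class (\<lambda>x. D x $ i)"
    "\<forall>x. GDERIV g x :> E x" "\<forall>i. bump_class (\<lambda>x. E x $ i)" by blast
  then show ?case
    by (intro exI[of _ "\<lambda>x. D x + E x"] conjI allI) (simp_all add: GDERIV_add bump_class.add)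
next
  case (mult f g)
  then obtain D E where "\<forall>x. GDERIV f x :> D x" "\<forall>i. bump_class (\<lambda>x. D x $ i)"
    "\<forall>x. GDERIV g x :> E x" "\<forall>i. bump_class (\<lambda>x. E x $ i)" by blast
  with mult show ?case
    by (intro exI[of _ "\<lambda>x. f x *\<^sub>R E x + g x *\<^sub>R D x"] conjI allI)
      (simp_all add: GDERIV_mult bump_class.add bump_class.mult)
qed

lemma smooth_bump_class: "bump_class f \<Longrightarrow> smooth f"
  unfolding smooth_def
proof
  fix k show "bump_class f \<Longrightarrow> Ck k f"
  proof (induction k arbitrary: f)
    case 0
    then show ?case
      using bump_class_GDERIV[OF 0] GDERIV_continuous
      by (auto intro!: continuous_at_imp_continuous_on)
  next
    case (Suc k)
    obtain D where D: "\<And>x. GDERIV f x :> D x" "\<And>i. bump_class (\<lambda>x. D x $ i)"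
      using bump_class_GDERIV[OF Suc.prems] by auto
    have "partial i f = (\<lambda>x. D x $ i)" for i using partial_GDERIV[OF D(1)] by blast
    moreover have "f differentiable_on UNIV"
      using D(1) unfolding gderiv_def differentiable_on_def differentiable_def by auto
    ultimately show ?case using Suc.IH D(2) by simp
  qed
qed

lemma continuous_compact_support_integrable:
  fixes f :: "'a::euclidean_space \<Rightarrow> 'b::{banach, second_countable_topology}"
  assumes "continuous_on UNIV f" "compact K" "\<And>x. x \<notin> K \<Longrightarrow> f x = 0"
  shows "integrable lborel f"
proof -
  have "integrable lborel (\<lambda>x. indicator K x *\<^sub>R f x)"
    by (rule borel_integrable_compact[OF assms(2) continuous_on_subset[OF assms(1)]]) auto
  also have "(\<lambda>x. indicator K x *\<^sub>R f x) = f"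
    using assms(3) by (auto simp: indicator_def)
  finally show ?thesis .
qed

section \<open>Bump functions and mollifiers of unit mass\<close>

definition bump :: "real \<Rightarrow> real ^ 'n::finite \<Rightarrow> real" where
  "bump e x = flat 0 (e\<^sup>2 - x \<bullet> x)"

definition mollifier :: "real \<Rightarrow> real ^ 'n::finite \<Rightarrow> real" where
  "mollifier e x = bump e x / (LINT y|lborel. bump e (y :: real ^ 'n))"

lemma bump_nonneg: "bump e x \<ge> 0"
  by (simp add: bump_def flat_def)

lemma bump_pos_iff: "e > 0 \<Longrightarrow> bump e x > 0 \<longleftrightarrow> norm x < e"
  using norm_lt_square[of x e] by (auto simp: bump_def flat_def)

lemma bump_eq_0: "e > 0 \<Longrightarrow> norm x \<ge> e \<Longrightarrow> bump e x = 0"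
  using bump_pos_iff[of e x] bump_nonneg[of e x] by linarith

lemma bump_class_bump: "bump_class (\<lambda>x. bump e (x - a))"
  unfolding bump_def by (rule bump_class.flat)

lemma continuous_on_bump: "continuous_on UNIV (bump e)"
  using smooth_continuous[OF smooth_bump_class[OF bump_class_bump[of e 0]]] by simp

lemma integrable_bump: "e > 0 \<Longrightarrow> integrable lborel (bump e :: real^'n::finite \<Rightarrow> real)"
  by (rule continuous_compact_support_integrable[OF continuous_on_bump compact_cball[of 0 e]])
    (auto simp: bump_eq_0)

text \<open>A nonnegative integrable function with zero integral vanishes almost everywhere; as the
  bump is positive on a ball, that ball would be a null set.\<close>

lemma integral_bump_pos:
  assumes "e > 0" shows "(LINT y|lborel. bump e (y::real^'n::finite)) > 0"
proof -
  have "(LINT y|lborel. bump e (y::real^'n)) \<noteq> 0"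
  proof
    assume "(LINT y|lborel. bump e (y::real^'n)) = 0"
    then have "AE y in lborel. bump e (y::real^'n) = 0"
      by (subst (asm) integral_nonneg_eq_0_iff_AE[OF integrable_bump[OF assms]])
        (simp_all add: bump_nonneg)
    then have "AE y in lborel. y \<notin> ball (0::real^'n) e"
    proof eventually_elim
      case (elim y)
      then show ?case using bump_pos_iff[OF assms, of y] by simp
    qed
    then have "ball (0::real^'n) e \<in> null_sets lborel"
      by (subst AE_iff_null_sets) simp_all
    then have "emeasure lborel (ball (0::real^'n) e) = 0" by blast
    moreover have "unit_ball_vol (real CARD('n)) > 0" by simp
    ultimately show False using assms by (simp add: emeasure_ball)
  qed
  moreover have "(LINT y|lborel. bump e (y::real^'n)) \<ge> 0" by (simp add: bump_nonneg)
  ultimately show ?thesis by linarith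
qed

lemma mollifier_nonneg: "e > 0 \<Longrightarrow> mollifier e (x::real^'n::finite) \<ge> 0"
  unfolding mollifier_def by (intro divide_nonneg_pos bump_nonneg integral_bump_pos)

lemma mollifier_eq_0: "e > 0 \<Longrightarrow> norm x \<ge> e \<Longrightarrow> mollifier e x = 0"
  by (simp add: mollifier_def bump_eq_0)

lemma mollifier_minus: "mollifier e (- x) = mollifier e x"
  by (simp add: mollifier_def bump_def)

lemma smooth_mollifier_diff: "smooth (\<lambda>x::real^'n::finite. mollifier e (x - a))"
proof -
  have "bump_class (\<lambda>x::real^'n. (1 / (LINT y|lborel. bump e (y::real^'n))) * bump e (x - a))"
    by (intro bump_class.mult bump_class.const bump_class_bump)
  then show ?thesis by (auto simp: mollifier_def intro: smooth_bump_class)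
qed

lemma smooth_mollifier: "smooth (mollifier e)"
  using smooth_mollifier_diff[of e 0] by simp

lemma continuous_on_mollifier: "continuous_on UNIV (mollifier e)"
  by (rule smooth_continuous[OF smooth_mollifier])

lemma integrable_mollifier: "e > 0 \<Longrightarrow> integrable lborel (mollifier e)"
  unfolding mollifier_def by (intro integrable_divide integrable_bump)

lemma integral_mollifier: "e > 0 \<Longrightarrow> (LINT x|lborel. mollifier e (x::real^'n::finite)) = 1"
  unfolding mollifier_def using integral_bump_pos[of e, where 'n='n] by simp

section \<open>Convolution and mollification in \<open>L\<^sup>p\<close>\<close>

lemma powr_add_le:
  fixes a b p :: real
  assumes "a \<ge> 0" "b \<ge> 0" "p \<ge> 0"
  shows "(a + b) powr p \<le> 2 powr p * (a powr p + b powr p)"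
proof -
  have "(a + b) powr p \<le> (2 * max a b) powr p"
    using assms by (intro powr_mono2) auto
  also have "\<dots> = 2 powr p * max a b powr p" using assms by (simp add: powr_mult)
  also have "\<dots> \<le> 2 powr p * (a powr p + b powr p)"
    by (intro mult_left_mono) (auto simp: max_def)
  finally show ?thesis .
qed

text \<open>Young's inequality with a free weight and without optimal constants: if b <= d a, the
  product is at most the first term, otherwise a < b / d makes it at most the second. The parameter
  \<open>d\<close> decides how much energy is left for absorption.\<close>

lemma powr_mult_le_split:
  fixes a b p d :: real
  assumes "a \<ge> 0" "b \<ge> 0" "p > 1" "d > 0"
  shows "a powr (p - 1) * b \<le> d * a powr p + d powr (1 - p) * b powr p"
proof (cases "b \<le> d * a")
  case True
  have "a powr (p - 1) * b \<le> a powr (p - 1) * (d * a)"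
    using True by (intro mult_left_mono) auto
  also have "\<dots> = d * a powr p"
    using assms by (cases "a = 0") (auto simp: powr_diff)
  finally show ?thesis by (smt (verit) mult_nonneg_nonneg powr_ge_zero)
next
  case False
  then have "a \<le> b / d" using assms by (simp add: field_simps)
  then have "a powr (p - 1) * b \<le> (b / d) powr (p - 1) * b"
    using assms by (intro mult_right_mono powr_mono2) auto
  also have "\<dots> = d powr (1 - p) * b powr p"
  proof (cases "b = 0")
    case False
    then have "b powr p = b powr (p - 1) * b" using assms by (simp add: powr_diff)
    moreover have "d powr (1 - p) = 1 / d powr (p - 1)"
      by (metis minus_diff_eq powr_minus_divide)
    ultimately show ?thesis using assms by (simp add: powr_divide)
  qed simp
  finally show ?thesis using assms by (smt (verit) mult_nonneg_nonneg powr_ge_zero)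
qed

text \<open>Jensen's inequality for t^p with an unnormalized weight, possibly of zero mass. It comes
  from integrating the tangent line inequality of t^p at the weighted mean of
  \<open>norm (G x)\<close>.\<close>

lemma weighted_power_mean:
  fixes G :: "'a \<Rightarrow> 'b::{banach, second_countable_topology}" and w :: "'a \<Rightarrow> real"
  assumes p: "p > 1" and w: "integrable M w" "\<And>x. w x \<ge> 0"
    and G: "G \<in> borel_measurable M" "integrable M (\<lambda>x. w x * norm (G x) powr p)"
  shows "integrable M (\<lambda>x. w x *\<^sub>R G x)"
    and "norm (LINT x|M. w x *\<^sub>R G x) powr p \<le> (LINT x|M. w x) powr (p - 1) * (LINT x|M. w x * norm (G x) powr p)"
proof -
  \<comment> \<open>Derives the integrability of the weighted norm from that of the weight and of
    the weighted p-th power.\<close>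
  have le: "t \<le> 1 + t powr p" if "t \<ge> 0" for t
  proof (cases "t \<le> 1")
    case True
    then show ?thesis by (smt (verit) powr_ge_zero)
  next
    case False
    then have "t powr 1 \<le> t powr p" using p by (intro powr_mono) auto
    then show ?thesis using False by simp
  qed
  have int: "integrable M (\<lambda>x. w x * norm (G x))"
  proof (rule Bochner_Integration.integrable_bound[of M "\<lambda>x. w x + w x * norm (G x) powr p"])
    show "(\<lambda>x. w x * norm (G x)) \<in> borel_measurable M" using w G by measurable
    show "AE x in M. norm (w x * norm (G x)) \<le> norm (w x + w x * norm (G x) powr p)"
    proof (rule AE_I2)
      fix x
      have "w x * norm (G x) \<le> w x * (1 + norm (G x) powr p)"
        using w le[of "norm (G x)"] by (intro mult_left_mono) auto
      then show "norm (w x * norm (G x)) \<le> norm (w x + w x * norm (G x) powr p)"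
        using w(2)[of x] by (simp add: distrib_left)
    qed
  qed (use w G in auto)
  then show iG: "integrable M (\<lambda>x. w x *\<^sub>R G x)"
    using w G by (subst integrable_norm_iff[symmetric]) (auto intro!: borel_measurable_scaleR)
  let ?s = "LINT x|M. w x * norm (G x)" and ?m = "LINT x|M. w x"
  let ?E = "LINT x|M. w x * norm (G x) powr p"
  have m0: "?m \<ge> 0" and E0: "?E \<ge> 0" and s0: "?s \<ge> 0" using w by auto
  have "norm (LINT x|M. w x *\<^sub>R G x) \<le> (LINT x|M. norm (w x *\<^sub>R G x))" by (rule integral_norm_bound)
  also have "\<dots> = ?s" using w by simp
  finally have "norm (LINT x|M. w x *\<^sub>R G x) powr p \<le> ?s powr p" using p by (intro powr_mono2) auto
  also have "\<dots> \<le> ?m powr (p - 1) * ?E"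
  proof (cases "?s = 0")
    case True
    then show ?thesis using E0 p by simp
  next
    case False
    then have s: "?s > 0" using s0 by simp
    have "?m \<noteq> 0"
    proof
      assume "?m = 0"
      then have "AE x in M. w x = 0" using integral_nonneg_eq_0_iff_AE[OF w(1)] w(2) by simp
      then have "?s = (LINT x|M. 0)" using w G by (intro integral_cong_AE) auto
      then show False using s by simp
    qed
    then have m: "?m > 0" using m0 by simp
    \<comment> \<open>The weighted mean of \<open>norm (G x)\<close>; Young's inequality with second
      factor b^(p - 1) is the tangent inequality of t^p / p at t = b.\<close>
    define b where "b = ?s / ?m"
    have b: "b > 0" using s m by (simp add: b_def)
    have pt: "b powr (p - 1) * norm (G x) \<le> norm (G x) powr p / p + (1 - 1 / p) * b powr p" for x
    proof -
      have "(b powr (p - 1)) powr (p / (p - 1)) = b powr p" using p by (simp add: powr_powr)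
      moreover have "1 / (p / (p - 1)) = 1 - 1 / p" using p by (simp add: field_simps)
      moreover have "p / (p - 1) > 1" "1 / p + 1 / (p / (p - 1)) = 1" using p by (simp_all add: field_simps)
      ultimately show ?thesis
        using Youngs_inequality[of p "p / (p - 1)" "norm (G x)" "b powr (p - 1)"] p b
        by (simp add: mult.commute divide_inverse)
    qed
    have "b powr p = b powr (p - 1) * b" using b by (simp add: powr_diff)
    moreover have "b * ?m = ?s" using m by (simp add: b_def)
    ultimately have "b powr p * ?m = b powr (p - 1) * ?s" by (simp add: mult.assoc)
    also have "\<dots> = (LINT x|M. w x * (b powr (p - 1) * norm (G x)))"
      by (subst integral_mult_right_zero[symmetric]) (simp add: ac_simps)
    also have "\<dots> \<le> (LINT x|M. w x * norm (G x) powr p * (1 / p) + w x * ((1 - 1 / p) * b powr p))"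
    proof (rule integral_mono)
      show "integrable M (\<lambda>x. w x * (b powr (p - 1) * norm (G x)))"
        using integrable_mult_right[OF int, of "b powr (p - 1)"] by (simp add: ac_simps)
      show "integrable M (\<lambda>x. w x * norm (G x) powr p * (1 / p) + w x * ((1 - 1 / p) * b powr p))"
        using w G by (intro Bochner_Integration.integrable_add integrable_mult_left) auto
      show "w x * (b powr (p - 1) * norm (G x)) \<le> w x * norm (G x) powr p * (1 / p) + w x * ((1 - 1 / p) * b powr p)" for x
        using mult_left_mono[OF pt[of x] w(2)[of x]] by (simp add: distrib_left)
    qed
    also have "\<dots> = ?E * (1 / p) + ?m * ((1 - 1 / p) * b powr p)"
      using w G by (subst Bochner_Integration.integral_add)
        (auto simp only: integral_mult_left_zero intro!: integrable_mult_left)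
    finally have "b powr p * ?m * (1 / p) \<le> ?E * (1 / p)" by (simp add: algebra_simps)
    then have "b powr p * ?m \<le> ?E" using p by (simp add: field_simps)
    then have "?m powr (p - 1) * (b powr p * ?m) \<le> ?m powr (p - 1) * ?E"
      by (intro mult_left_mono) auto
    moreover have "?s powr p = ?m powr (p - 1) * (b powr p * ?m)"
      using m s p by (simp add: b_def powr_divide powr_diff)
    ultimately show ?thesis by simp
  qed
  finally show "norm (LINT x|M. w x *\<^sub>R G x) powr p \<le> ?m powr (p - 1) * ?E" .
qed

section \<open>Convolution with continuous functions of compact support\<close>

lemma uniformly_continuous_compact_support:
  fixes f :: "'a::euclidean_space \<Rightarrow> 'b::real_normed_vector"
  assumes c: "continuous_on UNIV f" and z: "\<And>x. norm x > R \<Longrightarrow> f x = 0" and e: "e > 0"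
  obtains d where "d > 0" "\<And>x y. dist y x < d \<Longrightarrow> dist (f y) (f x) < e"
proof -
  \<comment> \<open>The margin 1 ensures that two points closer than 1, one of them beyond
    \<open>R + 1\<close>, both lie outside the support.\<close>
  have "uniformly_continuous_on (cball 0 (R + 1)) f"
    using c by (intro compact_uniformly_continuous) (auto intro: continuous_on_subset)
  then obtain d where d: "d > 0" "\<And>x y. x \<in> cball 0 (R + 1) \<Longrightarrow> y \<in> cball 0 (R + 1) \<Longrightarrow> dist y x < d \<Longrightarrow> dist (f y) (f x) < e"
    unfolding uniformly_continuous_on_def using e by metis
  have "dist (f y) (f x) < e" if "dist y x < min d 1" for x y
  proof (cases "x \<in> cball 0 (R + 1) \<and> y \<in> cball 0 (R + 1)")
    case True
    then show ?thesis using d that by auto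
  next
    case False
    have "norm x \<le> norm y + dist y x" "norm y \<le> norm x + dist y x"
      by (metis norm_triangle_sub dist_norm add.commute norm_minus_commute)+
    then have "norm x > R" "norm y > R" using False that by (auto simp: not_le)
    then show ?thesis using z e by simp
  qed
  then show ?thesis using d(1) by (intro that[of "min d 1"]) auto
qed

lemma bounded_compact_support:
  fixes f :: "'a::euclidean_space \<Rightarrow> 'b::real_normed_vector"
  assumes c: "continuous_on UNIV f" and z: "\<And>x. norm x > R \<Longrightarrow> f x = 0"
  obtains B where "B > 0" "\<And>x. norm (f x) \<le> B"
proof -
  have "compact (f ` cball 0 R)"
    using c by (intro compact_continuous_image) (auto intro: continuous_on_subset)
  then obtain B where B: "B > 0" "\<And>y. y \<in> f ` cball 0 R \<Longrightarrow> norm y \<le> B"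
    using compact_imp_bounded bounded_pos by metis
  have "norm (f x) \<le> B" for x
    using B z[of x] by (cases "norm x \<le> R") (auto simp: not_le)
  then show ?thesis using that B by blast
qed

lemma GDERIV_linearization:
  fixes f :: "'a::euclidean_space \<Rightarrow> real"
  assumes D: "\<And>x. GDERIV f x :> D x"
    and B: "\<And>z. norm (z - x) \<le> norm h \<Longrightarrow> norm (D z - D x) \<le> e"
  shows "\<bar>f (x + h) - f x - h \<bullet> D x\<bar> \<le> e * norm h"
proof -
  have "norm (f (x + h) - f x - (\<lambda>k. k \<bullet> D x) ((x + h) - x)) \<le> norm ((x + h) - x) * e"
  proof (rule differentiable_bound_linearization[where S="cball x (norm h)" and f'="\<lambda>z k. k \<bullet> D z"])
    show "x + t *\<^sub>R (x + h - x) \<in> cball x (norm h)" if "t \<in> {0..1}" for t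
      using that by (auto simp: dist_norm mult_left_le_one_le)
    show "(f has_derivative (\<lambda>k. k \<bullet> D z)) (at z within cball x (norm h))" for z
      using D[of z] unfolding gderiv_def by (rule has_derivative_at_withinI)
    show "onorm ((\<lambda>k. k \<bullet> D z) - (\<lambda>k. k \<bullet> D x)) \<le> e" if "z \<in> cball x (norm h)" for z
    proof (rule onorm_le)
      fix k
      have "norm (((\<lambda>k. k \<bullet> D z) - (\<lambda>k. k \<bullet> D x)) k) = \<bar>k \<bullet> (D z - D x)\<bar>" by (simp add: inner_diff_right)
      also have "\<dots> \<le> norm k * norm (D z - D x)" by (rule Cauchy_Schwarz_ineq2)
      also have "\<dots> \<le> norm k * e" using that B[of z] by (intro mult_left_mono) (auto simp: dist_norm norm_minus_commute)
      finally show "norm (((\<lambda>k. k \<bullet> D z) - (\<lambda>k. k \<bullet> D x)) k) \<le> e * norm k" by (simp add: mult.commute)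
    qed
  qed simp
  then show ?thesis by (simp add: mult.commute)
qed

lemma integrable_conv:
  fixes \<phi> :: "'a::euclidean_space \<Rightarrow> 'b::euclidean_space"
  assumes w: "integrable lborel w" and c: "continuous_on UNIV \<phi>" and z: "\<And>x. norm x > R \<Longrightarrow> \<phi> x = 0"
  shows "integrable lborel (\<lambda>y. w y *\<^sub>R \<phi> (x - y))"
proof -
  obtain B where B: "B > 0" "\<And>x. norm (\<phi> x) \<le> B" using bounded_compact_support[OF c z] by metis
  have [measurable]: "\<phi> \<in> borel_measurable borel" using c by (rule borel_measurable_continuous_onI)
  show ?thesis
  proof (rule Bochner_Integration.integrable_bound[of _ "\<lambda>y. B * norm (w y)"])
    show "AE y in lborel. norm (w y *\<^sub>R \<phi> (x - y)) \<le> norm (B * norm (w y))"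
      using B by (auto intro!: AE_I2 simp: abs_mult mult.commute[of B] intro: mult_left_mono)
  qed (use w in auto)
qed

text \<open>Serves to choose an error small compared with an integral \<open>t\<close> that may
  vanish; the added 1 keeps the quotient meaningful in that case.\<close>

lemma mult_divide_add_one_less:
  fixes e t :: real
  assumes "t \<ge> 0" "e > 0" shows "t * (e / (t + 1)) < e"
  using assms by (simp add: field_simps add_pos_nonneg)

lemma continuous_conv:
  fixes \<phi> :: "'a::euclidean_space \<Rightarrow> 'b::euclidean_space"
  assumes w: "integrable lborel w" and c: "continuous_on UNIV \<phi>" and z: "\<And>x. norm x > R \<Longrightarrow> \<phi> x = 0"
  shows "continuous_on UNIV (\<lambda>x. LINT y|lborel. w y *\<^sub>R \<phi> (x - y))"
proof -
  let ?I = "\<lambda>x. LINT y|lborel. w y *\<^sub>R \<phi> (x - y)"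
  let ?m = "LINT y|lborel. norm (w y)"
  have "isCont ?I x" for x
    unfolding continuous_at_eps_delta
  proof (intro allI impI)
    fix e :: real assume e: "e > 0"
    have m: "?m \<ge> 0" by simp
    have "e / (?m + 1) > 0" using e m by (intro divide_pos_pos add_nonneg_pos) auto
    then obtain d where d: "d > 0" "\<And>x y. dist y x < d \<Longrightarrow> dist (\<phi> y) (\<phi> x) < e / (?m + 1)"
      using uniformly_continuous_compact_support[OF c z] by metis
    have "dist (?I x') (?I x) < e" if "dist x' x < d" for x'
    proof -
      have "?I x' - ?I x = (LINT y|lborel. w y *\<^sub>R \<phi> (x' - y) - w y *\<^sub>R \<phi> (x - y))"
        by (rule Bochner_Integration.integral_diff[symmetric]) (rule integrable_conv[OF w c z], assumption)+
      then have "norm (?I x' - ?I x) \<le> (LINT y|lborel. norm (w y *\<^sub>R \<phi> (x' - y) - w y *\<^sub>R \<phi> (x - y)))"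
        by (simp only: integral_norm_bound)
      also have "\<dots> \<le> (LINT y|lborel. norm (w y) * (e / (?m + 1)))"
      proof (rule integral_mono)
        show "integrable lborel (\<lambda>y. norm (w y *\<^sub>R \<phi> (x' - y) - w y *\<^sub>R \<phi> (x - y)))"
          by (intro integrable_norm Bochner_Integration.integrable_diff integrable_conv[OF w c z]) auto
        show "norm (w y *\<^sub>R \<phi> (x' - y) - w y *\<^sub>R \<phi> (x - y)) \<le> norm (w y) * (e / (?m + 1))" for y
        proof -
          have "dist (x' - y) (x - y) < d" using that by (simp add: dist_norm)
          from d(2)[OF this] have "norm (\<phi> (x' - y) - \<phi> (x - y)) \<le> e / (?m + 1)" by (simp add: dist_norm)
          then show ?thesis unfolding scaleR_diff_right[symmetric] norm_scaleR
            by (intro mult_mono) auto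
        qed
      qed (use w in auto)
      also have "\<dots> = ?m * (e / (?m + 1))" by simp
      also have "\<dots> < e" using mult_divide_add_one_less[OF m e] .
      finally show ?thesis by (simp add: dist_norm)
    qed
    then show "\<exists>d>0. \<forall>x'. dist x' x < d \<longrightarrow> dist (?I x') (?I x) < e" using d(1) by blast
  qed
  then show ?thesis by (simp add: continuous_at_imp_continuous_on)
qed

text \<open>Differentiation under the integral sign. As \<open>D\<close> is uniformly continuous,
  one radius \<open>d\<close> controls the linearization error of every translate of \<phi>, and
  integration against \<open>w\<close> keeps it at most \<open>e * norm (x' - x)\<close>.\<close>

lemma GDERIV_conv:
  fixes \<phi> :: "'a::euclidean_space \<Rightarrow> real"
  assumes w: "integrable lborel w" and D: "\<And>x. GDERIV \<phi> x :> D x" and c: "continuous_on UNIV D"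
    and z: "\<And>x. norm x > R \<Longrightarrow> \<phi> x = 0" "\<And>x. norm x > R \<Longrightarrow> D x = 0"
  shows "GDERIV (\<lambda>x. LINT y|lborel. w y * \<phi> (x - y)) x :> (LINT y|lborel. w y *\<^sub>R D (x - y))"
  unfolding gderiv_def has_derivative_at_alt
proof (intro conjI allI impI)
  have c0: "continuous_on UNIV \<phi>"
    by (rule GDERIV_continuous_on[OF D])
  have i0: "integrable lborel (\<lambda>y. w y * \<phi> (x - y))" for x
    using integrable_conv[OF w c0 z(1)] by simp
  have i1: "integrable lborel (\<lambda>y. w y *\<^sub>R D (x - y))" for x by (rule integrable_conv[OF w c z(2)])
  let ?I = "\<lambda>x. LINT y|lborel. w y * \<phi> (x - y)"
  let ?J = "LINT y|lborel. w y *\<^sub>R D (x - y)"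
  let ?m = "LINT y|lborel. norm (w y)"
  show "bounded_linear (\<lambda>h. h \<bullet> ?J)" by (rule bounded_linear_inner_left)
  fix e :: real assume e: "e > 0"
  have m: "?m \<ge> 0" by simp
  define e' where "e' = e / (?m + 1)"
  have e': "e' > 0" unfolding e'_def using e m by (intro divide_pos_pos add_nonneg_pos) auto
  obtain d where d: "d > 0" "\<And>x y. dist y x < d \<Longrightarrow> dist (D y) (D x) < e'"
    using uniformly_continuous_compact_support[OF c z(2) e'] by metis
  have "norm (?I x' - ?I x - (x' - x) \<bullet> ?J) \<le> e * norm (x' - x)" if x': "norm (x' - x) < d" for x'
  proof -
    let ?h = "x' - x"
    let ?q = "\<lambda>y. w y * \<phi> (x' - y) - w y * \<phi> (x - y) - ?h \<bullet> (w y *\<^sub>R D (x - y))"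
    have iq: "integrable lborel ?q"
      by (intro Bochner_Integration.integrable_diff i0 integrable_inner_right i1)
    have "?h \<bullet> ?J = (LINT y|lborel. ?h \<bullet> (w y *\<^sub>R D (x - y)))"
      by (rule integral_inner_right[symmetric]) (rule i1)
    then have "?I x' - ?I x - ?h \<bullet> ?J = (LINT y|lborel. ?q y)"
      by (simp only: Bochner_Integration.integral_diff[OF Bochner_Integration.integrable_diff[OF i0 i0] integrable_inner_right[OF i1]]
          Bochner_Integration.integral_diff[OF i0 i0])
    then have "norm (?I x' - ?I x - ?h \<bullet> ?J) \<le> (LINT y|lborel. norm (?q y))" by (simp only: integral_norm_bound)
    also have "\<dots> \<le> (LINT y|lborel. norm (w y) * (e' * norm ?h))"
    proof (rule integral_mono)
      show "integrable lborel (\<lambda>y. norm (?q y))" using iq by (rule integrable_norm)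
      fix y
      have "\<bar>\<phi> ((x - y) + ?h) - \<phi> (x - y) - ?h \<bullet> D (x - y)\<bar> \<le> e' * norm ?h"
      proof (rule GDERIV_linearization[OF D])
        fix z assume "norm (z - (x - y)) \<le> norm ?h"
        then have "dist z (x - y) < d" using x' by (simp add: dist_norm)
        from d(2)[OF this] show "norm (D z - D (x - y)) \<le> e'" by (simp add: dist_norm)
      qed
      then have "\<bar>w y\<bar> * \<bar>\<phi> (x' - y) - \<phi> (x - y) - ?h \<bullet> D (x - y)\<bar> \<le> \<bar>w y\<bar> * (e' * norm ?h)"
        by (intro mult_left_mono) (auto simp: algebra_simps)
      moreover have "?q y = w y * (\<phi> (x' - y) - \<phi> (x - y) - ?h \<bullet> D (x - y))"
        by (simp add: algebra_simps)
      ultimately show "norm (?q y) \<le> norm (w y) * (e' * norm ?h)" by (simp add: abs_mult)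
    qed (use w in auto)
    also have "\<dots> = ?m * e' * norm ?h" by simp
    also have "\<dots> \<le> e * norm ?h"
      using mult_divide_add_one_less[OF m e] by (intro mult_right_mono) (auto simp: e'_def)
    finally show ?thesis .
  qed
  then show "\<exists>d>0. \<forall>y. norm (y - x) < d \<longrightarrow> norm (?I y - ?I x - (y - x) \<bullet> ?J) \<le> e * norm (y - x)"
    using d(1) by blast
qed


section \<open>Invariance of the integral and continuity of translations in L^1\<close>

lemma distr_lborel_reflect:
  fixes c :: "'a::euclidean_space"
  shows "distr lborel borel (\<lambda>y. c - y) = lborel"
  by (subst (2) lborel_affine[of "-1" c]) (auto simp: density_1)

lemma nn_integral_shift:
  fixes c :: "'a::euclidean_space"
  assumes [measurable]: "f \<in> borel_measurable borel"
  shows "(\<integral>\<^sup>+y. f (y - c) \<partial>lborel) = (\<integral>\<^sup>+y. f y \<partial>lborel)"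
  by (subst (2) lborel_distr_plus[of "-c", symmetric]) (simp add: nn_integral_distr)

lemma integral_reflect:
  fixes c :: "'a::euclidean_space" and f :: "'a \<Rightarrow> 'b::{banach, second_countable_topology}"
  assumes [measurable]: "f \<in> borel_measurable borel"
  shows "(LINT y|lborel. f (c - y)) = (LINT y|lborel. f y)"
  by (subst (2) distr_lborel_reflect[of c, symmetric]) (simp add: integral_distr)

text \<open>The set is squeezed between a compact \<open>K\<close> and an open \<open>U\<close>
  whose difference is small. A shift shorter than the distance from \<open>K\<close> to the
  complement of \<open>U\<close> changes the indicator only on \<open>U - K\<close> and on its
  translate.\<close>

lemma nn_integral_translation_indicator:
  fixes A :: "'a::euclidean_space set"
  assumes A[measurable]: "A \<in> sets borel" and fin: "emeasure lborel A < \<infinity>" and e: "e > 0"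
  shows "\<exists>d>0. \<forall>h. norm h < d \<longrightarrow>
    (\<integral>\<^sup>+x. ennreal (\<bar>indicator A (x - h) - indicator A x\<bar>) \<partial>lborel) \<le> ennreal e"
proof -
  obtain U where U: "open U" "A \<subseteq> U" "emeasure lebesgue (U - A) < ennreal (e / 4)"
    using sets_lebesgue_outer_open[of A "e / 4"] e A by (metis divide_pos_pos sets_completionI_sets sets_lborel zero_less_numeral)
  have [measurable]: "U \<in> sets borel" using U(1) by simp
  \<comment> \<open>Inner regularity is stated for finite measures, so Lebesgue measure is first
    restricted to \<open>A\<close>.\<close>
  let ?M = "density lborel (indicator A)"
  have M: "emeasure ?M B = emeasure lborel (A \<inter> B)" if "B \<in> sets borel" for B
    using that by (simp add: emeasure_density indicator_inter_arith[symmetric])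
  have "emeasure ?M A = (SUP K \<in> {K. K \<subseteq> A \<and> compact K}. emeasure ?M K)"
    using fin M[of UNIV] by (intro inner_regular) auto
  then have sup: "emeasure lborel A = (SUP K \<in> {K. K \<subseteq> A \<and> compact K}. emeasure ?M K)"
    using M[of A] by simp
  have "\<exists>K. K \<subseteq> A \<and> compact K \<and> emeasure lborel A \<le> emeasure lborel K + ennreal (e / 4)"
  proof (cases "emeasure lborel A = 0")
    case True
    then show ?thesis using e by (intro exI[of _ "{}"]) auto
  next
    case False
    then have "emeasure lborel A - ennreal (e / 4) < emeasure lborel A"
      using e fin by (intro ennreal_between) (auto simp: zero_less_iff_neq_zero)
    then obtain K where K: "K \<subseteq> A" "compact K" "emeasure lborel A - ennreal (e / 4) < emeasure ?M K"
      unfolding sup less_SUP_iff by auto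
    have "emeasure ?M K = emeasure lborel K"
      using K M[of K] by (simp add: borel_compact Int_absorb1)
    then have "emeasure lborel A \<le> emeasure lborel K + ennreal (e / 4)"
      using less_imp_le[OF K(3)] by (simp add: ennreal_minus_le_iff add.commute)
    then show ?thesis using K by blast
  qed
  then obtain K where K: "K \<subseteq> A" "compact K" "emeasure lborel A \<le> emeasure lborel K + ennreal (e / 4)" by blast
  have [measurable]: "K \<in> sets borel" using K(2) by (rule borel_compact)
  have finK: "emeasure lborel K \<noteq> \<infinity>" using emeasure_compact_finite[OF K(2)] by simp
  have "emeasure lborel (A - K) = emeasure lborel A - emeasure lborel K"
    using K finK by (intro emeasure_Diff) auto
  also have "\<dots> \<le> ennreal (e / 4)" using K(3) finK by (simp add: ennreal_minus_le_iff)
  finally have "emeasure lborel (A - K) \<le> ennreal (e / 4)" .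
  moreover have "emeasure lborel (U - A) \<le> ennreal (e / 4)" using U(3) by simp
  moreover have "U - K = (U - A) \<union> (A - K)" using U K by auto
  then have "emeasure lborel (U - K) \<le> emeasure lborel (U - A) + emeasure lborel (A - K)"
    using emeasure_subadditive[of "U - A" lborel "A - K"] by simp
  ultimately have "emeasure lborel (U - K) \<le> ennreal (e / 4) + ennreal (e / 4)"
    by (meson add_mono order_trans)
  also have "\<dots> = ennreal (e / 2)" using e by (simp flip: ennreal_plus)
  finally have UK: "emeasure lborel (U - K) \<le> ennreal (e / 2)" .
  obtain d where d: "d > 0" "\<And>x y. x \<in> K \<Longrightarrow> y \<in> - U \<Longrightarrow> d \<le> dist x y"
  proof -
    have cl: "closed (- U)" and dj: "K \<inter> - U = {}" using U K by auto
    obtain d where "d > 0" "\<forall>x\<in>K. \<forall>y\<in>- U. d \<le> dist x y"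
      using separate_compact_closed[OF K(2) cl dj] by blast
    then show ?thesis using that[of d] by simp
  qed
  have "(\<integral>\<^sup>+x. ennreal (\<bar>indicator A (x - h) - indicator A x\<bar>) \<partial>lborel) \<le> ennreal e" if h: "norm h < d" for h
  proof -
    have inU: "x - h \<in> U" "x + h \<in> U" if "x \<in> K" for x
      using d(2)[OF that, of "x - h"] d(2)[OF that, of "x + h"] h by (auto simp: dist_norm)
    have "ennreal (\<bar>indicator A (x - h) - indicator A x\<bar>) \<le> indicator (U - K) x + indicator (U - K) (x - h)" for x
      using inU[of x] inU(2)[of "x - h"] U(2) K(1)
      by (cases "x \<in> A"; cases "x - h \<in> A"; cases "x \<in> K"; cases "x - h \<in> K") (auto simp: indicator_def)
    then have "(\<integral>\<^sup>+x. ennreal (\<bar>indicator A (x - h) - indicator A x\<bar>) \<partial>lborel)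
        \<le> (\<integral>\<^sup>+x. indicator (U - K) x + indicator (U - K) (x - h) \<partial>lborel)"
      by (intro nn_integral_mono) auto
    also have "\<dots> = (\<integral>\<^sup>+x. indicator (U - K) x \<partial>lborel) + (\<integral>\<^sup>+x. indicator (U - K) (x - h) \<partial>lborel)"
      by (intro nn_integral_add) auto
    also have "(\<integral>\<^sup>+x. indicator (U - K) (x - h) \<partial>lborel) = (\<integral>\<^sup>+x. indicator (U - K) x \<partial>lborel)"
      by (rule nn_integral_shift) simp
    also have "(\<integral>\<^sup>+x. indicator (U - K) x \<partial>lborel) = emeasure lborel (U - K)" by simp
    also have "emeasure lborel (U - K) + emeasure lborel (U - K) \<le> ennreal (e / 2) + ennreal (e / 2)"
      using UK by (intro add_mono)
    also have "\<dots> = ennreal e" using e by (simp flip: ennreal_plus)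
    finally show ?thesis .
  qed
  then show ?thesis using d(1) by blast
qed

text \<open>Induction over integrable functions: indicators, sums, dominated limits. In the limit
  case the error is split into three thirds, two of which coincide by translation
  invariance.\<close>

lemma nn_integral_translation_continuous:
  fixes f :: "'a::euclidean_space \<Rightarrow> 'b::{banach, second_countable_topology}"
  assumes "integrable lborel f" "e > 0"
  shows "\<exists>d>0. \<forall>h. norm h < d \<longrightarrow> (\<integral>\<^sup>+x. ennreal (norm (f (x - h) - f x)) \<partial>lborel) \<le> ennreal e"
  using assms
proof (induction arbitrary: e rule: integrable_induct)
  case (base A c)
  have "\<exists>d>0. \<forall>h. norm h < d \<longrightarrow>
    (\<integral>\<^sup>+x. ennreal (\<bar>indicator A (x - h) - indicator A x\<bar>) \<partial>lborel) \<le> ennreal (e / (norm c + 1))"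
    using base by (intro nn_integral_translation_indicator) (auto intro!: divide_pos_pos add_nonneg_pos)
  then obtain d where d: "d > 0" "\<And>h. norm h < d \<Longrightarrow>
    (\<integral>\<^sup>+x. ennreal (\<bar>indicator A (x - h) - indicator A x\<bar>) \<partial>lborel) \<le> ennreal (e / (norm c + 1))" by blast
  have [measurable]: "A \<in> sets borel" using base by simp
  have "(\<integral>\<^sup>+x. ennreal (norm (indicator A (x - h) *\<^sub>R c - indicator A x *\<^sub>R c)) \<partial>lborel) \<le> ennreal e" if "norm h < d" for h
  proof -
    have "norm (indicator A (x - h) *\<^sub>R c - indicator A x *\<^sub>R c) = norm c * \<bar>indicator A (x - h) - indicator A x\<bar>" for x
      by (simp flip: scaleR_diff_left)
    then have "(\<integral>\<^sup>+x. ennreal (norm (indicator A (x - h) *\<^sub>R c - indicator A x *\<^sub>R c)) \<partial>lborel)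
      = (\<integral>\<^sup>+x. ennreal (norm c) * ennreal \<bar>indicator A (x - h) - indicator A x\<bar> \<partial>lborel)"
      by (simp add: ennreal_mult)
    also have "\<dots> = ennreal (norm c) * (\<integral>\<^sup>+x. ennreal \<bar>indicator A (x - h) - indicator A x\<bar> \<partial>lborel)"
      by (rule nn_integral_cmult) measurable
    also have "\<dots> \<le> ennreal (norm c) * ennreal (e / (norm c + 1))" using d(2)[OF that] by (rule mult_left_mono) simp
    also have "\<dots> = ennreal (norm c * (e / (norm c + 1)))" using base by (intro ennreal_mult[symmetric]) auto
    also have "\<dots> \<le> ennreal e" using base by (intro ennreal_leI) (simp add: field_simps add_pos_nonneg)
    finally show ?thesis .
  qed
  then show ?case using d(1) by blast
next
  case (add f g)
  have [measurable]: "f \<in> borel_measurable borel" "g \<in> borel_measurable borel" using add.hyps by auto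
  obtain d1 where d1: "d1 > 0" "\<And>h. norm h < d1 \<Longrightarrow> (\<integral>\<^sup>+x. ennreal (norm (f (x - h) - f x)) \<partial>lborel) \<le> ennreal (e / 2)"
    using add.IH(1)[of "e / 2"] add.prems by auto
  obtain d2 where d2: "d2 > 0" "\<And>h. norm h < d2 \<Longrightarrow> (\<integral>\<^sup>+x. ennreal (norm (g (x - h) - g x)) \<partial>lborel) \<le> ennreal (e / 2)"
    using add.IH(2)[of "e / 2"] add.prems by auto
  have "(\<integral>\<^sup>+x. ennreal (norm (f (x - h) + g (x - h) - (f x + g x))) \<partial>lborel) \<le> ennreal e" if "norm h < min d1 d2" for h
  proof -
    have "(\<integral>\<^sup>+x. ennreal (norm (f (x - h) + g (x - h) - (f x + g x))) \<partial>lborel)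
      \<le> (\<integral>\<^sup>+x. ennreal (norm (f (x - h) - f x)) + ennreal (norm (g (x - h) - g x)) \<partial>lborel)"
      by (intro nn_integral_mono) (auto simp flip: ennreal_plus intro!: ennreal_leI norm_diff_triangle_ineq)
    also have "\<dots> = (\<integral>\<^sup>+x. ennreal (norm (f (x - h) - f x)) \<partial>lborel) + (\<integral>\<^sup>+x. ennreal (norm (g (x - h) - g x)) \<partial>lborel)"
      by (rule nn_integral_add) measurable
    also have "\<dots> \<le> ennreal (e / 2) + ennreal (e / 2)" using d1(2) d2(2) that by (intro add_mono) auto
    also have "\<dots> = ennreal e" using add.prems by (simp flip: ennreal_plus)
    finally show ?thesis .
  qed
  then show ?case using d1(1) d2(1) by (intro exI[of _ "min d1 d2"]) auto
next
  case (lim f s)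
  have [measurable]: "s i \<in> borel_measurable borel" for i using lim.hyps(1)[of i] by auto
  have [measurable]: "f \<in> borel_measurable borel" using lim.hyps by auto
  \<comment> \<open>The approximants satisfy \<open>norm (s i x) <= 2 * norm (f x)\<close>, whence
    the dominating function \<open>3 * norm (f x)\<close>.\<close>
  have "(\<lambda>i. \<integral>\<^sup>+x. norm (s i x - f x) \<partial>lborel) \<longlonglongrightarrow> (\<integral>\<^sup>+x. 0 \<partial>(lborel :: 'a measure))"
  proof (rule nn_integral_dominated_convergence[where w="\<lambda>x. ennreal (3 * norm (f x))"
        and u="\<lambda>i x. ennreal (norm (s i x - f x))" and u'="\<lambda>x. 0"])
    show "AE x in lborel. ennreal (norm (s i x - f x)) \<le> ennreal (3 * norm (f x))" for i
    proof (rule AE_I2)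
      fix x have "norm (s i x - f x) \<le> norm (s i x) + norm (f x)" by (rule norm_triangle_ineq4)
      also have "\<dots> \<le> 3 * norm (f x)" using lim.hyps(3)[of x i] by simp
      finally show "ennreal (norm (s i x - f x)) \<le> ennreal (3 * norm (f x))" by (rule ennreal_leI)
    qed
    have "integrable lborel (\<lambda>x. 3 * norm (f x))" using lim.hyps(4) by auto
    then show "(\<integral>\<^sup>+x. ennreal (3 * norm (f x)) \<partial>lborel) < \<infinity>"
      by (simp add: nn_integral_eq_integral)
    show "AE x in lborel. (\<lambda>i. ennreal (norm (s i x - f x))) \<longlonglongrightarrow> 0"
    proof (rule AE_I2)
      fix x
      have "(\<lambda>i. norm (s i x - f x)) \<longlonglongrightarrow> 0"
        using lim.hyps(2)[of x] by (simp add: tendsto_norm_zero_iff LIM_zero_iff)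
      then show "(\<lambda>i. ennreal (norm (s i x - f x))) \<longlonglongrightarrow> 0"
        using tendsto_ennrealI by fastforce
    qed
  qed measurable
  then have "\<forall>\<^sub>F i in sequentially. (\<integral>\<^sup>+x. norm (s i x - f x) \<partial>lborel) < ennreal (e / 3)"
    using lim.prems by (intro order_tendstoD(2)[where y=0]) auto
  then obtain i where i: "(\<integral>\<^sup>+x. norm (s i x - f x) \<partial>lborel) \<le> ennreal (e / 3)"
    using eventually_happens'[OF sequentially_bot] less_imp_le by blast
  obtain d where d: "d > 0" "\<And>h. norm h < d \<Longrightarrow> (\<integral>\<^sup>+x. ennreal (norm (s i (x - h) - s i x)) \<partial>lborel) \<le> ennreal (e / 3)"
    using lim.IH[of "e / 3" i] lim.prems by auto
  have "(\<integral>\<^sup>+x. ennreal (norm (f (x - h) - f x)) \<partial>lborel) \<le> ennreal e" if "norm h < d" for h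
  proof -
    have "(\<integral>\<^sup>+x. ennreal (norm (f (x - h) - f x)) \<partial>lborel)
      \<le> (\<integral>\<^sup>+x. (ennreal (norm (s i (x - h) - f (x - h))) + ennreal (norm (s i x - f x))) + ennreal (norm (s i (x - h) - s i x)) \<partial>lborel)"
    proof (intro nn_integral_mono)
      fix x
      have "norm (f (x - h) - f x) \<le> norm (s i (x - h) - f (x - h)) + norm (s i x - f x) + norm (s i (x - h) - s i x)"
        by norm
      then show "ennreal (norm (f (x - h) - f x)) \<le> (ennreal (norm (s i (x - h) - f (x - h))) + ennreal (norm (s i x - f x))) + ennreal (norm (s i (x - h) - s i x))"
        by (simp flip: ennreal_plus)
    qed
    also have "\<dots> = (\<integral>\<^sup>+x. ennreal (norm (s i (x - h) - f (x - h))) + ennreal (norm (s i x - f x)) \<partial>lborel) + (\<integral>\<^sup>+x. ennreal (norm (s i (x - h) - s i x)) \<partial>lborel)"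
      by (rule nn_integral_add) measurable
    also have "(\<integral>\<^sup>+x. ennreal (norm (s i (x - h) - f (x - h))) + ennreal (norm (s i x - f x)) \<partial>lborel)
      = (\<integral>\<^sup>+x. ennreal (norm (s i (x - h) - f (x - h))) \<partial>lborel) + (\<integral>\<^sup>+x. ennreal (norm (s i x - f x)) \<partial>lborel)"
      by (rule nn_integral_add) measurable
    also have "(\<integral>\<^sup>+x. ennreal (norm (s i (x - h) - f (x - h))) \<partial>lborel) = (\<integral>\<^sup>+x. ennreal (norm (s i x - f x)) \<partial>lborel)"
      by (rule nn_integral_shift[where f="\<lambda>x. ennreal (norm (s i x - f x))"]) measurable
    also have "(\<integral>\<^sup>+x. ennreal (norm (s i x - f x)) \<partial>lborel) + (\<integral>\<^sup>+x. ennreal (norm (s i x - f x)) \<partial>lborel) + (\<integral>\<^sup>+x. ennreal (norm (s i (x - h) - s i x)) \<partial>lborel)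
      \<le> ennreal (e / 3) + ennreal (e / 3) + ennreal (e / 3)"
      using i d(2)[OF that] by (intro add_mono) auto
    also have "\<dots> = ennreal e" using lim.prems by (simp flip: ennreal_plus)
    finally show ?thesis .
  qed
  then show ?case using d(1) by blast
qed


lemma GDERIV_eq_0:
  assumes "GDERIV f x :> D" "open S" "x \<in> S" "\<And>y. y \<in> S \<Longrightarrow> f y = 0"
  shows "D = 0"
proof -
  have "(f has_derivative (\<lambda>h. h \<bullet> 0)) (at x)"
    by (rule has_derivative_transform_within_open[of "\<lambda>x. 0" _ x UNIV S]) (use assms in auto)
  then show ?thesis using GDERIV_unique[OF assms(1)] by (simp add: gderiv_def)
qed

lemma GDERIV_eq_0_outside_cball:
  assumes "GDERIV f x :> D" "\<And>x. norm x > R \<Longrightarrow> f x = 0" "norm x > R"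
  shows "D = 0"
  by (rule GDERIV_eq_0[OF assms(1), of "{x. norm x > R}"]) (use assms in \<open>auto intro: open_Collect_less continuous_intros\<close>)

lemma smooth_continuous_grad:
  assumes "smooth f" shows "continuous_on UNIV (grad f)"
proof -
  have "continuous_on UNIV (\<lambda>x. partial i f x)" for i
    using smooth_continuous[OF smooth_partial[OF assms]] .
  then show ?thesis unfolding grad_def by (intro continuous_on_vec_lambda)
qed

text \<open>All derivatives fall on \<phi>, so the induction runs over arbitrary \<phi> with the
  same support bound, while \<open>w\<close> need only be integrable.\<close>

lemma smooth_conv:
  fixes \<phi> :: "real ^ 'n::finite \<Rightarrow> real"
  assumes w: "integrable lborel w" and "smooth \<phi>" "\<And>x. norm x > R \<Longrightarrow> \<phi> x = 0"
  shows "smooth (\<lambda>x. LINT y|lborel. w y * \<phi> (x - y))"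
  unfolding smooth_def
proof
  fix k
  show "Ck k (\<lambda>x. LINT y|lborel. w y * \<phi> (x - y))"
    using assms(2,3)
  proof (induction k arbitrary: \<phi>)
    case 0
    then show ?case
      using continuous_conv[OF w smooth_continuous[OF 0(1)], of R] by simp
  next
    case (Suc k)
    have z: "norm x > R \<Longrightarrow> grad \<phi> x = 0" for x
      using GDERIV_eq_0_outside_cball[OF smooth_GDERIV[OF Suc.prems(1)] Suc.prems(2)] by blast
    note c = smooth_continuous_grad[OF Suc.prems(1)]
    have G: "GDERIV (\<lambda>x. LINT y|lborel. w y * \<phi> (x - y)) x :> (LINT y|lborel. w y *\<^sub>R grad \<phi> (x - y))" for x
      by (rule GDERIV_conv[OF w smooth_GDERIV[OF Suc.prems(1)] c Suc.prems(2) z])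
    have "partial i (\<lambda>x. LINT y|lborel. w y * \<phi> (x - y)) = (\<lambda>x. LINT y|lborel. w y * partial i \<phi> (x - y))" for i
    proof
      fix x
      have "partial i (\<lambda>x. LINT y|lborel. w y * \<phi> (x - y)) x = (LINT y|lborel. w y *\<^sub>R grad \<phi> (x - y)) $ i"
        by (rule partial_GDERIV[OF G])
      also have "\<dots> = (LINT y|lborel. (w y *\<^sub>R grad \<phi> (x - y)) $ i)"
        by (rule integral_bounded_linear[OF bounded_linear_vec_nth, symmetric]) (rule integrable_conv[OF w c z])
      finally show "partial i (\<lambda>x. LINT y|lborel. w y * \<phi> (x - y)) x = (LINT y|lborel. w y * partial i \<phi> (x - y))"
        by (simp add: grad_def)
    qed
    moreover have "Ck k (\<lambda>x. LINT y|lborel. w y * partial i \<phi> (x - y))" for i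
    proof (rule Suc.IH[OF smooth_partial[OF Suc.prems(1)]])
      show "norm x > R \<Longrightarrow> partial i \<phi> x = 0" for x
        using z[of x] by (simp add: grad_def vec_eq_iff)
    qed
    moreover have "(\<lambda>x. LINT y|lborel. w y * \<phi> (x - y)) differentiable_on UNIV"
      using G unfolding gderiv_def differentiable_on_def differentiable_def by blast
    ultimately show ?case by simp
  qed
qed

section \<open>Mollification and its convergence in L^p\<close>

definition mollify :: "real \<Rightarrow> (real ^ 'n::finite \<Rightarrow> 'b::euclidean_space) \<Rightarrow> real ^ 'n \<Rightarrow> 'b" where
  "mollify e G x = (LINT y|lborel. mollifier e (x - y) *\<^sub>R G y)"

lemma borel_measurable_mollifier[measurable]: "mollifier e \<in> borel_measurable borel"
  using continuous_on_mollifier by (rule borel_measurable_continuous_onI)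

lemma nn_integral_mollifier:
  assumes "e > 0" shows "(\<integral>\<^sup>+y. ennreal (mollifier e (y::real^'n::finite)) \<partial>lborel) = 1"
  by (subst nn_integral_eq_integral[OF integrable_mollifier[OF assms]])
    (simp_all add: mollifier_nonneg[OF assms] integral_mollifier[OF assms])

lemma integrable_mollifier_diff:
  fixes G :: "real ^ 'n::finite \<Rightarrow> 'b::euclidean_space"
  assumes "e > 0" "integrable lborel G"
  shows "integrable lborel (\<lambda>y. mollifier e (x - y) *\<^sub>R G y)"
proof -
  obtain B where B: "B > 0" "\<And>x::real^'n. norm (mollifier e x) \<le> B"
    using bounded_compact_support[OF continuous_on_mollifier[of e], where R=e] mollifier_eq_0[OF assms(1)]
    by (metis less_imp_le)
  show ?thesis
  proof (rule Bochner_Integration.integrable_bound[of _ "\<lambda>y. B * norm (G y)"])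
    show "AE y in lborel. norm (mollifier e (x - y) *\<^sub>R G y) \<le> norm (B * norm (G y))"
      using B by (auto intro!: AE_I2 mult_right_mono simp: abs_mult)
  qed (use assms in auto)
qed

lemma mollify_reflect:
  assumes [measurable]: "G \<in> borel_measurable borel"
  shows "mollify e G x = (LINT y|lborel. mollifier e y *\<^sub>R G (x - y))"
  unfolding mollify_def
  by (subst integral_reflect[of "\<lambda>y. mollifier e (x - y) *\<^sub>R G y" x, symmetric]) simp_all

lemma integral_mollifier_diff: "e > 0 \<Longrightarrow> (LINT y|lborel. mollifier e (x - y)) = 1"
  by (subst integral_reflect) (simp_all add: integral_mollifier)

lemma integrable_mollifier_reflect: "e > 0 \<Longrightarrow> integrable lborel (\<lambda>y::real^'n::finite. mollifier e (x - y))"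
  using integral_mollifier_diff[of e x] not_integrable_integral_eq by fastforce

text \<open>The kernel has unit mass and lives in the ball of radius \<open>e\<close>, so a
  mollification is an average of nearby values. Besides local uniform convergence this yields sup
  bounds, by taking \<open>c = 0\<close>.\<close>

lemma mollify_close:
  fixes G :: "real ^ 'n::finite \<Rightarrow> 'b::euclidean_space"
  assumes e: "e > 0" and G: "integrable lborel G" and d: "\<And>y. norm (x - y) < e \<Longrightarrow> norm (G y - c) \<le> d"
  shows "norm (mollify e G x - c) \<le> d"
proof -
  have i: "integrable lborel (\<lambda>y. mollifier e (x - y) *\<^sub>R G y)" by (rule integrable_mollifier_diff[OF e G])
  have ic: "integrable lborel (\<lambda>y. mollifier e (x - y) *\<^sub>R c)"
    using integrable_mollifier_reflect[OF e] by (rule integrable_scaleR_left)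
  have c: "c = (LINT y|lborel. mollifier e (x - y) *\<^sub>R c)"
    using integral_mollifier_diff[OF e, of x] integrable_mollifier_reflect[OF e, of x] by simp
  have "mollify e G x - c = (LINT y|lborel. mollifier e (x - y) *\<^sub>R G y) - (LINT y|lborel. mollifier e (x - y) *\<^sub>R c)"
    using c by (simp add: mollify_def)
  also have "\<dots> = (LINT y|lborel. mollifier e (x - y) *\<^sub>R G y - mollifier e (x - y) *\<^sub>R c)"
    by (rule Bochner_Integration.integral_diff[OF i ic, symmetric])
  finally have "norm (mollify e G x - c) \<le> (LINT y|lborel. norm (mollifier e (x - y) *\<^sub>R G y - mollifier e (x - y) *\<^sub>R c))"
    by (simp only: integral_norm_bound)
  also have "\<dots> \<le> (LINT y|lborel. mollifier e (x - y) * d)"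
  proof (rule integral_mono)
    show "integrable lborel (\<lambda>y. norm (mollifier e (x - y) *\<^sub>R G y - mollifier e (x - y) *\<^sub>R c))"
      by (intro integrable_norm Bochner_Integration.integrable_diff i ic)
    show "integrable lborel (\<lambda>y. mollifier e (x - y) * d)"
      by (rule integrable_mult_left) (use integrable_mollifier_reflect[OF e] in auto)
    show "norm (mollifier e (x - y) *\<^sub>R G y - mollifier e (x - y) *\<^sub>R c) \<le> mollifier e (x - y) * d" for y
    proof (cases "norm (x - y) < e")
      case True
      then show ?thesis using d mollifier_nonneg[OF e, of "x - y"]
        by (auto simp flip: scaleR_diff_right intro: mult_left_mono)
    qed (use mollifier_eq_0[OF e, of "x - y"] in auto)
  qed
  also have "\<dots> = d" using integral_mollifier_diff[OF e, of x] integrable_mollifier_reflect[OF e, of x] by simp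
  finally show ?thesis .
qed

text \<open>By unit mass, \<open>mollify e G x - G x\<close> is an average over \<open>y\<close> of
  \<open>G (x - y) - G x\<close>; after Fubini only translations shorter than \<open>e\<close>
  occur.\<close>

lemma mollify_L1_convergence:
  fixes G :: "real ^ 'n::finite \<Rightarrow> 'b::euclidean_space"
  assumes G: "integrable lborel G" and \<eta>: "\<eta> > 0"
  shows "\<exists>d>0. \<forall>e. 0 < e \<and> e < d \<longrightarrow> (\<integral>\<^sup>+x. ennreal (norm (mollify e G x - G x)) \<partial>lborel) \<le> ennreal \<eta>"
proof -
  have [measurable]: "G \<in> borel_measurable borel" using G by auto
  obtain d where d: "d > 0" "\<And>h. norm h < d \<Longrightarrow> (\<integral>\<^sup>+x. ennreal (norm (G (x - h) - G x)) \<partial>lborel) \<le> ennreal \<eta>"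
    using nn_integral_translation_continuous[OF G \<eta>] by blast
  have "(\<integral>\<^sup>+x. ennreal (norm (mollify e G x - G x)) \<partial>lborel) \<le> ennreal \<eta>" if e: "0 < e" "e < d" for e
  proof -
    have pt: "ennreal (norm (mollify e G x - G x)) \<le> (\<integral>\<^sup>+(y::real^'n). ennreal (mollifier e y) * ennreal (norm (G (x - y) - G x)) \<partial>lborel)" for x
    proof -
      have "integrable lborel (\<lambda>y::real^'n. mollifier e (x - y) *\<^sub>R G y)" by (rule integrable_mollifier_diff[OF e(1) G])
      then have i: "integrable lborel (\<lambda>y::real^'n. mollifier e y *\<^sub>R G (x - y))"
        by (subst (asm) distr_lborel_reflect[of x, symmetric]) (simp add: integrable_distr_eq)
      have ic: "integrable lborel (\<lambda>y::real^'n. mollifier e y *\<^sub>R G x)"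
        using integrable_mollifier[OF e(1)] by (rule integrable_scaleR_left)
      have "G x = (LINT (y::real^'n)|lborel. mollifier e y *\<^sub>R G x)"
        by (subst integral_scaleR_left) (simp_all add: integral_mollifier[OF e(1)] integrable_mollifier[OF e(1)])
      then have "mollify e G x - G x = (LINT (y::real^'n)|lborel. mollifier e y *\<^sub>R G (x - y)) - (LINT (y::real^'n)|lborel. mollifier e y *\<^sub>R G x)"
        by (simp add: mollify_reflect)
      also have "\<dots> = (LINT (y::real^'n)|lborel. mollifier e y *\<^sub>R G (x - y) - mollifier e y *\<^sub>R G x)"
        by (rule Bochner_Integration.integral_diff[OF i ic, symmetric])
      finally have "ennreal (norm (mollify e G x - G x)) \<le> (\<integral>\<^sup>+(y::real^'n). ennreal (norm (mollifier e y *\<^sub>R G (x - y) - mollifier e y *\<^sub>R G x)) \<partial>lborel)"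
        using integral_norm_bound_ennreal[OF Bochner_Integration.integrable_diff[OF i ic]] by simp
      then show ?thesis
        by (simp add: ennreal_mult abs_of_nonneg mollifier_nonneg[OF e(1)] flip: scaleR_diff_right)
    qed
    have "(\<integral>\<^sup>+x. ennreal (norm (mollify e G x - G x)) \<partial>lborel)
        \<le> (\<integral>\<^sup>+x. (\<integral>\<^sup>+y. ennreal (mollifier e y) * ennreal (norm (G (x - y) - G x)) \<partial>lborel) \<partial>lborel)"
      using pt by (intro nn_integral_mono)
    also have "\<dots> = (\<integral>\<^sup>+y. (\<integral>\<^sup>+x. ennreal (mollifier e y) * ennreal (norm (G (x - y) - G x)) \<partial>lborel) \<partial>lborel)"
      by (rule lborel_pair.Fubini'[symmetric]) measurable
    also have "\<dots> = (\<integral>\<^sup>+y. ennreal (mollifier e y) * (\<integral>\<^sup>+x. ennreal (norm (G (x - y) - G x)) \<partial>lborel) \<partial>lborel)"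
      by (intro nn_integral_cong nn_integral_cmult) measurable
    also have "\<dots> \<le> (\<integral>\<^sup>+y. ennreal (mollifier e (y::real^'n)) * ennreal \<eta> \<partial>lborel)"
    proof (intro nn_integral_mono)
      fix y :: "real^'n"
      show "ennreal (mollifier e y) * (\<integral>\<^sup>+x. ennreal (norm (G (x - y) - G x)) \<partial>lborel) \<le> ennreal (mollifier e y) * ennreal \<eta>"
        using d(2)[of y] mollifier_eq_0[OF e(1), of y] e by (cases "norm y < e") (auto intro: mult_left_mono)
    qed
    also have "\<dots> = (\<integral>\<^sup>+y. ennreal (mollifier e (y::real^'n)) \<partial>lborel) * ennreal \<eta>"
      by (rule nn_integral_multc) measurable
    also have "(\<integral>\<^sup>+y. ennreal (mollifier e (y::real^'n)) \<partial>lborel) = 1"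
      by (rule nn_integral_mollifier[OF e(1)])
    finally show ?thesis by simp
  qed
  then show ?thesis using d(1) by blast
qed

text \<open>Jensen's inequality against a kernel of mass one, then Fubini and translation
  invariance.\<close>

lemma mollify_Lp_contraction:
  fixes G :: "real ^ 'n::finite \<Rightarrow> 'b::euclidean_space"
  assumes e: "e > 0" and p: "p > 1" and G[measurable]: "G \<in> borel_measurable borel"
    and Gp: "integrable lborel (\<lambda>x. norm (G x) powr p)"
  shows "(\<integral>\<^sup>+x. ennreal (norm (mollify e G x) powr p) \<partial>lborel) \<le> (\<integral>\<^sup>+x. ennreal (norm (G x) powr p) \<partial>lborel)"
proof -
  have pt: "ennreal (norm (mollify e G x) powr p) \<le> (\<integral>\<^sup>+y. ennreal (mollifier e (x - y)) * ennreal (norm (G y) powr p) \<partial>lborel)" for x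
  proof -
    have i: "integrable lborel (\<lambda>y. mollifier e (x - y) * norm (G y) powr p)"
      using integrable_mollifier_diff[OF e Gp] by simp
    have "norm (mollify e G x) powr p \<le> (LINT y|lborel. mollifier e (x - y)) powr (p - 1) * (LINT y|lborel. mollifier e (x - y) * norm (G y) powr p)"
      unfolding mollify_def
      by (rule weighted_power_mean[OF p]) (use integrable_mollifier_reflect[OF e] mollifier_nonneg[OF e] i in auto)
    also have "\<dots> = (LINT y|lborel. mollifier e (x - y) * norm (G y) powr p)"
      by (simp add: integral_mollifier_diff[OF e])
    finally have "ennreal (norm (mollify e G x) powr p) \<le> ennreal (LINT y|lborel. mollifier e (x - y) * norm (G y) powr p)"
      by (rule ennreal_leI)
    also have "\<dots> = (\<integral>\<^sup>+y. ennreal (mollifier e (x - y) * norm (G y) powr p) \<partial>lborel)"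
      using mollifier_nonneg[OF e] i by (intro nn_integral_eq_integral[symmetric] AE_I2 mult_nonneg_nonneg) auto
    finally show ?thesis by (simp add: ennreal_mult mollifier_nonneg[OF e])
  qed
  have "(\<integral>\<^sup>+x. ennreal (norm (mollify e G x) powr p) \<partial>lborel)
      \<le> (\<integral>\<^sup>+x. (\<integral>\<^sup>+y. ennreal (mollifier e (x - y)) * ennreal (norm (G y) powr p) \<partial>lborel) \<partial>lborel)"
    using pt by (intro nn_integral_mono)
  also have "\<dots> = (\<integral>\<^sup>+y. (\<integral>\<^sup>+x. ennreal (mollifier e (x - y)) * ennreal (norm (G y) powr p) \<partial>lborel) \<partial>lborel)"
    by (rule lborel_pair.Fubini'[symmetric]) measurable
  also have "\<dots> = (\<integral>\<^sup>+y. (\<integral>\<^sup>+x. ennreal (mollifier e (x - y)) \<partial>lborel) * ennreal (norm (G y) powr p) \<partial>lborel)"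
    by (intro nn_integral_cong nn_integral_multc) measurable
  also have "\<dots> = (\<integral>\<^sup>+y. ennreal (norm (G y) powr p) \<partial>lborel)"
  proof (intro nn_integral_cong)
    fix y :: "real^'n"
    have "(\<integral>\<^sup>+x. ennreal (mollifier e (x - y)) \<partial>lborel) = (\<integral>\<^sup>+x. ennreal (mollifier e (x::real^'n)) \<partial>lborel)"
      by (rule nn_integral_shift[where f="\<lambda>x. ennreal (mollifier e x)"]) measurable
    also have "\<dots> = 1" by (rule nn_integral_mollifier[OF e])
    finally show "(\<integral>\<^sup>+x. ennreal (mollifier e (x - y)) \<partial>lborel) * ennreal (norm (G y) powr p) = ennreal (norm (G y) powr p)"
      by simp
  qed
  finally show ?thesis .
qed


text \<open>Splits \<open>G\<close> at height \<open>N\<close>. The large part is small in L^p and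
  stays so under mollification by contraction. The bounded part has mollification error at most
  \<open>M\<close>, so the p-th power of this error is controlled by M^(p - 1) times the error
  itself, which tends to 0 in L^1.\<close>

lemma mollify_Lp_convergence:
  fixes G :: "real ^ 'n::finite \<Rightarrow> 'b::euclidean_space"
  assumes p: "p > 1" and G: "integrable lborel G"
    and Gp: "integrable lborel (\<lambda>x. norm (G x) powr p)" and \<eta>: "\<eta> > 0"
  shows "\<exists>d>0. \<forall>e. 0 < e \<and> e < d \<longrightarrow> (\<integral>\<^sup>+x. ennreal (norm (mollify e G x - G x) powr p) \<partial>lborel) \<le> ennreal \<eta>"
proof -
  have [measurable]: "G \<in> borel_measurable borel" using G by auto
  \<comment> \<open>Chosen so that the large part, after two uses of \<open>powr_add_le\<close> and
    with two terms of size \<tau>, contributes \<eta> / 2.\<close>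
  define \<tau> where "\<tau> = \<eta> / (4 * (2 powr p * 2 powr p))"
  have \<tau>: "\<tau> > 0" using \<eta> by (simp add: \<tau>_def)
  define b where "b N x = (if norm (G x) \<le> real N then 0 else G x)" for N x
  define a where "a N x = (if norm (G x) \<le> real N then G x else 0)" for N x
  have [measurable]: "a N \<in> borel_measurable borel" "b N \<in> borel_measurable borel" for N
    unfolding a_def[abs_def] b_def[abs_def] by measurable
  have "(\<lambda>N. \<integral>\<^sup>+x. ennreal (norm (b N x) powr p) \<partial>lborel) \<longlonglongrightarrow> (\<integral>\<^sup>+x. 0 \<partial>(lborel :: (real^'n) measure))"
  proof (rule nn_integral_dominated_convergence[where w="\<lambda>x. ennreal (norm (G x) powr p)"
        and u="\<lambda>N x. ennreal (norm (b N x) powr p)" and u'="\<lambda>x. 0"])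
    show "(\<integral>\<^sup>+x. ennreal (norm (G x) powr p) \<partial>lborel) < \<infinity>"
      using Gp by (simp add: nn_integral_eq_integral)
    show "AE x in lborel. (\<lambda>N. ennreal (norm (b N x) powr p)) \<longlonglongrightarrow> 0"
    proof (rule AE_I2)
      fix x
      obtain N0 where "norm (G x) \<le> real N0" using real_arch_simple by blast
      then have "\<forall>\<^sub>F N in sequentially. ennreal (norm (b N x) powr p) = 0"
        by (intro eventually_sequentiallyI[of N0]) (simp add: b_def)
      then show "(\<lambda>N. ennreal (norm (b N x) powr p)) \<longlonglongrightarrow> 0" by (rule tendsto_eventually)
    qed
  qed (auto simp: b_def intro!: AE_I2)
  then have "\<forall>\<^sub>F N in sequentially. (\<integral>\<^sup>+x. ennreal (norm (b N x) powr p) \<partial>lborel) < ennreal \<tau>"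
    using \<tau> by (intro order_tendstoD(2)[where y=0]) auto
  then obtain N where N: "(\<integral>\<^sup>+x. ennreal (norm (b N x) powr p) \<partial>lborel) \<le> ennreal \<tau>"
    using eventually_happens'[OF sequentially_bot] less_imp_le by blast
  have ia: "integrable lborel (a N)" and ib: "integrable lborel (b N)"
    by (rule Bochner_Integration.integrable_bound[OF G]; simp add: a_def b_def)+
  have ibp: "integrable lborel (\<lambda>x. norm (b N x) powr p)"
    by (rule Bochner_Integration.integrable_bound[OF Gp]) (auto simp: b_def)
  \<comment> \<open>Both the truncated function and its mollification are bounded by
    \<open>N\<close>; the added 1 keeps \<open>M\<close> positive when \<open>N = 0\<close>.\<close>
  define M where "M = 2 * real N + 1"
  define K where "K = 2 powr p * M powr (p - 1)"
  have K: "K > 0" by (simp add: K_def M_def)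
  obtain d where d: "d > 0" "\<And>e. 0 < e \<Longrightarrow> e < d \<Longrightarrow>
      (\<integral>\<^sup>+x. ennreal (norm (mollify e (a N) x - a N x)) \<partial>lborel) \<le> ennreal (\<eta> / (2 * K))"
    using mollify_L1_convergence[OF ia, of "\<eta> / (2 * K)"] K \<eta> by auto
  have "(\<integral>\<^sup>+x. ennreal (norm (mollify e G x - G x) powr p) \<partial>lborel) \<le> ennreal \<eta>" if e: "0 < e" "e < d" for e
  proof -
    have [measurable]: "mollify e (a N) \<in> borel_measurable borel" "mollify e (b N) \<in> borel_measurable borel"
      unfolding mollify_def[abs_def] by measurable
    have pt: "norm (mollify e G x - G x) powr p
      \<le> K * norm (mollify e (a N) x - a N x) + 2 powr p * 2 powr p * (norm (mollify e (b N) x) powr p + norm (b N x) powr p)" for x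
    proof -
      have ab: "G y = a N y + b N y" for y by (simp add: a_def b_def)
      have "mollify e G x = mollify e (a N) x + mollify e (b N) x"
        unfolding mollify_def using integrable_mollifier_diff[OF e(1) ia, of x] integrable_mollifier_diff[OF e(1) ib, of x]
        by (subst Bochner_Integration.integral_add[symmetric]) (simp_all add: ab flip: scaleR_add_right)
      then have eq: "mollify e G x - G x = (mollify e (a N) x - a N x) + (mollify e (b N) x - b N x)"
        using ab[of x] by simp
      let ?A = "norm (mollify e (a N) x - a N x)" and ?B = "norm (mollify e (b N) x - b N x)"
      have "norm (mollify e G x - G x) powr p \<le> (?A + ?B) powr p"
        unfolding eq using p by (intro powr_mono2 norm_triangle_ineq) auto
      also have "\<dots> \<le> 2 powr p * (?A powr p + ?B powr p)" using p by (intro powr_add_le) auto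
      finally have 1: "norm (mollify e G x - G x) powr p \<le> 2 powr p * (?A powr p + ?B powr p)" .
      have "norm (mollify e (a N) x - 0) \<le> real N"
        by (rule mollify_close[OF e(1) ia]) (simp add: a_def)
      moreover have "norm (a N x) \<le> real N" by (simp add: a_def)
      ultimately have "?A \<le> M" using norm_triangle_ineq4[of "mollify e (a N) x" "a N x"] by (simp add: M_def)
      then have "?A powr (p - 1) \<le> M powr (p - 1)" using p by (intro powr_mono2) auto
      then have "?A powr (p - 1) * ?A \<le> M powr (p - 1) * ?A" by (intro mult_right_mono) auto
      moreover have "?A powr p = ?A powr (p - 1) * ?A" by (cases "?A = 0") (use p in \<open>simp_all add: powr_diff\<close>)
      ultimately have 2: "?A powr p \<le> M powr (p - 1) * ?A" by simp
      have "?B powr p \<le> (norm (mollify e (b N) x) + norm (b N x)) powr p"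
        using p by (intro powr_mono2 norm_triangle_ineq4) auto
      also have "\<dots> \<le> 2 powr p * (norm (mollify e (b N) x) powr p + norm (b N x) powr p)"
        using p by (intro powr_add_le) auto
      finally have 3: "?B powr p \<le> 2 powr p * (norm (mollify e (b N) x) powr p + norm (b N x) powr p)" .
      have "2 powr p * (?A powr p + ?B powr p)
        \<le> 2 powr p * (M powr (p - 1) * ?A + 2 powr p * (norm (mollify e (b N) x) powr p + norm (b N x) powr p))"
        using 2 3 by (intro mult_left_mono add_mono) auto
      then show ?thesis using 1 by (simp add: K_def algebra_simps)
    qed
    have "(\<integral>\<^sup>+x. ennreal (norm (mollify e G x - G x) powr p) \<partial>lborel)
      \<le> (\<integral>\<^sup>+x. ennreal K * ennreal (norm (mollify e (a N) x - a N x))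
          + ennreal (2 powr p * 2 powr p) * (ennreal (norm (mollify e (b N) x) powr p) + ennreal (norm (b N x) powr p)) \<partial>lborel)"
    proof (rule nn_integral_mono)
      fix x
      show "ennreal (norm (mollify e G x - G x) powr p) \<le> ennreal K * ennreal (norm (mollify e (a N) x - a N x))
          + ennreal (2 powr p * 2 powr p) * (ennreal (norm (mollify e (b N) x) powr p) + ennreal (norm (b N x) powr p))"
        using ennreal_leI[OF pt[of x]] K by (simp add: ennreal_plus ennreal_mult del: ennreal_plus_if)
    qed
    also have "\<dots> = (\<integral>\<^sup>+x. ennreal K * ennreal (norm (mollify e (a N) x - a N x)) \<partial>lborel)
        + (\<integral>\<^sup>+x. ennreal (2 powr p * 2 powr p) * (ennreal (norm (mollify e (b N) x) powr p) + ennreal (norm (b N x) powr p)) \<partial>lborel)"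
      by (rule nn_integral_add) measurable
    also have "(\<integral>\<^sup>+x. ennreal K * ennreal (norm (mollify e (a N) x - a N x)) \<partial>lborel)
        = ennreal K * (\<integral>\<^sup>+x. ennreal (norm (mollify e (a N) x - a N x)) \<partial>lborel)"
      by (rule nn_integral_cmult) measurable
    also have "\<dots> \<le> ennreal K * ennreal (\<eta> / (2 * K))" using d(2)[OF e] by (rule mult_left_mono) simp
    also have "\<dots> = ennreal (\<eta> / 2)" using K \<eta> by (simp flip: ennreal_mult)
    also have "(\<integral>\<^sup>+x. ennreal (2 powr p * 2 powr p) * (ennreal (norm (mollify e (b N) x) powr p) + ennreal (norm (b N x) powr p)) \<partial>lborel)
        = ennreal (2 powr p * 2 powr p) * (\<integral>\<^sup>+x. ennreal (norm (mollify e (b N) x) powr p) + ennreal (norm (b N x) powr p) \<partial>lborel)"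
      by (rule nn_integral_cmult) measurable
    also have "(\<integral>\<^sup>+x. ennreal (norm (mollify e (b N) x) powr p) + ennreal (norm (b N x) powr p) \<partial>lborel)
        = (\<integral>\<^sup>+x. ennreal (norm (mollify e (b N) x) powr p) \<partial>lborel) + (\<integral>\<^sup>+x. ennreal (norm (b N x) powr p) \<partial>lborel)"
      by (rule nn_integral_add) measurable
    also have "\<dots> \<le> ennreal \<tau> + ennreal \<tau>"
      using mollify_Lp_contraction[OF e(1) p _ ibp] N by (intro add_mono) auto
    also have "ennreal (\<eta> / 2) + ennreal (2 powr p * 2 powr p) * (ennreal \<tau> + ennreal \<tau>) = ennreal \<eta>"
      using \<tau> \<eta> by (simp add: \<tau>_def flip: ennreal_plus ennreal_mult)
    finally show ?thesis by (simp add: add_left_mono mult_left_mono)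
  qed
  then show ?thesis using d(1) by blast
qed

section \<open>Weak solutions and approximation\<close>

lemma powr_le_one_add_powr:
  fixes t q p :: real
  assumes "t \<ge> 0" "0 \<le> q" "q \<le> p"
  shows "t powr q \<le> 1 + t powr p"
proof (cases "t \<le> 1")
  case True
  then have "t powr q \<le> 1" using assms by (simp add: powr_le1)
  then show ?thesis by (smt (verit) powr_ge_zero)
next
  case False
  then have "t powr q \<le> t powr p" using assms by (intro powr_mono) auto
  then show ?thesis by simp
qed

lemma nn_integral_le_imp_integral_le:
  fixes f :: "'a \<Rightarrow> real"
  assumes [measurable]: "f \<in> borel_measurable M" and "\<And>x. f x \<ge> 0" "c \<ge> 0" "(\<integral>\<^sup>+x. ennreal (f x) \<partial>M) \<le> ennreal c"
  shows "integrable M f" "(LINT x|M. f x) \<le> c"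
proof -
  show "integrable M f"
    using assms by (intro integrableI_nonneg) (auto intro: le_less_trans)
  show "(LINT x|M. f x) \<le> c"
    using assms by (subst integral_eq_nn_integral) (auto intro: enn2real_leI)
qed

lemma compact_norm_bound:
  fixes f :: "'a::topological_space \<Rightarrow> 'b::real_normed_vector"
  assumes "compact S" "continuous_on S f"
  obtains B where "B > 0" "\<And>x. x \<in> S \<Longrightarrow> norm (f x) \<le> B"
  using compact_imp_bounded[OF compact_continuous_image[OF assms(2,1)]] unfolding bounded_pos by auto

lemma uniform_approximation_compose:
  fixes u :: "'a::topological_space \<Rightarrow> real" and F :: "real \<Rightarrow> real"
  assumes "compact S" "continuous_on S u" "continuous_on UNIV F" "\<theta> > 0"
  obtains d where "d > 0" "\<And>x t. x \<in> S \<Longrightarrow> \<bar>t - u x\<bar> \<le> d \<Longrightarrow> \<bar>F t - F (u x)\<bar> \<le> \<theta>"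
proof -
  obtain B where B: "\<And>x. x \<in> S \<Longrightarrow> \<bar>u x\<bar> \<le> B"
    using compact_imp_bounded[OF compact_continuous_image[OF assms(2,1)]] unfolding bounded_iff by auto
  have "uniformly_continuous_on {-B-1..B+1} F"
    using assms(3) by (intro compact_uniformly_continuous) (auto intro: continuous_on_subset)
  then obtain d where d: "d > 0" "\<And>s t. s \<in> {-B-1..B+1} \<Longrightarrow> t \<in> {-B-1..B+1} \<Longrightarrow> dist t s < d \<Longrightarrow> dist (F t) (F s) < \<theta>"
    unfolding uniformly_continuous_on_def using assms(4) by metis
  show ?thesis
  proof (rule that[of "min (d / 2) 1"])
    fix x t assume x: "x \<in> S" and t: "\<bar>t - u x\<bar> \<le> min (d / 2) 1"
    have "dist (F t) (F (u x)) < \<theta>"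
      using B[OF x] t d(1) by (intro d(2)) (auto simp: dist_real_def abs_le_iff)
    then show "\<bar>F t - F (u x)\<bar> \<le> \<theta>" by (simp add: dist_real_def)
  qed (use d in auto)
qed

text \<open>The union of the closed balls is a Minkowski sum of compact sets, hence compact.
  Mollifications at a scale below \<open>e\<close>, evaluated on \<open>S\<close>, involve only data
  on \<open>K\<close>.\<close>

lemma compact_open_neighborhood:
  fixes S :: "'a::euclidean_space set"
  assumes "compact S" "open \<Omega>" "S \<subseteq> \<Omega>"
  obtains e K where "e > 0" "compact K" "K \<subseteq> \<Omega>" "S \<subseteq> K" "\<And>x y. x \<in> S \<Longrightarrow> norm (x - y) \<le> e \<Longrightarrow> y \<in> K"
proof -
  obtain e where e: "e > 0" "(\<Union>x\<in>S. cball x e) \<subseteq> \<Omega>"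
    using compact_subset_open_imp_cball_epsilon_subset[OF assms] by blast
  have eq: "(\<Union>x\<in>S. cball x e) = {x + y |x y. x \<in> S \<and> y \<in> cball 0 e}"
  proof (intro set_eqI iffI)
    fix z assume "z \<in> (\<Union>x\<in>S. cball x e)"
    then obtain x where "x \<in> S" "dist x z \<le> e" by auto
    then show "z \<in> {x + y |x y. x \<in> S \<and> y \<in> cball 0 e}"
      by (intro CollectI exI[of _ x] exI[of _ "z - x"]) (auto simp: dist_norm norm_minus_commute)
  next
    fix z assume "z \<in> {x + y |x y. x \<in> S \<and> y \<in> cball 0 e}"
    then obtain x y where "x \<in> S" "norm y \<le> e" "z = x + y" by auto
    then show "z \<in> (\<Union>x\<in>S. cball x e)" by (auto simp: dist_norm intro!: bexI[of _ x])
  qed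
  show ?thesis
  proof
    show "compact (\<Union>x\<in>S. cball x e)" unfolding eq using compact_sums[OF assms(1) compact_cball[of 0 e]] by simp
    show "S \<subseteq> (\<Union>x\<in>S. cball x e)" using e(1) by auto
    show "y \<in> (\<Union>x\<in>S. cball x e)" if "x \<in> S" "norm (x - y) \<le> e" for x y
      using that by (auto simp: dist_norm)
  qed (use e in auto)
qed

lemma test_functionsI:
  assumes "smooth \<phi>" "compact K" "K \<subseteq> \<Omega>" "\<And>x. x \<notin> K \<Longrightarrow> \<phi> x = 0"
  shows "\<phi> \<in> test_functions \<Omega>"
proof -
  have "{x. \<phi> x \<noteq> 0} \<subseteq> K" using assms(4) by auto
  then have "closure {x. \<phi> x \<noteq> 0} \<subseteq> K" using assms(2) by (simp add: closure_minimal compact_imp_closed)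
  moreover have "compact (closure {x. \<phi> x \<noteq> 0})"
    using calculation assms(2) by (meson bounded_subset closed_closure compact_eq_bounded_closed)
  ultimately show ?thesis using assms by (auto simp: test_functions_def)
qed

lemma GDERIV_mollifier: "GDERIV (mollifier e) x :> grad (mollifier e) x"
  by (rule smooth_GDERIV[OF smooth_mollifier])

lemma GDERIV_mollifier_diff: "GDERIV (\<lambda>y. mollifier e (y - a)) x :> grad (mollifier e) (x - a)"
proof -
  have "((\<lambda>y. y - a) has_derivative (\<lambda>h. h)) (at x)" by (auto intro!: derivative_eq_intros)
  from has_derivative_compose[OF this GDERIV_mollifier[unfolded gderiv_def]]
  show ?thesis by (simp add: gderiv_def)
qed

lemma grad_mollifier_minus: "grad (mollifier e) (- x) = - grad (mollifier e) x"
proof -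
  have "((\<lambda>y. - y) has_derivative (\<lambda>h. - h)) (at x)" by (auto intro!: derivative_eq_intros)
  from has_derivative_compose[OF this GDERIV_mollifier[unfolded gderiv_def]]
  have "GDERIV (mollifier e) x :> - grad (mollifier e) (- x)"
    by (simp add: gderiv_def mollifier_minus)
  then show ?thesis using GDERIV_unique[OF GDERIV_mollifier] by (metis minus_minus)
qed

lemma mollify_eq_conv: "mollify e G x = (LINT y|lborel. G y * mollifier e (x - y))" for G :: "real ^ 'n::finite \<Rightarrow> real"
  by (simp add: mollify_def mult.commute)

text \<open>All integrals run over the whole space with \<open>lborel\<close>: test functions vanish
  outside the domain, so the set integrals of the definition can be written without it. The gradient
  is one fixed Borel function, and \<open>u\<close> is the continuous representative.\<close>

locale weak_p_harmonic =
  fixes \<Omega> :: "(real ^ 'n::finite) set" and u :: "real ^ 'n \<Rightarrow> real" and g :: "real ^ 'n \<Rightarrow> real ^ 'n" and p :: real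
  assumes open_domain: "open \<Omega>" and p_gt_1: "p > 1"
    and continuous_u: "continuous_on \<Omega> u"
    and g_measurable[measurable]: "g \<in> borel_measurable borel"
    and g_Lp: "\<And>K. compact K \<Longrightarrow> K \<subseteq> \<Omega> \<Longrightarrow> integrable lborel (\<lambda>x. indicator K x * norm (g x) powr p)"
    and weak_gradient_eq: "\<And>\<phi> i. \<phi> \<in> test_functions \<Omega> \<Longrightarrow>
      (LINT x|lborel. u x * partial i \<phi> x) = - (LINT x|lborel. g x $ i * \<phi> x)"
    and weak_equation: "\<And>\<phi>. \<phi> \<in> test_functions \<Omega> \<Longrightarrow>
      (LINT x|lborel. (norm (g x) powr (p - 2) *\<^sub>R g x) \<bullet> grad \<phi> x) = 0"
begin

definition "flux x = norm (g x) powr (p - 2) *\<^sub>R g x"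

lemma flux_measurable[measurable]: "flux \<in> borel_measurable borel"
  unfolding flux_def[abs_def] by measurable

lemma norm_flux: "norm (flux x) = norm (g x) powr (p - 1)"
proof (cases "g x = 0")
  case False
  then have "norm (g x) powr (p - 1) = norm (g x) powr (p - 2) * norm (g x) powr 1"
    by (subst powr_add[symmetric]) simp
  then show ?thesis using False by (simp add: flux_def)
qed (simp add: flux_def)

lemma flux_inner_g: "flux x \<bullet> g x = norm (g x) powr p"
proof (cases "g x = 0")
  case False
  then have "norm (g x) powr p = norm (g x) powr (p - 2) * norm (g x) powr 2"
    by (subst powr_add[symmetric]) simp
  then show ?thesis using False by (simp add: flux_def dot_square_norm powr_numeral)
qed (simp add: flux_def)

lemma g_powr_integrable:
  assumes K: "compact K" "K \<subseteq> \<Omega>" and q: "0 \<le> q" "q \<le> p"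
  shows "integrable lborel (\<lambda>x. indicator K x * norm (g x) powr q)"
proof (rule Bochner_Integration.integrable_bound)
  have [measurable]: "K \<in> sets borel" using K(1) by (rule borel_compact)
  have "integrable lborel (indicator K :: _ \<Rightarrow> real)"
    using fmeasurable_compact[OF K(1)] by (simp add: fmeasurable_def)
  then show "integrable lborel (\<lambda>x. indicator K x + indicator K x * norm (g x) powr p)"
    by (intro Bochner_Integration.integrable_add g_Lp K)
  show "AE x in lborel. norm (indicator K x * norm (g x) powr q) \<le> norm (indicator K x + indicator K x * norm (g x) powr p)"
    using powr_le_one_add_powr[OF norm_ge_zero q] by (auto intro!: AE_I2 simp: indicator_def)
  show "(\<lambda>x. indicator K x * norm (g x) powr q) \<in> borel_measurable lborel" by measurable
qed

text \<open>For a point of \<open>S\<close> the mollifier centred there is an admissible test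
  function, so the classical gradient of the mollified \<open>u\<close> equals the mollified weak
  gradient. Restricting both to \<open>K\<close> makes them integrable on the whole space without
  changing anything that is seen from \<open>S\<close>.\<close>

lemma C1_approximation:
  assumes S: "compact S" "S \<subseteq> \<Omega>" and \<delta>: "\<delta> > 0"
  obtains U V where "\<And>x. GDERIV U x :> V x" "continuous_on UNIV V" "\<And>x. x \<in> S \<Longrightarrow> \<bar>U x - u x\<bar> \<le> \<delta>"
    "integrable lborel (\<lambda>x. indicator S x * norm (V x - g x) powr p)"
    "(LINT x|lborel. indicator S x * norm (V x - g x) powr p) \<le> \<delta>"
proof -
  obtain e1 K where e1: "e1 > 0" and K: "compact K" "K \<subseteq> \<Omega>" "S \<subseteq> K" "\<And>x y. x \<in> S \<Longrightarrow> norm (x - y) \<le> e1 \<Longrightarrow> y \<in> K"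
    using compact_open_neighborhood[OF S(1) open_domain S(2)] by metis
  have [measurable]: "K \<in> sets borel" "S \<in> sets borel" using K(1) S(1) by (auto intro: borel_compact)
  define w where "w x = indicator K x * u x" for x
  define G where "G x = indicator K x *\<^sub>R g x" for x
  have uK: "continuous_on K u" using continuous_u K(2) continuous_on_subset by blast
  have iw: "integrable lborel w"
    unfolding w_def[abs_def] using borel_integrable_compact[OF K(1) uK] by simp
  have [measurable]: "G \<in> borel_measurable borel" unfolding G_def[abs_def] by measurable
  have normG: "norm (G x) powr q = indicator K x * norm (g x) powr q" if "q \<noteq> 0" for x q
    by (simp add: G_def indicator_def)
  have iG: "integrable lborel G"
  proof (subst integrable_norm_iff[symmetric])
    show "integrable lborel (\<lambda>x. norm (G x))"
      using g_powr_integrable[OF K(1,2), of 1] p_gt_1 by (simp add: G_def)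
  qed simp
  have iGp: "integrable lborel (\<lambda>x. norm (G x) powr p)"
    using g_Lp[OF K(1,2)] p_gt_1 by (simp add: normG)
  obtain d where d: "d > 0" "\<And>e. 0 < e \<Longrightarrow> e < d \<Longrightarrow> (\<integral>\<^sup>+x. ennreal (norm (mollify e G x - G x) powr p) \<partial>lborel) \<le> ennreal \<delta>"
    using mollify_Lp_convergence[OF p_gt_1 iG iGp \<delta>] by blast
  obtain d' where d': "d' > 0" "\<And>x y. x \<in> K \<Longrightarrow> y \<in> K \<Longrightarrow> dist y x < d' \<Longrightarrow> dist (u y) (u x) < \<delta>"
    using compact_uniformly_continuous[OF uK K(1)] \<delta> unfolding uniformly_continuous_on_def by metis
  define e where "e = min e1 (min d d') / 2"
  have e: "e > 0" "e < e1" "e < d" "e < d'" using e1 d(1) d'(1) by (auto simp: e_def)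
  have zm: "norm x > e \<Longrightarrow> mollifier e x = 0" for x :: "real^'n" by (simp add: mollifier_eq_0[OF e(1)])
  have zg: "norm x > e \<Longrightarrow> grad (mollifier e) x = 0" for x :: "real^'n"
    using GDERIV_eq_0_outside_cball[OF GDERIV_mollifier zm] by blast
  define V where "V x = (LINT y|lborel. w y *\<^sub>R grad (mollifier e) (x - y))" for x
  have cg: "continuous_on UNIV (grad (mollifier e :: real^'n \<Rightarrow> real))"
    by (rule smooth_continuous_grad[OF smooth_mollifier])
  have iwg: "integrable lborel (\<lambda>y. w y *\<^sub>R grad (mollifier e) (x - y))" for x
    by (rule integrable_conv[OF iw cg zg])
  have "mollify e w = (\<lambda>x. LINT y|lborel. w y * mollifier e (x - y))"
    by (rule ext) (rule mollify_eq_conv)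
  then have GD: "GDERIV (mollify e w) x :> V x" for x
    unfolding V_def using GDERIV_conv[OF iw GDERIV_mollifier cg zm zg] by simp
  have cV: "continuous_on UNIV V"
    unfolding V_def[abs_def] by (rule continuous_conv[OF iw cg zg])
  have U: "\<bar>mollify e w x - u x\<bar> \<le> \<delta>" if x: "x \<in> S" for x
  proof -
    have "norm (mollify e w x - u x) \<le> \<delta>"
    proof (rule mollify_close[OF e(1) iw])
      fix y assume y: "norm (x - y) < e"
      then have "y \<in> K" using K(4)[OF x] e by simp
      then show "norm (w y - u x) \<le> \<delta>"
        using d'(2)[of x y] x K(3) y e by (auto simp: w_def dist_norm norm_minus_commute less_imp_le)
    qed
    then show ?thesis by simp
  qed
  have Veq: "V x = mollify e G x" if x: "x \<in> S" for x
  proof (subst vec_eq_iff, intro allI)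
    fix i
    let ?\<phi> = "\<lambda>y. mollifier e (y - x)"
    have \<phi>: "?\<phi> \<in> test_functions \<Omega>"
    proof (rule test_functionsI[OF smooth_mollifier_diff])
      show "compact (cball x e)" by simp
      show "cball x e \<subseteq> \<Omega>" using K(2) K(4)[OF x] e by (auto simp: dist_norm)
      show "y \<notin> cball x e \<Longrightarrow> ?\<phi> y = 0" for y by (rule zm) (simp add: dist_norm norm_minus_commute)
    qed
    have inK: "y \<in> K" if "norm (x - y) \<le> e" for y using K(4)[OF x] that e by simp
    have "V x $ i = (LINT y|lborel. (w y *\<^sub>R grad (mollifier e) (x - y)) $ i)"
      unfolding V_def by (rule integral_bounded_linear[OF bounded_linear_vec_nth, symmetric, OF iwg])
    also have "\<dots> = (LINT y|lborel. - (u y * partial i ?\<phi> y))"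
    proof (rule Bochner_Integration.integral_cong[OF refl])
      fix y
      have "partial i ?\<phi> y = grad (mollifier e) (y - x) $ i" by (rule partial_GDERIV[OF GDERIV_mollifier_diff])
      \<comment> \<open>The mollifier is even, so its gradient is odd; this sign cancels the one in
        the weak gradient identity.\<close>
      also have "\<dots> = - (grad (mollifier e) (x - y) $ i)"
        using grad_mollifier_minus[of e "x - y"] by simp
      finally have "- (u y * partial i ?\<phi> y) = u y * grad (mollifier e) (x - y) $ i" by simp
      moreover have "w y * grad (mollifier e) (x - y) $ i = u y * grad (mollifier e) (x - y) $ i"
        using inK[of y] zg[of "x - y"] by (cases "norm (x - y) \<le> e") (auto simp: w_def)
      ultimately show "(w y *\<^sub>R grad (mollifier e) (x - y)) $ i = - (u y * partial i ?\<phi> y)" by simp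
    qed
    also have "\<dots> = (LINT y|lborel. g y $ i * ?\<phi> y)"
      using weak_gradient_eq[OF \<phi>, of i] by simp
    also have "\<dots> = (LINT y|lborel. (mollifier e (x - y) *\<^sub>R G y) $ i)"
    proof (rule Bochner_Integration.integral_cong[OF refl])
      fix y
      show "g y $ i * ?\<phi> y = (mollifier e (x - y) *\<^sub>R G y) $ i"
        using mollifier_minus[of e "x - y"] inK[of y] zm[of "x - y"]
        by (cases "norm (x - y) \<le> e") (auto simp: G_def)
    qed
    also have "\<dots> = mollify e G x $ i"
      unfolding mollify_def
      by (rule integral_bounded_linear[OF bounded_linear_vec_nth]) (rule integrable_mollifier_diff[OF e(1) iG])
    finally show "V x $ i = mollify e G x $ i" .
  qed
  let ?D = "\<lambda>x. indicator S x * norm (V x - g x) powr p"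
  have [measurable]: "V \<in> borel_measurable borel" using cV by (rule borel_measurable_continuous_onI)
  have "(\<integral>\<^sup>+x. ennreal (?D x) \<partial>lborel) \<le> (\<integral>\<^sup>+x. ennreal (norm (mollify e G x - G x) powr p) \<partial>lborel)"
    using Veq K(3) by (intro nn_integral_mono) (auto simp: indicator_def G_def subset_iff)
  also have "\<dots> \<le> ennreal \<delta>" by (rule d(2)[OF e(1,3)])
  finally have le: "(\<integral>\<^sup>+x. ennreal (?D x) \<partial>lborel) \<le> ennreal \<delta>" .
  show ?thesis
    using nn_integral_le_imp_integral_le[OF _ _ _ le] \<delta> by (intro that[OF GD cV U]) auto
qed

lemma C1_approximation_compose:
  assumes F: "\<And>t. DERIV F t :> F' t" and cF': "continuous_on UNIV F'"
    and S: "compact S" "S \<subseteq> \<Omega>" and \<theta>: "\<theta> > 0"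
  obtains U V where "\<And>x. GDERIV (\<lambda>x. F (U x)) x :> F' (U x) *\<^sub>R V x" "continuous_on UNIV V"
    "continuous_on UNIV (\<lambda>x. F (U x))" "continuous_on UNIV (\<lambda>x. F' (U x))"
    "\<And>x. x \<in> S \<Longrightarrow> \<bar>F (U x) - F (u x)\<bar> \<le> \<theta>" "\<And>x. x \<in> S \<Longrightarrow> \<bar>F' (U x) - F' (u x)\<bar> \<le> \<theta>"
    "integrable lborel (\<lambda>x. indicator S x * norm (V x - g x) powr p)"
    "(LINT x|lborel. indicator S x * norm (V x - g x) powr p) \<le> \<theta>"
proof -
  have cu: "continuous_on S u" using continuous_u S(2) continuous_on_subset by blast
  have cF: "continuous_on UNIV F" by (rule DERIV_continuous_on_UNIV[OF F])
  obtain d1 where d1: "d1 > 0" "\<And>x t. x \<in> S \<Longrightarrow> \<bar>t - u x\<bar> \<le> d1 \<Longrightarrow> \<bar>F t - F (u x)\<bar> \<le> \<theta>"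
    using uniform_approximation_compose[OF S(1) cu cF \<theta>] by blast
  obtain d2 where d2: "d2 > 0" "\<And>x t. x \<in> S \<Longrightarrow> \<bar>t - u x\<bar> \<le> d2 \<Longrightarrow> \<bar>F' t - F' (u x)\<bar> \<le> \<theta>"
    using uniform_approximation_compose[OF S(1) cu cF' \<theta>] by blast
  have "min \<theta> (min d1 d2) > 0" using \<theta> d1(1) d2(1) by simp
  then obtain U V where UV: "\<And>x. GDERIV U x :> V x" "continuous_on UNIV V" "\<And>x. x \<in> S \<Longrightarrow> \<bar>U x - u x\<bar> \<le> min \<theta> (min d1 d2)"
    "integrable lborel (\<lambda>x. indicator S x * norm (V x - g x) powr p)"
    "(LINT x|lborel. indicator S x * norm (V x - g x) powr p) \<le> min \<theta> (min d1 d2)"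
    using C1_approximation[OF S] by blast
  have cU: "continuous_on UNIV U" by (rule GDERIV_continuous_on[OF UV(1)])
  show ?thesis
    by (rule that[OF GDERIV_DERIV_compose[OF UV(1) F] UV(2) continuous_on_compose2[OF cF cU] continuous_on_compose2[OF cF' cU] d1(2) d2(2) UV(4)])
      (use UV(3,5) in auto)
qed

text \<open>Enlarges the class of test functions from smooth to C^1: mollifications of \<phi> are
  admissible, their gradients converge uniformly, and the flux is integrable on compact sets because
  its norm is \<open>norm (g x) powr (p - 1)\<close>. Later cutoffs and truncations therefore need
  only be C^1.\<close>

lemma weak_equation_C1:
  assumes D: "\<And>x. GDERIV \<phi> x :> D x" and cD: "continuous_on UNIV D"
    and S: "compact S" "S \<subseteq> \<Omega>" and z: "\<And>x. x \<notin> S \<Longrightarrow> \<phi> x = 0"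
  shows "(LINT x|lborel. flux x \<bullet> D x) = 0"
proof -
  obtain e1 K where e1: "e1 > 0" and K: "compact K" "K \<subseteq> \<Omega>" "S \<subseteq> K" "\<And>x y. x \<in> S \<Longrightarrow> norm (x - y) \<le> e1 \<Longrightarrow> y \<in> K"
    using compact_open_neighborhood[OF S(1) open_domain S(2)] by metis
  obtain R where R: "R > 0" "\<And>x. x \<in> S \<Longrightarrow> norm x \<le> R" using compact_imp_bounded[OF S(1)] bounded_pos by metis
  have c\<phi>: "continuous_on UNIV \<phi>" by (rule GDERIV_continuous_on[OF D])
  have zD: "D x = 0" if "x \<notin> S" for x
    by (rule GDERIV_eq_0[OF D, of "- S"]) (use S that z compact_imp_closed in auto)
  have zR: "norm x > R \<Longrightarrow> \<phi> x = 0" "norm x > R \<Longrightarrow> D x = 0" for x using z zD R by force+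
  have i\<phi>: "integrable lborel \<phi>" by (rule continuous_compact_support_integrable[OF c\<phi> S(1) z])
  have iD: "integrable lborel D" by (rule continuous_compact_support_integrable[OF cD S(1) zD])
  have [measurable]: "D \<in> borel_measurable borel" "K \<in> sets borel" "\<phi> \<in> borel_measurable borel"
    using cD c\<phi> K(1) by (auto intro: borel_measurable_continuous_onI borel_compact)
  have iF: "integrable lborel (\<lambda>x. indicator K x * norm (g x) powr (p - 1))"
    using g_powr_integrable[OF K(1,2), of "p - 1"] p_gt_1 by simp
  let ?m = "LINT x|lborel. indicator K x * norm (g x) powr (p - 1)"
  have bound: "\<bar>LINT x|lborel. flux x \<bullet> D x\<bar> \<le> \<delta> * ?m" if \<delta>: "\<delta> > 0" for \<delta>
  proof -
    obtain d where d: "d > 0" "\<And>x y. dist y x < d \<Longrightarrow> dist (D y) (D x) < \<delta>"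
      using uniformly_continuous_compact_support[OF cD zR(2) \<delta>] by metis
    define e where "e = min e1 d / 2"
    have e: "e > 0" "e < e1" "e < d" using e1 d(1) by (auto simp: e_def)
    let ?\<phi> = "\<lambda>x. LINT y|lborel. \<phi> y * mollifier e (x - y)"
    have G: "GDERIV ?\<phi> x :> mollify e D x" for x
    proof -
      \<comment> \<open>Reflecting the variable moves the derivative from the mollifier to \<phi>,
        which exhibits the gradient as a mollification of \<open>D\<close>.\<close>
      have "?\<phi> = (\<lambda>x. LINT y|lborel. mollifier e y * \<phi> (x - y))"
        using mollify_reflect[of \<phi> e] by (auto simp: fun_eq_iff mollify_eq_conv)
      moreover have "GDERIV (\<lambda>x. LINT y|lborel. mollifier e y * \<phi> (x - y)) x :> (LINT y|lborel. mollifier e y *\<^sub>R D (x - y))"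
        by (rule GDERIV_conv[OF integrable_mollifier[OF e(1)] D cD zR])
      ultimately show ?thesis by (simp add: mollify_reflect)
    qed
    have zK: "mollifier e (x - y) = 0 \<or> y \<notin> S" if "x \<notin> K" for x y
      using that K(4)[of y x] mollifier_eq_0[OF e(1), of "x - y"] e norm_minus_commute[of x y]
      by (cases "norm (x - y) \<ge> e") auto
    have test: "?\<phi> \<in> test_functions \<Omega>"
    proof (rule test_functionsI[OF _ K(1,2)])
      show "smooth ?\<phi>" by (rule smooth_conv[OF i\<phi> smooth_mollifier, of e]) (rule mollifier_eq_0[OF e(1)], simp)
      show "?\<phi> x = 0" if "x \<notin> K" for x
      proof -
        have "(\<lambda>y. \<phi> y * mollifier e (x - y)) = (\<lambda>y. 0)"
          using zK[OF that] z by (intro ext) (metis mult_zero_left mult_zero_right)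
        then show ?thesis by simp
      qed
    qed
    have "(LINT x|lborel. flux x \<bullet> mollify e D x) = 0"
      using weak_equation[OF test] grad_GDERIV[OF G] by (simp add: flux_def)
    have zm: "mollify e D x = 0" if "x \<notin> K" for x
    proof -
      have "(\<lambda>y. mollifier e (x - y) *\<^sub>R D y) = (\<lambda>y. 0)"
        using zK[OF that] zD by (intro ext) (metis scaleR_zero_left scaleR_zero_right)
      then show ?thesis by (simp add: mollify_def)
    qed
    have close: "norm (mollify e D x - D x) \<le> \<delta>" for x
    proof (rule mollify_close[OF e(1) iD])
      fix y assume "norm (x - y) < e"
      then have "dist y x < d" using e by (simp add: dist_norm norm_minus_commute)
      from d(2)[OF this] show "norm (D y - D x) \<le> \<delta>" by (simp add: dist_norm)
    qed
    have [measurable]: "mollify e D \<in> borel_measurable borel"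
      unfolding mollify_def[abs_def] by measurable
    obtain B where B: "B > 0" "\<And>x. norm (D x) \<le> B" using bounded_compact_support[OF cD zR(2)] by metis
    have int: "integrable lborel (\<lambda>x. flux x \<bullet> E x)"
      if [measurable]: "E \<in> borel_measurable borel" and E: "\<And>x. norm (E x) \<le> C" "\<And>x. x \<notin> K \<Longrightarrow> E x = 0" for E :: "real^'n \<Rightarrow> real^'n" and C
    proof (rule Bochner_Integration.integrable_bound)
      show "integrable lborel (\<lambda>x. C * (indicator K x * norm (g x) powr (p - 1)))" using iF by (rule integrable_mult_right)
      show "AE x in lborel. norm (flux x \<bullet> E x) \<le> norm (C * (indicator K x * norm (g x) powr (p - 1)))"
      proof (rule AE_I2)
        fix x
        have "norm (flux x \<bullet> E x) \<le> norm (flux x) * norm (E x)" unfolding real_norm_def by (rule Cauchy_Schwarz_ineq2)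
        also have "\<dots> \<le> norm (flux x) * (indicator K x * C)" using E by (intro mult_left_mono) (auto simp: indicator_def)
        also have "\<dots> = C * (indicator K x * norm (g x) powr (p - 1))" unfolding norm_flux by simp
        finally show "norm (flux x \<bullet> E x) \<le> norm (C * (indicator K x * norm (g x) powr (p - 1)))" by simp
      qed
    qed measurable
    have zDK: "x \<notin> K \<Longrightarrow> D x = 0" for x using zD K(3) by blast
    have i1: "integrable lborel (\<lambda>x. flux x \<bullet> D x)" by (rule int[OF _ B(2) zDK]) measurable
    have Bm: "norm (mollify e D x) \<le> B + \<delta>" for x using close[of x] B(2)[of x] by norm
    have i2: "integrable lborel (\<lambda>x. flux x \<bullet> mollify e D x)" by (rule int[OF _ Bm zm]) measurable
    have "(LINT x|lborel. flux x \<bullet> D x) = (LINT x|lborel. flux x \<bullet> D x) - (LINT x|lborel. flux x \<bullet> mollify e D x)"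
      using \<open>(LINT x|lborel. flux x \<bullet> mollify e D x) = 0\<close> by simp
    also have "\<dots> = (LINT x|lborel. flux x \<bullet> D x - flux x \<bullet> mollify e D x)"
      by (rule Bochner_Integration.integral_diff[OF i1 i2, symmetric])
    also have "\<bar>\<dots>\<bar> \<le> (LINT x|lborel. \<delta> * (indicator K x * norm (g x) powr (p - 1)))"
    proof (rule order_trans[OF integral_abs_bound integral_mono])
      show "integrable lborel (\<lambda>x. \<bar>flux x \<bullet> D x - flux x \<bullet> mollify e D x\<bar>)"
        by (intro integrable_abs Bochner_Integration.integrable_diff i1 i2)
      show "integrable lborel (\<lambda>x. \<delta> * (indicator K x * norm (g x) powr (p - 1)))" using iF by (rule integrable_mult_right)
      fix x
      have "\<bar>flux x \<bullet> D x - flux x \<bullet> mollify e D x\<bar> = \<bar>flux x \<bullet> (D x - mollify e D x)\<bar>" by (simp add: inner_diff_right)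
      also have "\<dots> \<le> norm (flux x) * norm (D x - mollify e D x)" by (rule Cauchy_Schwarz_ineq2)
      also have "\<dots> \<le> norm (flux x) * (indicator K x * \<delta>)"
        using close[of x] zDK zm by (intro mult_left_mono) (auto simp: indicator_def norm_minus_commute)
      also have "\<dots> = \<delta> * (indicator K x * norm (g x) powr (p - 1))" unfolding norm_flux by simp
      finally show "\<bar>flux x \<bullet> D x - flux x \<bullet> mollify e D x\<bar> \<le> \<delta> * (indicator K x * norm (g x) powr (p - 1))" .
    qed
    also have "\<dots> = \<delta> * ?m" by simp
    finally show ?thesis .
  qed
  have "\<bar>LINT x|lborel. flux x \<bullet> D x\<bar> \<le> 0 + e" if e: "e > 0" for e
  proof -
    have m: "?m \<ge> 0" by simp
    have "e / (?m + 1) > 0" using e m by (intro divide_pos_pos add_nonneg_pos) auto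
    from bound[OF this] mult_divide_add_one_less[OF m e] show ?thesis by (simp add: mult.commute)
  qed
  then have "\<bar>LINT x|lborel. flux x \<bullet> D x\<bar> \<le> 0" by (rule field_le_epsilon)
  then show ?thesis by simp
qed

end

section \<open>Caccioppoli inequality\<close>

context weak_p_harmonic
begin

lemma continuous_on_compose_u:
  assumes "S \<subseteq> \<Omega>" "continuous_on UNIV F"
  shows "continuous_on S (\<lambda>x. F (u x))"
  using continuous_on_compose2[OF assms(2) continuous_on_subset[OF continuous_u assms(1)]] by simp

lemma borel_measurable_indicator_continuous:
  assumes "compact S" "continuous_on S f"
  shows "(\<lambda>x::real^'n. indicator S x * f x :: real) \<in> borel_measurable borel"
  using borel_measurable_continuous_on_indicator[OF _ assms(2)] assms(1) by (simp add: borel_compact)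

lemma integrable_indicator_g:
  assumes S: "compact S" "S \<subseteq> \<Omega>" and f: "continuous_on S f" and k[measurable]: "k \<in> borel_measurable borel"
    and q: "0 \<le> q" "q \<le> p" and C: "\<And>x. x \<in> S \<Longrightarrow> \<bar>k x\<bar> \<le> C * norm (g x) powr q"
  shows "integrable lborel (\<lambda>x. indicator S x * (f x * k x))"
proof -
  obtain B where B: "B > 0" "\<And>x. x \<in> S \<Longrightarrow> \<bar>f x\<bar> \<le> B"
    using compact_imp_bounded[OF compact_continuous_image[OF f S(1)]] unfolding bounded_pos by auto
  have [measurable]: "(\<lambda>x. indicator S x * f x) \<in> borel_measurable borel"
    by (rule borel_measurable_indicator_continuous[OF S(1) f])
  show ?thesis
  proof (rule Bochner_Integration.integrable_bound[OF integrable_mult_right[OF g_powr_integrable[OF S q], of "B * C"]])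
    have "(\<lambda>x. (indicator S x * f x) * k x) \<in> borel_measurable lborel" by measurable
    then show "(\<lambda>x. indicator S x * (f x * k x)) \<in> borel_measurable lborel" by (simp add: mult.assoc)
    show "AE x in lborel. norm (indicator S x * (f x * k x)) \<le> norm (B * C * (indicator S x * norm (g x) powr q))"
    proof (rule AE_I2)
      fix x
      show "norm (indicator S x * (f x * k x)) \<le> norm (B * C * (indicator S x * norm (g x) powr q))"
      proof (cases "x \<in> S")
        case True
        have "\<bar>f x\<bar> * \<bar>k x\<bar> \<le> B * (C * norm (g x) powr q)"
          using B(1) B(2)[OF True] C[OF True] by (intro mult_mono) auto
        also have "\<dots> \<le> \<bar>B * C * norm (g x) powr q\<bar>" by (simp add: mult.assoc)
        finally show ?thesis using True by (simp add: abs_mult)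
      qed simp
    qed
  qed
qed

lemma flux_inner_le: "norm h \<le> B \<Longrightarrow> \<bar>flux x \<bullet> h\<bar> \<le> B * norm (g x) powr (p - 1)"
  using order_trans[OF Cauchy_Schwarz_ineq2 mult_left_mono[of "norm h" B "norm (flux x)"]]
  by (simp add: norm_flux mult.commute)

lemma caccioppoli_integrable:
  assumes c\<Phi>: "continuous_on UNIV \<Phi>" and c\<Phi>': "continuous_on UNIV \<Phi>'" and c\<eta>: "continuous_on UNIV \<eta>"
    and cH: "continuous_on UNIV H" and S: "compact S" "S \<subseteq> \<Omega>"
  shows "integrable lborel (\<lambda>x. indicator S x * (\<eta> x * \<Phi>' (u x) * norm (g x) powr p))"
    and "integrable lborel (\<lambda>x. indicator S x * (\<Phi> (u x) * (flux x \<bullet> H x)))"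
proof -
  have [measurable]: "H \<in> borel_measurable borel" using cH by (rule borel_measurable_continuous_onI)
  obtain B where B: "\<And>x. x \<in> S \<Longrightarrow> norm (H x) \<le> B"
    using compact_norm_bound[OF S(1) continuous_on_subset[OF cH]] by blast
  show "integrable lborel (\<lambda>x. indicator S x * (\<eta> x * \<Phi>' (u x) * norm (g x) powr p))"
    by (rule integrable_indicator_g[OF S, where q=p and C=1])
      (use p_gt_1 in \<open>auto intro!: continuous_intros continuous_on_compose_u S c\<Phi>' continuous_on_subset[OF c\<eta>]\<close>)
  show "integrable lborel (\<lambda>x. indicator S x * (\<Phi> (u x) * (flux x \<bullet> H x)))"
    by (rule integrable_indicator_g[OF S, where q="p - 1" and C=B])
      (use p_gt_1 flux_inner_le[OF B] in \<open>auto intro!: continuous_on_compose_u S c\<Phi>\<close>)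
qed

text \<open>Expands the weak equation tested with \<eta> times \<Phi> of a C^1 approximant. For
  every scale \<open>s\<close> the total error is at most \<open>s\<close> times the constant
  \<open>?C\<close>, which does not depend on the approximant, so the error is zero.\<close>

lemma caccioppoli_identity:
  assumes \<Phi>: "\<And>t. DERIV \<Phi> t :> \<Phi>' t" and c\<Phi>': "continuous_on UNIV \<Phi>'"
    and \<eta>: "\<And>x. GDERIV \<eta> x :> H x" and cH: "continuous_on UNIV H"
    and S: "compact S" "S \<subseteq> \<Omega>" and z: "\<And>x. x \<notin> S \<Longrightarrow> \<eta> x = 0"
  shows "(LINT x|lborel. indicator S x * (\<eta> x * \<Phi>' (u x) * norm (g x) powr p))
    = - (LINT x|lborel. indicator S x * (\<Phi> (u x) * (flux x \<bullet> H x)))"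
proof -
  have c\<Phi>: "continuous_on UNIV \<Phi>" by (rule DERIV_continuous_on_UNIV[OF \<Phi>])
  have c\<eta>: "continuous_on UNIV \<eta>" by (rule GDERIV_continuous_on[OF \<eta>])
  have [measurable]: "S \<in> sets borel" "H \<in> borel_measurable borel" "\<eta> \<in> borel_measurable borel"
    using S(1) cH c\<eta> by (auto intro: borel_compact borel_measurable_continuous_onI)
  have zH: "H x = 0" if "x \<notin> S" for x
    by (rule GDERIV_eq_0[OF \<eta>, of "- S"]) (use S that z compact_imp_closed in auto)
  obtain B1 where B1: "\<And>x. x \<in> S \<Longrightarrow> norm (\<eta> x) \<le> B1"
    using compact_norm_bound[OF S(1) continuous_on_subset[OF c\<eta>]] by blast
  obtain B2 where B2: "\<And>x. x \<in> S \<Longrightarrow> norm (H x) \<le> B2"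
    using compact_norm_bound[OF S(1) continuous_on_subset[OF cH]] by blast
  obtain B3 where B3: "\<And>x. x \<in> S \<Longrightarrow> norm (\<Phi>' (u x)) \<le> B3"
    using compact_norm_bound[OF S(1) continuous_on_compose_u[OF S(2) c\<Phi>']] by blast
  define B where "B = max 1 (max B1 (max B2 (B3 + 1)))"
  have B: "B \<ge> 1" "\<And>x. x \<in> S \<Longrightarrow> \<bar>\<eta> x\<bar> \<le> B" "\<And>x. x \<in> S \<Longrightarrow> norm (H x) \<le> B"
    "\<And>x. x \<in> S \<Longrightarrow> \<bar>\<Phi>' (u x)\<bar> + 1 \<le> B"
    using B1 B2 B3 by (force simp: B_def)+
  let ?Ip = "LINT x|lborel. indicator S x * norm (g x) powr p"
  let ?Iq = "LINT x|lborel. indicator S x * norm (g x) powr (p - 1)"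
  have iIp: "integrable lborel (\<lambda>x. indicator S x * norm (g x) powr p)" by (rule g_Lp[OF S])
  have iIq: "integrable lborel (\<lambda>x. indicator S x * norm (g x) powr (p - 1))"
    using g_powr_integrable[OF S, of "p - 1"] p_gt_1 by simp
  let ?P = "\<lambda>x. indicator S x * (\<eta> x * \<Phi>' (u x) * norm (g x) powr p)"
  let ?Q = "\<lambda>x. indicator S x * (\<Phi> (u x) * (flux x \<bullet> H x))"
  have fluxH: "\<bar>flux x \<bullet> H x\<bar> \<le> B * norm (g x) powr (p - 1)" if "x \<in> S" for x
    by (rule flux_inner_le[OF B(3)[OF that]])
  have iP: "integrable lborel ?P" and iQ: "integrable lborel ?Q"
    by (rule caccioppoli_integrable[OF c\<Phi> c\<Phi>' c\<eta> cH S])+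
  let ?C = "B * ?Ip + B * B * ?Ip + B * B + B * ?Iq"
  have bound: "\<bar>(LINT x|lborel. ?P x) + (LINT x|lborel. ?Q x)\<bar> \<le> s * ?C" if s: "s > 0" for s
  proof -
    \<comment> \<open>The bound by \<open>s powr p\<close> compensates the factor
      \<open>s powr (1 - p)\<close> that Young's inequality puts on the integral of
      \<open>norm (V x - g x) powr p\<close>.\<close>
    define \<theta> where "\<theta> = min (min s 1) (s powr p)"
    have \<theta>: "\<theta> > 0" "\<theta> \<le> s" "\<theta> \<le> 1" "\<theta> \<le> s powr p" using s by (auto simp: \<theta>_def)
    let ?D = "\<lambda>V x. indicator S x * norm (V x - g x) powr p"
    obtain U V where UV: "\<And>x. GDERIV (\<lambda>x. \<Phi> (U x)) x :> \<Phi>' (U x) *\<^sub>R V x" "continuous_on UNIV V"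
      "continuous_on UNIV (\<lambda>x. \<Phi> (U x))" "continuous_on UNIV (\<lambda>x. \<Phi>' (U x))"
      "\<And>x. x \<in> S \<Longrightarrow> \<bar>\<Phi> (U x) - \<Phi> (u x)\<bar> \<le> \<theta>" "\<And>x. x \<in> S \<Longrightarrow> \<bar>\<Phi>' (U x) - \<Phi>' (u x)\<bar> \<le> \<theta>"
      and D: "integrable lborel (?D V)" "(LINT x|lborel. ?D V x) \<le> \<theta>"
      using C1_approximation_compose[OF \<Phi> c\<Phi>' S \<theta>(1)] by blast
    let ?D = "?D V"
    have [measurable]: "V \<in> borel_measurable borel" "(\<lambda>x. \<Phi> (U x)) \<in> borel_measurable borel" "(\<lambda>x. \<Phi>' (U x)) \<in> borel_measurable borel"
      using UV(2-4) by (auto intro: borel_measurable_continuous_onI)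
    let ?E = "\<lambda>x. \<eta> x *\<^sub>R (\<Phi>' (U x) *\<^sub>R V x) + \<Phi> (U x) *\<^sub>R H x"
    have GE: "GDERIV (\<lambda>x. \<eta> x * \<Phi> (U x)) x :> ?E x" for x
      by (rule GDERIV_mult[OF \<eta> UV(1)])
    have cE: "continuous_on UNIV ?E"
      by (intro continuous_intros c\<eta> UV cH)
    have eq0: "(LINT x|lborel. flux x \<bullet> ?E x) = 0"
      using weak_equation_C1[OF GE cE S] z by simp
    have pt: "\<bar>?P x + ?Q x - flux x \<bullet> ?E x\<bar> \<le> s * (B * (indicator S x * norm (g x) powr p)
        + B * B * (indicator S x * norm (g x) powr p) + B * (indicator S x * norm (g x) powr (p - 1)))
        + B * B * s powr (1 - p) * ?D x" for x
    proof (cases "x \<in> S")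
      case True
      have t1: "\<bar>\<Phi> (U x) - \<Phi> (u x)\<bar> \<le> s" and t2: "\<bar>\<Phi>' (U x) - \<Phi>' (u x)\<bar> \<le> s" and t3: "\<bar>\<Phi>' (U x)\<bar> \<le> B"
        using UV(5,6)[OF True] B(4)[OF True] \<theta> by linarith+
      have t4: "\<bar>flux x \<bullet> (g x - V x)\<bar> \<le> s * norm (g x) powr p + s powr (1 - p) * norm (V x - g x) powr p"
      proof -
        have "\<bar>flux x \<bullet> (g x - V x)\<bar> \<le> norm (flux x) * norm (g x - V x)" by (rule Cauchy_Schwarz_ineq2)
        also have "\<dots> = norm (g x) powr (p - 1) * norm (V x - g x)" by (simp add: norm_flux norm_minus_commute)
        also have "\<dots> \<le> s * norm (g x) powr p + s powr (1 - p) * norm (V x - g x) powr p"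
          using p_gt_1 s by (intro powr_mult_le_split) auto
        finally show ?thesis .
      qed
      \<comment> \<open>Three errors, from evaluating \<open>\<Phi>'\<close> at the approximant,
        from replacing \<open>g\<close> by \<open>V\<close>, and from evaluating
        \<open>\<Phi>\<close> at the approximant.\<close>
      have eq: "?P x + ?Q x - flux x \<bullet> ?E x = \<eta> x * (\<Phi>' (u x) - \<Phi>' (U x)) * norm (g x) powr p
        + \<eta> x * \<Phi>' (U x) * (flux x \<bullet> (g x - V x)) + (\<Phi> (u x) - \<Phi> (U x)) * (flux x \<bullet> H x)"
        using True by (simp add: inner_diff_right inner_add_right flux_inner_g algebra_simps)
      have "\<bar>?P x + ?Q x - flux x \<bullet> ?E x\<bar> \<le> \<bar>\<eta> x * (\<Phi>' (u x) - \<Phi>' (U x)) * norm (g x) powr p\<bar>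
        + \<bar>\<eta> x * \<Phi>' (U x) * (flux x \<bullet> (g x - V x))\<bar> + \<bar>(\<Phi> (u x) - \<Phi> (U x)) * (flux x \<bullet> H x)\<bar>"
        unfolding eq
        by linarith
      also have "\<dots> \<le> B * s * norm (g x) powr p
        + B * B * (s * norm (g x) powr p + s powr (1 - p) * norm (V x - g x) powr p) + s * (B * norm (g x) powr (p - 1))"
      proof (intro add_mono)
        have "\<bar>\<eta> x\<bar> * \<bar>\<Phi>' (u x) - \<Phi>' (U x)\<bar> \<le> B * s"
          using B(1) B(2)[OF True] t2 by (intro mult_mono) (auto simp: abs_minus_commute)
        then show "\<bar>\<eta> x * (\<Phi>' (u x) - \<Phi>' (U x)) * norm (g x) powr p\<bar> \<le> B * s * norm (g x) powr p"
          unfolding abs_mult by (simp add: mult_right_mono)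
        have "\<bar>\<eta> x\<bar> * \<bar>\<Phi>' (U x)\<bar> \<le> B * B"
          using B(1) B(2)[OF True] t3 by (intro mult_mono) auto
        then show "\<bar>\<eta> x * \<Phi>' (U x) * (flux x \<bullet> (g x - V x))\<bar>
            \<le> B * B * (s * norm (g x) powr p + s powr (1 - p) * norm (V x - g x) powr p)"
          unfolding abs_mult using t4 B(1) by (intro mult_mono[of "\<bar>\<eta> x\<bar> * \<bar>\<Phi>' (U x)\<bar>"]) simp_all
        show "\<bar>(\<Phi> (u x) - \<Phi> (U x)) * (flux x \<bullet> H x)\<bar> \<le> s * (B * norm (g x) powr (p - 1))"
          unfolding abs_mult using t1 fluxH[OF True] s by (intro mult_mono) (auto simp: abs_minus_commute)
      qed
      also have "\<dots> = s * (B * (indicator S x * norm (g x) powr p)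
        + B * B * (indicator S x * norm (g x) powr p) + B * (indicator S x * norm (g x) powr (p - 1)))
        + B * B * s powr (1 - p) * ?D x"
        using True by (simp add: algebra_simps)
      finally show ?thesis .
    qed (use z zH in simp)
    have iPQ: "integrable lborel (\<lambda>x. ?P x + ?Q x)" using iP iQ by (rule Bochner_Integration.integrable_add)
    have iR: "integrable lborel (\<lambda>x. s * (B * (indicator S x * norm (g x) powr p)
        + B * B * (indicator S x * norm (g x) powr p) + B * (indicator S x * norm (g x) powr (p - 1)))
        + B * B * s powr (1 - p) * ?D x)"
      by (intro Bochner_Integration.integrable_add integrable_mult_right iIp iIq D)
    \<comment> \<open>The pointwise estimate itself supplies the dominating function.\<close>
    have iE: "integrable lborel (\<lambda>x. flux x \<bullet> ?E x)"
    proof (rule Bochner_Integration.integrable_bound[OF Bochner_Integration.integrable_add[OF iR integrable_norm[OF iPQ]]])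
      show "AE x in lborel. norm (flux x \<bullet> ?E x) \<le> norm (s * (B * (indicator S x * norm (g x) powr p)
        + B * B * (indicator S x * norm (g x) powr p) + B * (indicator S x * norm (g x) powr (p - 1)))
        + B * B * s powr (1 - p) * ?D x + norm (?P x + ?Q x))"
        using pt by (intro AE_I2) (smt (verit) real_norm_def)
    qed measurable
    have eq: "(LINT x|lborel. ?P x) + (LINT x|lborel. ?Q x) = (LINT x|lborel. ?P x + ?Q x - flux x \<bullet> ?E x)"
      using Bochner_Integration.integral_add[OF iP iQ] eq0 Bochner_Integration.integral_diff[OF iPQ iE] by simp
    have "\<bar>(LINT x|lborel. ?P x) + (LINT x|lborel. ?Q x)\<bar> \<le> (LINT x|lborel. s * (B * (indicator S x * norm (g x) powr p)
        + B * B * (indicator S x * norm (g x) powr p) + B * (indicator S x * norm (g x) powr (p - 1)))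
        + B * B * s powr (1 - p) * ?D x)"
      unfolding eq
    proof (rule order_trans[OF integral_abs_bound integral_mono])
      show "integrable lborel (\<lambda>x. \<bar>?P x + ?Q x - flux x \<bullet> ?E x\<bar>)"
        by (rule integrable_abs[OF Bochner_Integration.integrable_diff[OF iPQ iE]])
    qed (rule iR, rule pt)
    also have "\<dots> = s * (B * ?Ip + B * B * ?Ip + B * ?Iq) + B * B * s powr (1 - p) * (LINT x|lborel. ?D x)"
      using iIp iIq D(1)
      by (simp only: Bochner_Integration.integral_add Bochner_Integration.integrable_add integrable_mult_right integral_mult_right_zero)
    also have "\<dots> \<le> s * (B * ?Ip + B * B * ?Ip + B * ?Iq) + B * B * s powr (1 - p) * s powr p"
      using D(2) \<theta>(4) B(1) by (intro add_left_mono mult_left_mono) auto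
    also have "\<dots> = s * ?C" using s by (simp add: algebra_simps flip: powr_add)
    finally show ?thesis .
  qed
  have C: "?C \<ge> 0" using B(1) by (intro add_nonneg_nonneg mult_nonneg_nonneg integral_nonneg) auto
  have "\<bar>(LINT x|lborel. ?P x) + (LINT x|lborel. ?Q x)\<bar> \<le> 0 + e" if e: "e > 0" for e
  proof -
    have "e / (?C + 1) > 0" using e C by (intro divide_pos_pos add_nonneg_pos) auto
    from bound[OF this] mult_divide_add_one_less[OF C e] show ?thesis by (simp add: mult.commute)
  qed
  then have "\<bar>(LINT x|lborel. ?P x) + (LINT x|lborel. ?Q x)\<bar> \<le> 0" by (rule field_le_epsilon)
  then show ?thesis by linarith
qed

text \<open>The growth condition on \<Phi> bounds the cross term by a product
  \<open>a powr (p - 1) * b\<close> with a^p the energy density, and Young's inequality with weight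
  1/2 absorbs half of the energy. The gradient of the cutoff has to be controlled only where
  \<Phi>(u) does not vanish, a freedom on which the maximum principle relies.\<close>

lemma caccioppoli_inequality:
  assumes \<Phi>: "\<And>t. DERIV \<Phi> t :> \<Phi>' t" and c\<Phi>': "continuous_on UNIV \<Phi>'"
    and \<eta>: "\<And>x. GDERIV \<eta> x :> H x" and cH: "continuous_on UNIV H"
    and S: "compact S" "S \<subseteq> \<Omega>" and z: "\<And>x. x \<notin> S \<Longrightarrow> \<eta> x = 0" and \<eta>0: "\<And>x. \<eta> x \<ge> 0"
    and L: "L \<ge> 0" "\<And>x. x \<in> S \<Longrightarrow> \<Phi>' (u x) \<ge> 0 \<and> \<bar>\<Phi> (u x)\<bar> \<le> L powr (1 / p) * \<Phi>' (u x) powr ((p - 1) / p)"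
    and G: "G \<ge> 0" "D \<in> sets borel" "emeasure lborel D < \<infinity>"
      "\<And>x. x \<in> S \<Longrightarrow> \<Phi> (u x) \<noteq> 0 \<Longrightarrow> H x \<noteq> 0 \<Longrightarrow> x \<in> D \<and> norm (H x) \<le> G * \<eta> x powr ((p - 1) / p)"
  shows "(LINT x|lborel. indicator S x * (\<eta> x * \<Phi>' (u x) * norm (g x) powr p))
    \<le> 2 powr p * L * G powr p * measure lborel D"
proof -
  have c\<Phi>: "continuous_on UNIV \<Phi>" by (rule DERIV_continuous_on_UNIV[OF \<Phi>])
  have c\<eta>: "continuous_on UNIV \<eta>" by (rule GDERIV_continuous_on[OF \<eta>])
  have [measurable]: "S \<in> sets borel" "H \<in> borel_measurable borel" "D \<in> sets borel"
    using S(1) cH G by (auto intro: borel_compact borel_measurable_continuous_onI)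
  let ?P = "\<lambda>x. indicator S x * (\<eta> x * \<Phi>' (u x) * norm (g x) powr p)"
  let ?Q = "\<lambda>x. indicator S x * (\<Phi> (u x) * (flux x \<bullet> H x))"
  let ?c = "2 powr (p - 1) * (L * G powr p)"
  have iP: "integrable lborel ?P" and iQ: "integrable lborel ?Q"
    by (rule caccioppoli_integrable[OF c\<Phi> c\<Phi>' c\<eta> cH S])+
  have iD: "integrable lborel (\<lambda>x. ?c * indicator D x)"
    using G(2,3) by (intro integrable_mult_right) simp
  have pt: "- ?Q x \<le> 1 / 2 * ?P x + ?c * indicator D x" for x
  proof (cases "x \<in> S \<and> \<Phi> (u x) \<noteq> 0 \<and> H x \<noteq> 0")
    case True
    then have x: "x \<in> S" and HG: "norm (H x) \<le> G * \<eta> x powr ((p - 1) / p)" and xD: "x \<in> D" using G(4) by auto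
    have \<Phi>x: "\<Phi>' (u x) \<ge> 0" "\<bar>\<Phi> (u x)\<bar> \<le> L powr (1 / p) * \<Phi>' (u x) powr ((p - 1) / p)" using L(2)[OF x] by auto
    define a where "a = (\<eta> x * \<Phi>' (u x)) powr (1 / p) * norm (g x)"
    define b where "b = L powr (1 / p) * G"
    have "- ?Q x \<le> \<bar>\<Phi> (u x)\<bar> * \<bar>flux x \<bullet> H x\<bar>" using x by (simp flip: abs_mult)
    also have "\<dots> \<le> \<bar>\<Phi> (u x)\<bar> * (norm (flux x) * norm (H x))"
      by (intro mult_left_mono Cauchy_Schwarz_ineq2) auto
    also have "\<dots> \<le> (L powr (1 / p) * \<Phi>' (u x) powr ((p - 1) / p)) * (norm (g x) powr (p - 1) * (G * \<eta> x powr ((p - 1) / p)))"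
      unfolding norm_flux using \<Phi>x HG by (intro mult_mono) auto
    also have "\<dots> = a powr (p - 1) * b"
    proof -
      have "a powr (p - 1) = (\<eta> x * \<Phi>' (u x)) powr ((p - 1) / p) * norm (g x) powr (p - 1)"
        unfolding a_def using \<Phi>x(1) \<eta>0[of x] by (simp add: powr_mult powr_powr)
      also have "(\<eta> x * \<Phi>' (u x)) powr ((p - 1) / p) = \<eta> x powr ((p - 1) / p) * \<Phi>' (u x) powr ((p - 1) / p)"
        using \<Phi>x(1) \<eta>0[of x] by (simp add: powr_mult)
      finally show ?thesis by (simp add: b_def)
    qed
    also have "\<dots> \<le> 1 / 2 * a powr p + (1 / 2) powr (1 - p) * b powr p"
      using p_gt_1 G(1) by (intro powr_mult_le_split) (auto simp: a_def b_def)
    also have "a powr p = ?P x"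
      unfolding a_def using x \<Phi>x(1) \<eta>0[of x] p_gt_1 by (simp add: powr_mult powr_powr)
    also have "(1 / 2) powr (1 - p) * b powr p = ?c"
    proof -
      have "(1 / 2) powr (1 - p) = 2 powr (p - 1)"
        by (simp add: powr_divide) (metis minus_diff_eq powr_minus_divide)
      then show ?thesis using L(1) G(1) p_gt_1 by (simp add: b_def powr_mult powr_powr)
    qed
    finally show ?thesis using xD by simp
  next
    case False
    then have "?Q x = 0" by auto
    moreover have "?P x \<ge> 0" using L(2)[of x] \<eta>0[of x] by (simp add: indicator_def)
    moreover have "?c * indicator D x \<ge> 0" using L(1) by simp
    ultimately show ?thesis by linarith
  qed
  have "(LINT x|lborel. ?P x) = (LINT x|lborel. - ?Q x)"
    using caccioppoli_identity[OF \<Phi> c\<Phi>' \<eta> cH S z] by simp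
  also have "\<dots> \<le> (LINT x|lborel. 1 / 2 * ?P x + ?c * indicator D x)"
    using pt by (intro integral_mono Bochner_Integration.integrable_add iD integrable_mult_right iP) (use iQ in auto)
  also have "\<dots> = 1 / 2 * (LINT x|lborel. ?P x) + ?c * measure lborel D"
    using iP iD G by (subst Bochner_Integration.integral_add) (auto intro: integrable_mult_right)
  finally have "(LINT x|lborel. ?P x) \<le> 2 * ?c * measure lborel D" by linarith
  also have "2 * ?c = 2 powr p * L * G powr p"
    by (simp add: powr_diff)
  finally show ?thesis .
qed

end

section \<open>Morrey's inequality\<close>

lemma nn_integral_lborel_affine:
  fixes k :: "'a::euclidean_space \<Rightarrow> ennreal"
  assumes [measurable]: "k \<in> borel_measurable borel" and t: "t > 0"
  shows "(\<integral>\<^sup>+w. k w \<partial>lborel) = ennreal (t ^ DIM('a)) * (\<integral>\<^sup>+z. k (c + t *\<^sub>R z) \<partial>lborel)"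
proof -
  have "(\<integral>\<^sup>+w. k w \<partial>lborel) = (\<integral>\<^sup>+w. k w \<partial>density (distr lborel borel (\<lambda>x. c + t *\<^sub>R x)) (\<lambda>_. \<bar>t\<bar> ^ DIM('a)))"
    using t by (subst lborel_affine[of t c]) simp_all
  also have "\<dots> = (\<integral>\<^sup>+w. ennreal (\<bar>t\<bar> ^ DIM('a)) * k w \<partial>distr lborel borel (\<lambda>x. c + t *\<^sub>R x))"
    by (rule nn_integral_density) auto
  also have "\<dots> = (\<integral>\<^sup>+z. ennreal (\<bar>t\<bar> ^ DIM('a)) * k (c + t *\<^sub>R z) \<partial>lborel)"
    by (rule nn_integral_distr) auto
  also have "\<dots> = ennreal (\<bar>t\<bar> ^ DIM('a)) * (\<integral>\<^sup>+z. k (c + t *\<^sub>R z) \<partial>lborel)"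
    by (rule nn_integral_cmult) measurable
  finally show ?thesis using t by simp
qed

lemma nn_integral_powr_unit_interval:
  fixes a :: real
  assumes "0 < a" "a < 1"
  shows "(\<integral>\<^sup>+t. ennreal (indicator {0..1} t * t powr (- a)) \<partial>lborel) = ennreal (1 / (1 - a))"
proof (rule nn_integral_has_integral_lborel)
  have "((\<lambda>t::real. t powr (- a)) has_integral (1 powr (- a + 1) / (- a + 1))) {0..1}"
    using assms by (intro has_integral_powr_from_0) auto
  then have "((\<lambda>t::real. if t \<in> {0..1} then t powr (- a) else 0) has_integral (1 / (1 - a))) UNIV"
    by (subst has_integral_restrict_UNIV) simp
  moreover have "(\<lambda>t::real. if t \<in> {0..1} then t powr (- a) else 0) = (\<lambda>t. indicator {0..1} t * t powr (- a))"
    by (auto simp: indicator_def)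
  ultimately show "((\<lambda>t::real. indicator {0..1} t * t powr (- a)) has_integral (1 / (1 - a))) UNIV" by simp
qed auto

text \<open>Fundamental theorem of calculus along the segment; as a nonnegative extended integral it
  can be exchanged with the integral over \<open>z\<close> without integrability checks.\<close>

lemma segment_difference_le:
  fixes f :: "'a::euclidean_space \<Rightarrow> real"
  assumes D: "\<And>x. GDERIV f x :> D x" and c: "continuous_on UNIV D"
  shows "ennreal \<bar>f z - f x\<bar> \<le> (\<integral>\<^sup>+t. ennreal (indicator {0..1} t * (norm (z - x) * norm (D (x + t *\<^sub>R (z - x))))) \<partial>lborel)"
proof -
  let ?c = "\<lambda>t::real. x + t *\<^sub>R (z - x)"
  let ?F = "\<lambda>t. f (?c t)" and ?F' = "\<lambda>t. (z - x) \<bullet> D (?c t)"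
  have cc: "continuous_on UNIV (\<lambda>t. D (?c t))"
    by (rule continuous_on_compose2[OF c]) (auto intro!: continuous_intros)
  have d: "(?F has_vector_derivative ?F' t) (at t within {0..1})" for t
  proof -
    have "(?c has_derivative (\<lambda>s. s *\<^sub>R (z - x))) (at t)" by (auto intro!: derivative_eq_intros)
    from has_derivative_compose[OF this D[unfolded gderiv_def]]
    have "(?F has_vector_derivative ?F' t) (at t)" by (simp add: has_vector_derivative_def)
    then show ?thesis by (rule has_vector_derivative_at_within)
  qed
  have cF': "continuous_on {0..1} ?F'"
    by (intro continuous_intros continuous_on_subset[OF cc]) auto
  have "has_bochner_integral lborel (\<lambda>t. indicator {0..1} t *\<^sub>R ?F' t) (?F 1 - ?F 0)"
    by (rule has_bochner_integral_FTC_Icc[OF _ d cF']) simp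
  then have i: "integrable lborel (\<lambda>t. indicator {0..1} t *\<^sub>R ?F' t)" and e: "(LINT t|lborel. indicator {0..1} t *\<^sub>R ?F' t) = f z - f x"
    by (auto simp: has_bochner_integral_iff)
  have "ennreal \<bar>f z - f x\<bar> \<le> (\<integral>\<^sup>+t. ennreal (norm (indicator {0..1} t *\<^sub>R ?F' t)) \<partial>lborel)"
    using integral_norm_bound_ennreal[OF i] e by simp
  also have "\<dots> \<le> (\<integral>\<^sup>+t. ennreal (indicator {0..1} t * (norm (z - x) * norm (D (?c t)))) \<partial>lborel)"
    using Cauchy_Schwarz_ineq2 by (intro nn_integral_mono ennreal_leI) (auto simp: indicator_def)
  finally show ?thesis .
qed

text \<open>The substitution \<open>w = x + t (z - x)\<close> maps \<open>W\<close> into itself; with \<open>n\<close> the dimension, the factor \<open>t powr (- n / p)\<close> that it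
  produces is integrable on \<open>[0, 1]\<close> since \<open>p > n\<close>, and no polar coordinates are needed.\<close>

lemma morrey_C1_average:
  fixes f :: "'a::euclidean_space \<Rightarrow> real"
  assumes D: "\<And>x. GDERIV f x :> D x" and c: "continuous_on UNIV D"
    and W: "open W" "convex W" "bounded W" and d: "\<And>x y. x \<in> W \<Longrightarrow> y \<in> W \<Longrightarrow> norm (x - y) \<le> d"
    and p: "p > real DIM('a)" and x: "x \<in> W"
  defines "I \<equiv> LINT z|lborel. indicator W z * norm (D z) powr p"
  shows "(\<integral>\<^sup>+z. indicator W z * ennreal \<bar>f z - f x\<bar> \<partial>lborel)
    \<le> ennreal (d * measure lborel W powr (1 - 1 / p) * I powr (1 / p) / (1 - real DIM('a) / p))"
proof -
  let ?n = "DIM('a)" and ?m = "measure lborel W"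
  have p1: "p > 1" using p DIM_positive[where 'a='a] by linarith
  have [measurable]: "W \<in> sets borel" "D \<in> borel_measurable borel"
    using W c by (auto intro: borel_measurable_continuous_onI)
  have cf: "continuous_on UNIV f" by (rule GDERIV_continuous_on[OF D])
  have [measurable]: "f \<in> borel_measurable borel" using cf by (rule borel_measurable_continuous_onI)
  have finW: "emeasure lborel W < \<infinity>" using W(3) emeasure_bounded_finite by blast
  have iW: "integrable lborel (indicator W :: 'a \<Rightarrow> real)" using finW by simp
  have d0: "d \<ge> 0" using d[OF x x] by simp
  have "compact (closure W)" using W(3) by (simp add: compact_closure)
  then obtain B where B: "B > 0" "\<And>z. z \<in> closure W \<Longrightarrow> norm (D z) \<le> B"
    using compact_norm_bound[OF _ continuous_on_subset[OF c]] by blast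
  have BW: "norm (D z) \<le> B" if "z \<in> W" for z using B(2) that closure_subset by blast
  have iI: "integrable lborel (\<lambda>z. indicator W z * norm (D z) powr p)"
  proof (rule Bochner_Integration.integrable_bound[OF integrable_mult_right[OF iW, of "B powr p"]])
    show "AE z in lborel. norm (indicator W z * norm (D z) powr p) \<le> norm (B powr p * indicator W z)"
      using BW p1 by (intro AE_I2) (auto simp: indicator_def intro!: powr_mono2)
  qed measurable
  have I0: "I \<ge> 0" unfolding I_def by simp
  let ?h = "\<lambda>t z. D (x + t *\<^sub>R (z - x))"
  have inner: "(\<integral>\<^sup>+z. ennreal (indicator W z * norm (?h t z)) \<partial>lborel)
      \<le> ennreal (?m powr (1 - 1 / p) * I powr (1 / p) * t powr (- (real ?n / p)))" if t: "0 < t" "t \<le> 1" for t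
  proof -
    have inW: "(x - t *\<^sub>R x) + t *\<^sub>R z \<in> W" if "z \<in> W" for z
    proof -
      have "(1 - t) *\<^sub>R x + t *\<^sub>R z \<in> W" using t that x W(2) by (intro convexD) auto
      then show ?thesis by (simp add: algebra_simps)
    qed
    have eq: "?h t z = D ((x - t *\<^sub>R x) + t *\<^sub>R z)" for z by (simp add: algebra_simps)
    have "ennreal (t ^ ?n) * (\<integral>\<^sup>+z. ennreal (indicator W z * norm (?h t z) powr p) \<partial>lborel)
      \<le> ennreal (t ^ ?n) * (\<integral>\<^sup>+z. ennreal (indicator W ((x - t *\<^sub>R x) + t *\<^sub>R z) * norm (D ((x - t *\<^sub>R x) + t *\<^sub>R z)) powr p) \<partial>lborel)"
      unfolding eq using inW by (intro mult_left_mono nn_integral_mono ennreal_leI) (auto simp: indicator_def)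
    also have "\<dots> = (\<integral>\<^sup>+w. ennreal (indicator W w * norm (D w) powr p) \<partial>lborel)"
      by (rule nn_integral_lborel_affine[OF _ t(1), symmetric]) measurable
    also have "\<dots> = ennreal I"
      unfolding I_def by (rule nn_integral_eq_integral[OF iI]) simp
    finally have le: "ennreal (t ^ ?n) * (\<integral>\<^sup>+z. ennreal (indicator W z * norm (?h t z) powr p) \<partial>lborel) \<le> ennreal I" .
    have "(\<integral>\<^sup>+z. ennreal (indicator W z * norm (?h t z) powr p) \<partial>lborel)
      = ennreal (1 / t ^ ?n) * (ennreal (t ^ ?n) * (\<integral>\<^sup>+z. ennreal (indicator W z * norm (?h t z) powr p) \<partial>lborel))"
      using t by (simp flip: mult.assoc ennreal_mult)
    also have "\<dots> \<le> ennreal (1 / t ^ ?n) * ennreal I" using le by (rule mult_left_mono) simp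
    also have "\<dots> = ennreal (I / t ^ ?n)" using t I0 by (simp flip: ennreal_mult)
    finally have le2: "(\<integral>\<^sup>+z. ennreal (indicator W z * norm (?h t z) powr p) \<partial>lborel) \<le> ennreal (I / t ^ ?n)" .
    have ihp: "integrable lborel (\<lambda>z. indicator W z * norm (?h t z) powr p)"
      and ihp_le: "(LINT z|lborel. indicator W z * norm (?h t z) powr p) \<le> I / t ^ ?n"
      using nn_integral_le_imp_integral_le[OF _ _ _ le2] t I0 by auto
    \<comment> \<open>Hoelder's inequality on \<open>W\<close>, obtained from the power mean
      inequality with the indicator of \<open>W\<close> as weight.\<close>
    have 1: "integrable lborel (\<lambda>z. indicator W z *\<^sub>R norm (?h t z))"
      and 2: "norm (LINT z|lborel. indicator W z *\<^sub>R norm (?h t z)) powr p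
        \<le> (LINT z|lborel. indicator W z) powr (p - 1) * (LINT z|lborel. indicator W z * norm (norm (?h t z)) powr p)"
      using weighted_power_mean[OF p1 iW, of "\<lambda>z. norm (?h t z)"] ihp by simp_all
    let ?J = "LINT z|lborel. indicator W z * norm (?h t z)"
    have J0: "?J \<ge> 0" by simp
    have "?J powr p \<le> ?m powr (p - 1) * (LINT z|lborel. indicator W z * norm (?h t z) powr p)"
      using 2 J0 by simp
    also have "\<dots> \<le> ?m powr (p - 1) * (I / t ^ ?n)" using ihp_le by (intro mult_left_mono) auto
    finally have "(?J powr p) powr (1 / p) \<le> (?m powr (p - 1) * (I / t ^ ?n)) powr (1 / p)"
      using p1 by (intro powr_mono2) auto
    also have "(?J powr p) powr (1 / p) = ?J" using p1 J0 by (simp add: powr_powr)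
    also have "(?m powr (p - 1) * (I / t ^ ?n)) powr (1 / p) = ?m powr (1 - 1 / p) * I powr (1 / p) * t powr (- (real ?n / p))"
    proof -
      have "(?m powr (p - 1) * (I / t ^ ?n)) powr (1 / p) = (?m powr (p - 1)) powr (1 / p) * (I powr (1 / p) / (t ^ ?n) powr (1 / p))"
        using t I0 by (simp add: powr_mult powr_divide)
      also have "(?m powr (p - 1)) powr (1 / p) = ?m powr (1 - 1 / p)" using p1 by (simp add: powr_powr diff_divide_distrib)
      also have "(t ^ ?n) powr (1 / p) = t powr (real ?n / p)" using t by (simp add: powr_realpow[symmetric] powr_powr)
      finally show ?thesis by (simp add: powr_minus divide_inverse)
    qed
    finally have J: "?J \<le> ?m powr (1 - 1 / p) * I powr (1 / p) * t powr (- (real ?n / p))" .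
    have "(\<integral>\<^sup>+z. ennreal (indicator W z * norm (?h t z)) \<partial>lborel) = ennreal ?J"
      using 1 by (intro nn_integral_eq_integral) auto
    then show ?thesis using ennreal_leI[OF J] by simp
  qed
  let ?K = "d * (?m powr (1 - 1 / p) * I powr (1 / p))"
  have K0: "?K \<ge> 0" using d0 by simp
  have "(\<integral>\<^sup>+z. indicator W z * ennreal \<bar>f z - f x\<bar> \<partial>lborel)
      \<le> (\<integral>\<^sup>+z. (\<integral>\<^sup>+t. ennreal (indicator {0..1} t * (d * (indicator W z * norm (?h t z)))) \<partial>lborel) \<partial>lborel)"
  proof (rule nn_integral_mono)
    fix z
    show "indicator W z * ennreal \<bar>f z - f x\<bar> \<le> (\<integral>\<^sup>+t. ennreal (indicator {0..1} t * (d * (indicator W z * norm (?h t z)))) \<partial>lborel)"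
    proof (cases "z \<in> W")
      case True
      have "ennreal \<bar>f z - f x\<bar> \<le> (\<integral>\<^sup>+t. ennreal (indicator {0..1} t * (norm (z - x) * norm (?h t z))) \<partial>lborel)"
        by (rule segment_difference_le[OF D c])
      also have "\<dots> \<le> (\<integral>\<^sup>+t. ennreal (indicator {0..1} t * (d * norm (?h t z))) \<partial>lborel)"
        using d[OF True x] by (intro nn_integral_mono ennreal_leI mult_left_mono mult_right_mono) auto
      finally show ?thesis using True by simp
    qed simp
  qed
  also have "\<dots> = (\<integral>\<^sup>+t. (\<integral>\<^sup>+z. ennreal (indicator {0..1} t * (d * (indicator W z * norm (?h t z)))) \<partial>lborel) \<partial>lborel)"
    by (rule lborel_pair.Fubini') measurable
  also have "\<dots> \<le> (\<integral>\<^sup>+t. ennreal ?K * ennreal (indicator {0..1} t * t powr (- (real ?n / p))) \<partial>lborel)"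
  proof (rule nn_integral_mono_AE)
    \<comment> \<open>At \<open>t = 0\<close> the substitution degenerates; this single point is
      discarded.\<close>
    have "AE t in lborel. t \<noteq> (0::real)" by (rule AE_lborel_singleton)
    then show "AE t in lborel. (\<integral>\<^sup>+z. ennreal (indicator {0..1} t * (d * (indicator W z * norm (?h t z)))) \<partial>lborel)
        \<le> ennreal ?K * ennreal (indicator {0..1} t * t powr (- (real ?n / p)))"
    proof eventually_elim
      fix t :: real assume t0: "t \<noteq> 0"
      show "(\<integral>\<^sup>+z. ennreal (indicator {0..1} t * (d * (indicator W z * norm (?h t z)))) \<partial>lborel)
        \<le> ennreal ?K * ennreal (indicator {0..1} t * t powr (- (real ?n / p)))"
      proof (cases "t \<in> {0..1}")
        case True
        have "(\<integral>\<^sup>+z. ennreal (indicator {0..1} t * (d * (indicator W z * norm (?h t z)))) \<partial>lborel)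
          = (\<integral>\<^sup>+z. ennreal d * ennreal (indicator W z * norm (?h t z)) \<partial>lborel)"
          using True d0 by (intro nn_integral_cong) (simp add: ennreal_mult)
        also have "\<dots> = ennreal d * (\<integral>\<^sup>+z. ennreal (indicator W z * norm (?h t z)) \<partial>lborel)"
          by (rule nn_integral_cmult) measurable
        also have "\<dots> \<le> ennreal d * ennreal (?m powr (1 - 1 / p) * I powr (1 / p) * t powr (- (real ?n / p)))"
          using inner[of t] True t0 by (intro mult_left_mono) auto
        also have "\<dots> = ennreal ?K * ennreal (indicator {0..1} t * t powr (- (real ?n / p)))"
          using True d0 by (simp add: mult.assoc flip: ennreal_mult)
        finally show ?thesis .
      qed simp
    qed
  qed
  also have "\<dots> = ennreal ?K * (\<integral>\<^sup>+t. ennreal (indicator {0..1} t * t powr (- (real ?n / p))) \<partial>lborel)"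
    by (rule nn_integral_cmult) measurable
  also have "(\<integral>\<^sup>+t. ennreal (indicator {0..1} t * t powr (- (real ?n / p))) \<partial>lborel) = ennreal (1 / (1 - real ?n / p))"
    using p p1 by (intro nn_integral_powr_unit_interval) (auto simp: divide_simps)
  also have "ennreal ?K * ennreal (1 / (1 - real ?n / p)) = ennreal (?K * (1 / (1 - real ?n / p)))"
    using K0 p p1 by (intro ennreal_mult[symmetric]) (auto simp: divide_simps)
  finally show ?thesis by (simp add: mult.assoc)
qed

lemma measure_lborel_open_pos:
  fixes W :: "'a::euclidean_space set"
  assumes "open W" "bounded W" "W \<noteq> {}"
  shows "measure lborel W > 0"
proof -
  obtain x where "x \<in> W" using assms(3) by blast
  then obtain e where e: "e > 0" "ball x e \<subseteq> W" using assms(1) open_contains_ball by blast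
  have "0 < measure lborel (ball x e)" using e(1) by (simp add: content_ball)
  also have "\<dots> \<le> measure lborel W"
    using e(2) assms emeasure_bounded_finite[OF assms(2)] by (intro measure_mono_fmeasurable) (auto simp: fmeasurable_def)
  finally show ?thesis .
qed

text \<open>Averages the triangle inequality through a third point \<open>z\<close> over
  \<open>W\<close>. The result is kept in p-th powers with the measure of \<open>W\<close> on the
  left, so that it compares directly with an energy integral.\<close>

lemma morrey_C1:
  fixes f :: "'a::euclidean_space \<Rightarrow> real"
  assumes D: "\<And>x. GDERIV f x :> D x" and c: "continuous_on UNIV D"
    and W: "open W" "convex W" "bounded W" and d: "d > 0" "\<And>x y. x \<in> W \<Longrightarrow> y \<in> W \<Longrightarrow> norm (x - y) \<le> d"
    and p: "p > real DIM('a)" and x: "x \<in> W" and y: "y \<in> W"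
  shows "((1 - real DIM('a) / p) / (2 * d) * \<bar>f x - f y\<bar>) powr p * measure lborel W
    \<le> (LINT z|lborel. indicator W z * norm (D z) powr p)"
proof -
  let ?m = "measure lborel W" and ?\<kappa> = "1 - real DIM('a) / p"
  let ?I = "LINT z|lborel. indicator W z * norm (D z) powr p"
  have p1: "p > 1" using p DIM_positive[where 'a='a] by linarith
  have \<kappa>: "?\<kappa> > 0" using p p1 by simp
  have [measurable]: "W \<in> sets borel" using W by auto
  have cf: "continuous_on UNIV f" by (rule GDERIV_continuous_on[OF D])
  have [measurable]: "f \<in> borel_measurable borel" using cf by (rule borel_measurable_continuous_onI)
  have finW: "emeasure lborel W < \<infinity>" using W(3) emeasure_bounded_finite by blast
  have m: "?m > 0" using measure_lborel_open_pos[OF W(1,3)] x by blast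
  let ?K = "d * ?m powr (1 - 1 / p) * ?I powr (1 / p) / ?\<kappa>"
  have K0: "?K \<ge> 0" using d(1) \<kappa> by simp
  have "ennreal (?m * \<bar>f x - f y\<bar>) = (\<integral>\<^sup>+z. ennreal \<bar>f x - f y\<bar> * indicator W z \<partial>lborel)"
  proof -
    have "(\<integral>\<^sup>+z. ennreal \<bar>f x - f y\<bar> * indicator W z \<partial>lborel) = ennreal \<bar>f x - f y\<bar> * emeasure lborel W"
      by (rule nn_integral_cmult_indicator) simp
    also have "emeasure lborel W = ennreal ?m" using finW by (intro emeasure_eq_ennreal_measure) auto
    finally show ?thesis by (simp add: ennreal_mult mult.commute)
  qed
  also have "\<dots> \<le> (\<integral>\<^sup>+z. indicator W z * ennreal \<bar>f z - f x\<bar> + indicator W z * ennreal \<bar>f z - f y\<bar> \<partial>lborel)"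
    by (intro nn_integral_mono) (auto simp: indicator_def simp flip: ennreal_plus intro!: ennreal_leI)
  also have "\<dots> = (\<integral>\<^sup>+z. indicator W z * ennreal \<bar>f z - f x\<bar> \<partial>lborel) + (\<integral>\<^sup>+z. indicator W z * ennreal \<bar>f z - f y\<bar> \<partial>lborel)"
    by (rule nn_integral_add) measurable
  also have "\<dots> \<le> ennreal ?K + ennreal ?K"
    by (intro add_mono morrey_C1_average[OF D c W d(2) p x] morrey_C1_average[OF D c W d(2) p y])
  also have "\<dots> = ennreal (2 * ?K)" using K0 by (simp flip: ennreal_plus)
  finally have "?m * \<bar>f x - f y\<bar> \<le> 2 * ?K" using K0 by (subst (asm) ennreal_le_iff) auto
  also have "2 * ?K = (2 * d / ?\<kappa>) * (?m powr (1 - 1 / p) * ?I powr (1 / p))" by simp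
  finally have "\<bar>f x - f y\<bar> * ?m / (2 * d / ?\<kappa>) \<le> ?m powr (1 - 1 / p) * ?I powr (1 / p)"
    using d(1) \<kappa> by (subst pos_divide_le_eq) (auto simp: mult.commute)
  then have "(?\<kappa> / (2 * d) * \<bar>f x - f y\<bar>) * ?m \<le> ?m powr (1 - 1 / p) * ?I powr (1 / p)"
    by (simp add: mult_ac)
  also have "?m powr (1 - 1 / p) = ?m / ?m powr (1 / p)" using m by (simp add: powr_diff)
  finally have *: "(?\<kappa> / (2 * d) * \<bar>f x - f y\<bar>) * ?m \<le> ?m / ?m powr (1 / p) * ?I powr (1 / p)" .
  \<comment> \<open>Stated for abstract reals, to cancel one factor \<open>?m\<close> and to move
    the root of the measure to the left.\<close>
  have "X * q \<le> Y" if "q > 0" "X * ?m \<le> ?m / q * Y" for X Y q :: real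
  proof -
    have "?m * (X * q) \<le> ?m * Y" using that by (simp add: field_simps)
    then show ?thesis using m by simp
  qed
  from this[OF _ *] have "(?\<kappa> / (2 * d) * \<bar>f x - f y\<bar>) * ?m powr (1 / p) \<le> ?I powr (1 / p)"
    using m by simp
  then have "((?\<kappa> / (2 * d) * \<bar>f x - f y\<bar>) * ?m powr (1 / p)) powr p \<le> (?I powr (1 / p)) powr p"
    using p1 d(1) \<kappa> by (intro powr_mono2) auto
  moreover have "((?\<kappa> / (2 * d) * \<bar>f x - f y\<bar>) * ?m powr (1 / p)) powr p = (?\<kappa> / (2 * d) * \<bar>f x - f y\<bar>) powr p * ?m"
    using d(1) \<kappa> m p1 by (subst powr_mult) (auto simp: powr_powr)
  moreover have "(?I powr (1 / p)) powr p = ?I" using p1 by (simp add: powr_powr)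
  ultimately show ?thesis by simp
qed


context weak_p_harmonic
begin

text \<open>The inequality for C^1 functions is applied to \<open>F (U x)\<close> for an approximant
  \<open>U\<close> and passed to the limit. The factor \<open>4 powr p\<close> pays for splitting
  the gradient into \<open>F' (u z) *\<^sub>R g z\<close> and two errors, through two uses of
  \<open>powr_add_le\<close>.\<close>

lemma morrey:
  assumes F: "\<And>t. DERIV F t :> F' t" and cF': "continuous_on UNIV F'"
    and W: "open W" "convex W" "bounded W" "closure W \<subseteq> \<Omega>"
    and d: "d > 0" "\<And>x y. x \<in> W \<Longrightarrow> y \<in> W \<Longrightarrow> norm (x - y) \<le> d"
    and p: "p > real CARD('n)" and x: "x \<in> W" and y: "y \<in> W"
  shows "((1 - real CARD('n) / p) / (2 * d) * \<bar>F (u x) - F (u y)\<bar>) powr p * measure lborel W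
    \<le> 4 powr p * (LINT z|lborel. indicator (closure W) z * (\<bar>F' (u z)\<bar> powr p * norm (g z) powr p))"
proof -
  define S where "S = closure W"
  have S: "compact S" "S \<subseteq> \<Omega>" "W \<subseteq> S" using W by (auto simp: S_def closure_subset)
  have [measurable]: "S \<in> sets borel" "W \<in> sets borel" using S(1) W(1) by (auto intro: borel_compact)
  obtain B0 where B0: "B0 > 0" "\<And>x. x \<in> S \<Longrightarrow> norm (F' (u x)) \<le> B0"
    using compact_norm_bound[OF S(1) continuous_on_compose_u[OF S(2) cF']] by blast
  \<comment> \<open>The added 1 makes \<open>B\<close> a bound for \<open>F' (U z)\<close> as well,
    since the approximation error is at most 1.\<close>
  define B where "B = B0 + 1"
  have B: "B > 0" "\<And>x. x \<in> S \<Longrightarrow> \<bar>F' (u x)\<bar> + 1 \<le> B" using B0 by (auto simp: B_def)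
  let ?A = "(1 - real CARD('n) / p) / (2 * d)"
  have A: "?A > 0" using p p_gt_1 d(1) by simp
  let ?J = "LINT z|lborel. indicator S z * (\<bar>F' (u z)\<bar> powr p * norm (g z) powr p)"
  let ?Ip = "LINT x|lborel. indicator S x * norm (g x) powr p"
  let ?\<Delta> = "\<bar>F (u x) - F (u y)\<bar>"
  have iIp: "integrable lborel (\<lambda>x. indicator S x * norm (g x) powr p)" by (rule g_Lp[OF S(1,2)])
  have iJ: "integrable lborel (\<lambda>z. indicator S z * (\<bar>F' (u z)\<bar> powr p * norm (g z) powr p))"
  proof (rule integrable_indicator_g[OF S(1,2), where q=p and C=1])
    have "continuous_on S (\<lambda>x. F' (u x))" by (rule continuous_on_compose_u[OF S(2) cF'])
    then show "continuous_on S (\<lambda>x. \<bar>F' (u x)\<bar> powr p)"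
      using p_gt_1 by (intro continuous_on_powr' continuous_intros) auto
  qed (use p_gt_1 in auto)
  have step: "(?A * (?\<Delta> - 2 * s)) powr p * measure lborel W \<le> 4 powr p * (?J + s * (?Ip + B powr p))"
    if s: "0 < s" "2 * s < ?\<Delta>" for s
  proof -
    \<comment> \<open>The root \<open>s powr (1 / p)\<close> turns the error in \<open>F'\<close>
      into \<open>s\<close> after raising to the power p. Both endpoint values move by at most
      \<open>s\<close>, whence the loss \<open>2 * s\<close> on the left.\<close>
    define \<theta> where "\<theta> = min (min s 1) (s powr (1 / p))"
    have \<theta>: "\<theta> > 0" "\<theta> \<le> s" "\<theta> \<le> 1" "\<theta> \<le> s powr (1 / p)" using s by (auto simp: \<theta>_def)
    let ?D = "\<lambda>V x. indicator S x * norm (V x - g x) powr p"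
    obtain U V where UV: "\<And>x. GDERIV (\<lambda>x. F (U x)) x :> F' (U x) *\<^sub>R V x" "continuous_on UNIV V"
      "continuous_on UNIV (\<lambda>x. F (U x))" "continuous_on UNIV (\<lambda>x. F' (U x))"
      "\<And>x. x \<in> S \<Longrightarrow> \<bar>F (U x) - F (u x)\<bar> \<le> \<theta>" "\<And>x. x \<in> S \<Longrightarrow> \<bar>F' (U x) - F' (u x)\<bar> \<le> \<theta>"
      and D: "integrable lborel (?D V)" "(LINT x|lborel. ?D V x) \<le> \<theta>"
      using C1_approximation_compose[OF F cF' S(1,2) \<theta>(1)] by blast
    let ?D = "?D V"
    let ?E = "\<lambda>z. F' (U z) *\<^sub>R V z"
    have cE: "continuous_on UNIV ?E" by (intro continuous_intros UV)
    have M1: "(?A * \<bar>F (U x) - F (U y)\<bar>) powr p * measure lborel W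
      \<le> (LINT z|lborel. indicator W z * norm (?E z) powr p)"
      using morrey_C1[OF UV(1) cE W(1-3) d _ x y] p by simp
    let ?R = "\<lambda>z. 4 powr p * (indicator S z * (\<bar>F' (u z)\<bar> powr p * norm (g z) powr p)
        + s * (indicator S z * norm (g z) powr p) + B powr p * ?D z)"
    have iR: "integrable lborel ?R"
      by (intro Bochner_Integration.integrable_add integrable_mult_right iJ iIp D)
    have pt: "indicator W z * norm (?E z) powr p \<le> ?R z" for z
    proof (cases "z \<in> W")
      case True
      then have z: "z \<in> S" using S(3) by auto
      have t2: "\<bar>F' (U z) - F' (u z)\<bar> \<le> s powr (1 / p)" and t3: "\<bar>F' (U z)\<bar> \<le> B"
        using UV(6)[OF z] B(2)[OF z] \<theta> by linarith+
      let ?a = "\<bar>F' (u z)\<bar> * norm (g z)" and ?b = "s powr (1 / p) * norm (g z)" and ?c = "B * norm (V z - g z)"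
      have "?E z = F' (u z) *\<^sub>R g z + (F' (U z) - F' (u z)) *\<^sub>R g z + F' (U z) *\<^sub>R (V z - g z)"
        by (simp add: algebra_simps)
      then have "norm (?E z) \<le> norm (F' (u z) *\<^sub>R g z) + norm ((F' (U z) - F' (u z)) *\<^sub>R g z) + norm (F' (U z) *\<^sub>R (V z - g z))"
        by (simp only: order_trans[OF norm_triangle_ineq add_right_mono[OF norm_triangle_ineq]])
      also have "\<dots> \<le> ?a + ?b + ?c"
        unfolding norm_scaleR using t2 t3 by (intro add_mono mult_right_mono) auto
      finally have "norm (?E z) powr p \<le> (?a + (?b + ?c)) powr p"
        using p_gt_1 by (intro powr_mono2) auto
      also have "\<dots> \<le> 2 powr p * (?a powr p + (?b + ?c) powr p)"
        using B(1) p_gt_1 by (intro powr_add_le) auto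
      also have "\<dots> \<le> 2 powr p * (?a powr p + 2 powr p * (?b powr p + ?c powr p))"
        using B(1) p_gt_1 by (intro mult_left_mono add_left_mono powr_add_le) auto
      also have "\<dots> \<le> 2 powr p * (2 powr p * ?a powr p + 2 powr p * (?b powr p + ?c powr p))"
        using p_gt_1 by (intro mult_left_mono add_right_mono mult_left_le_one_le) (auto simp: ge_one_powr_ge_zero mult_le_cancel_right1)
      also have "\<dots> = (2 * 2) powr p * (?a powr p + ?b powr p + ?c powr p)"
        by (simp only: powr_mult) (simp add: algebra_simps)
      also have "?a powr p = \<bar>F' (u z)\<bar> powr p * norm (g z) powr p" by (simp add: powr_mult)
      also have "?b powr p = s * norm (g z) powr p" using s p_gt_1 by (simp add: powr_mult powr_powr)
      also have "?c powr p = B powr p * norm (V z - g z) powr p" using B by (simp add: powr_mult)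
      finally show ?thesis using True z by simp
    qed (use s in simp)
    have "(LINT z|lborel. indicator W z * norm (?E z) powr p) \<le> (LINT z|lborel. ?R z)"
    proof (rule integral_mono_AE'[OF iR])
      have "?R z \<ge> 0" for z using s by (intro mult_nonneg_nonneg add_nonneg_nonneg) auto
      then show "AE z in lborel. 0 \<le> ?R z" by (rule AE_I2)
    qed (rule AE_I2, rule pt)
    also have "\<dots> = 4 powr p * (?J + s * ?Ip + B powr p * (LINT z|lborel. ?D z))"
      using iJ iIp D(1) by (simp only: Bochner_Integration.integral_add Bochner_Integration.integrable_add integrable_mult_right integral_mult_right_zero)
    also have "\<dots> \<le> 4 powr p * (?J + s * ?Ip + B powr p * s)"
      using D(2) \<theta>(2) B(1) by (intro mult_left_mono add_left_mono) auto
    finally have M2: "(?A * \<bar>F (U x) - F (U y)\<bar>) powr p * measure lborel W \<le> 4 powr p * (?J + s * (?Ip + B powr p))"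
      using M1 by (simp add: algebra_simps)
    have "x \<in> S" "y \<in> S" using x y S(3) by auto
    then have "\<bar>F (U x) - F (u x)\<bar> \<le> s" "\<bar>F (U y) - F (u y)\<bar> \<le> s"
      using UV(5) \<theta>(2) by (meson order_trans)+
    then have "?\<Delta> - 2 * s \<le> \<bar>F (U x) - F (U y)\<bar>" by linarith
    then have "(?A * (?\<Delta> - 2 * s)) powr p \<le> (?A * \<bar>F (U x) - F (U y)\<bar>) powr p"
    proof (intro powr_mono2)
      show "0 \<le> ?A * (?\<Delta> - 2 * s)" using A s by (intro mult_nonneg_nonneg) linarith+
      show "?A * (?\<Delta> - 2 * s) \<le> ?A * \<bar>F (U x) - F (U y)\<bar>"
        using \<open>?\<Delta> - 2 * s \<le> \<bar>F (U x) - F (U y)\<bar>\<close> A by (intro mult_left_mono) linarith+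
    qed (use p_gt_1 in simp)
    then have "(?A * (?\<Delta> - 2 * s)) powr p * measure lborel W \<le> (?A * \<bar>F (U x) - F (U y)\<bar>) powr p * measure lborel W"
      by (rule mult_right_mono) simp
    then show ?thesis using M2 by linarith
  qed
  show ?thesis
  proof (cases "?\<Delta> = 0")
    case True
    have "?J \<ge> 0" by simp
    then show ?thesis using True by (simp add: S_def)
  next
    case False
    then have \<Delta>: "?\<Delta> > 0" by simp
    \<comment> \<open>Here \<open>s\<close> tends to 0 from the right; as \<open>?\<Delta>\<close>
      is positive, \<open>2 * s < ?\<Delta>\<close> holds eventually and the base of the power stays
      away from 0.\<close>
    have "(?A * (?\<Delta> - 2 * 0)) powr p * measure lborel W \<le> 4 powr p * (?J + 0 * (?Ip + B powr p))"
    proof (rule tendsto_le)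
      show "((\<lambda>s. 4 powr p * (?J + s * (?Ip + B powr p))) \<longlongrightarrow> 4 powr p * (?J + 0 * (?Ip + B powr p))) (at_right 0)"
        by (intro tendsto_intros)
      show "((\<lambda>s. (?A * (?\<Delta> - 2 * s)) powr p * measure lborel W) \<longlongrightarrow> (?A * (?\<Delta> - 2 * 0)) powr p * measure lborel W) (at_right 0)"
        using A \<Delta> by (intro tendsto_intros) auto
      have "\<forall>\<^sub>F s in at_right 0. s < ?\<Delta> / 2" using \<Delta> by (intro order_tendstoD(2)[OF tendsto_ident_at]) auto
      moreover have "\<forall>\<^sub>F s in at_right 0. s > (0::real)" by (rule eventually_at_right_less)
      ultimately show "\<forall>\<^sub>F s in at_right 0. (?A * (?\<Delta> - 2 * s)) powr p * measure lborel W \<le> 4 powr p * (?J + s * (?Ip + B powr p))"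
        by eventually_elim (rule step; simp)
    qed simp
    then show ?thesis by (simp add: S_def)
  qed
qed

text \<open>Where \<open>\<eta> z * \<Phi>' (u z)\<close> dominates the p-th power of
  \<open>F' (u z)\<close>, the energy required by Morrey is the one bounded by Caccioppoli. It is
  used with \<open>F\<close> equal to \<Phi> for a truncation, and with \<open>F\<close> a logarithm
  and \<Phi> a negative power.\<close>

lemma caccioppoli_morrey:
  assumes \<Phi>: "\<And>t. DERIV \<Phi> t :> \<Phi>' t" and c\<Phi>': "continuous_on UNIV \<Phi>'"
    and F: "\<And>t. DERIV F t :> F' t" and cF': "continuous_on UNIV F'"
    and \<eta>: "\<And>x. GDERIV \<eta> x :> H x" and cH: "continuous_on UNIV H"
    and S: "compact S" "S \<subseteq> \<Omega>" and z: "\<And>x. x \<notin> S \<Longrightarrow> \<eta> x = 0" and \<eta>0: "\<And>x. \<eta> x \<ge> 0"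
    and L: "L \<ge> 0" "\<And>x. x \<in> S \<Longrightarrow> \<Phi>' (u x) \<ge> 0 \<and> \<bar>\<Phi> (u x)\<bar> \<le> L powr (1 / p) * \<Phi>' (u x) powr ((p - 1) / p)"
    and G: "G \<ge> 0" "\<And>x. x \<in> S \<Longrightarrow> \<Phi> (u x) \<noteq> 0 \<Longrightarrow> H x \<noteq> 0 \<Longrightarrow> norm x \<le> \<rho> \<and> norm (H x) \<le> G * \<eta> x powr ((p - 1) / p)"
    and W: "open W" "convex W" "bounded W" "closure W \<subseteq> S"
    and d: "d > 0" "\<And>x y. x \<in> W \<Longrightarrow> y \<in> W \<Longrightarrow> norm (x - y) \<le> d"
    and p: "p > real CARD('n)" and x: "x \<in> W" and y: "y \<in> W"
    and c: "c \<ge> 0" "\<And>z. z \<in> closure W \<Longrightarrow> \<bar>F' (u z)\<bar> powr p \<le> c * (\<eta> z * \<Phi>' (u z))"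
  shows "((1 - real CARD('n) / p) / (2 * d) * \<bar>F (u x) - F (u y)\<bar>) powr p * measure lborel W
    \<le> 4 powr p * (c * (2 powr p * L * G powr p * measure lborel (cball (0 :: real^'n) \<rho>)))"
proof -
  let ?P = "\<lambda>x. indicator S x * (\<eta> x * \<Phi>' (u x) * norm (g x) powr p)"
  have iP: "integrable lborel ?P"
    by (rule caccioppoli_integrable(1)[OF DERIV_continuous_on_UNIV[OF \<Phi>] c\<Phi>' GDERIV_continuous_on[OF \<eta>] cH S])
  have P0: "?P z \<ge> 0" for z using L(2)[of z] \<eta>0[of z] by (simp add: indicator_def)
  have "((1 - real CARD('n) / p) / (2 * d) * \<bar>F (u x) - F (u y)\<bar>) powr p * measure lborel W
    \<le> 4 powr p * (LINT z|lborel. indicator (closure W) z * (\<bar>F' (u z)\<bar> powr p * norm (g z) powr p))"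
    using W S(2) by (intro morrey[OF F cF' _ _ _ _ d p x y]) auto
  also have "(LINT z|lborel. indicator (closure W) z * (\<bar>F' (u z)\<bar> powr p * norm (g z) powr p)) \<le> (LINT z|lborel. c * ?P z)"
  proof (rule integral_mono_AE'[OF integrable_mult_right[OF iP]]; rule AE_I2)
    fix z
    show nn: "0 \<le> c * ?P z" using c(1) P0 by (rule mult_nonneg_nonneg)
    show "indicator (closure W) z * (\<bar>F' (u z)\<bar> powr p * norm (g z) powr p) \<le> c * ?P z"
    proof (cases "z \<in> closure W")
      case True
      then show ?thesis using mult_right_mono[OF c(2)[OF True], of "norm (g z) powr p"] W(4)
        by (auto simp: mult.assoc)
    qed (use nn in simp)
  qed
  also have "(LINT z|lborel. c * ?P z) = c * (LINT z|lborel. ?P z)" by simp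
  also have "(LINT z|lborel. ?P z) \<le> 2 powr p * L * G powr p * measure lborel (cball (0 :: real^'n) \<rho>)"
    using G emeasure_compact_finite[OF compact_cball[of "0::real^'n" \<rho>]]
    by (intro caccioppoli_inequality[OF \<Phi> c\<Phi>' \<eta> cH S z \<eta>0 L]) auto
  finally show ?thesis using c(1) by (simp add: mult_left_mono)
qed

end

section \<open>Cutoff functions and the maximum principle\<close>

text \<open>The square makes the positive part C^1. The function is the truncation in the maximum
  principle and the building block of the cutoffs and of \<open>pos_floor\<close>.\<close>

definition pos_sq :: "real \<Rightarrow> real" where "pos_sq t = (max 0 t)\<^sup>2"

lemma DERIV_pos_sq: "DERIV pos_sq t :> 2 * max 0 t"
proof -
  consider "t > 0" | "t < 0" | "t = 0" by linarith
  then show ?thesis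
  proof cases
    case 1
    have "DERIV (\<lambda>t. t\<^sup>2) t :> 2 * max 0 t" using 1 by (auto intro!: derivative_eq_intros)
    then show ?thesis
      by (rule has_field_derivative_transform_within_open[where S="{0<..}"]) (use 1 in \<open>auto simp: pos_sq_def\<close>)
  next
    case 2
    have "DERIV (\<lambda>t. 0) t :> 2 * max 0 t" using 2 by simp
    then show ?thesis
      by (rule has_field_derivative_transform_within_open[where S="{..<0}"]) (use 2 in \<open>auto simp: pos_sq_def\<close>)
  next
    case 3
    have "((\<lambda>h. pos_sq h / h) \<longlongrightarrow> 0) (at 0)"
    proof (rule tendsto_0_le[where K=1 and f="\<lambda>h. h"])
      have "norm (pos_sq h / h) \<le> norm h * 1" for h
        by (cases "h > 0") (auto simp: pos_sq_def power2_eq_square)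
      then show "\<forall>\<^sub>F h in at 0. norm (pos_sq h / h) \<le> norm h * 1" by (rule always_eventually[OF allI])
    qed (rule tendsto_ident_at)
    then show ?thesis using 3 by (simp add: DERIV_def pos_sq_def)
  qed
qed

text \<open>On [0, 1] this is 1 - (1 - t^2)^2, joined to the constants 0 and 1 with matching
  derivatives.\<close>

definition smoothstep :: "real \<Rightarrow> real" where "smoothstep t = 1 - pos_sq (1 - pos_sq t)"

definition smoothstep' :: "real \<Rightarrow> real" where "smoothstep' t = 4 * max 0 (1 - pos_sq t) * max 0 t"

lemma DERIV_smoothstep: "DERIV smoothstep t :> smoothstep' t"
proof -
  have "DERIV (\<lambda>t. 1 - pos_sq (1 - pos_sq t)) t :> 0 - 2 * max 0 (1 - pos_sq t) * (0 - 2 * max 0 t)"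
    by (intro DERIV_diff DERIV_const DERIV_chain2[OF DERIV_pos_sq] DERIV_pos_sq)
  then show ?thesis by (simp add: smoothstep_def[abs_def] smoothstep'_def mult.assoc)
qed

lemma continuous_on_pos_sq: "continuous_on UNIV pos_sq"
  by (rule DERIV_continuous_on_UNIV[OF DERIV_pos_sq])

lemma continuous_on_smoothstep': "continuous_on UNIV smoothstep'"
  unfolding smoothstep'_def[abs_def]
  by (intro continuous_intros continuous_on_compose2[OF continuous_on_pos_sq]) auto

lemma pos_sq_ge_1: "t \<ge> 1 \<Longrightarrow> pos_sq t \<ge> 1"
  by (simp add: pos_sq_def)

lemma smoothstep_le_0: "t \<le> 0 \<Longrightarrow> smoothstep t = 0" "t \<le> 0 \<Longrightarrow> smoothstep' t = 0"
  by (simp_all add: smoothstep_def smoothstep'_def pos_sq_def)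

lemma smoothstep_ge_1:
  assumes "t \<ge> 1" shows "smoothstep t = 1" "smoothstep' t = 0"
  using pos_sq_ge_1[OF assms] by (simp_all add: smoothstep_def smoothstep'_def pos_sq_def[of "1 - pos_sq t"] max_def)

lemma smoothstep_bounds: "0 \<le> smoothstep t" "smoothstep t \<le> 1"
proof -
  have "0 \<le> pos_sq t" by (simp add: pos_sq_def)
  then have "max 0 (1 - pos_sq t) \<le> 1" by simp
  then have "pos_sq (1 - pos_sq t) \<le> 1" unfolding pos_sq_def[of "1 - pos_sq t"] by (intro power_le_one) auto
  then show "0 \<le> smoothstep t" by (simp add: smoothstep_def)
  show "smoothstep t \<le> 1" by (simp add: smoothstep_def pos_sq_def)
qed

lemma smoothstep'_bound: "\<bar>smoothstep' t\<bar> \<le> 4"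
proof (cases "t \<ge> 1")
  case False
  have "max 0 (1 - pos_sq t) * max 0 t \<le> 1 * 1"
    using False by (intro mult_mono) (auto simp: pos_sq_def)
  then show ?thesis by (simp add: smoothstep'_def abs_mult)
qed (simp add: smoothstep_ge_1)

text \<open>The cutoff is the power \<open>\<lceil>p\<rceil>\<close> of a smooth step; this makes its gradient bounded by a multiple of
  \<open>\<eta> powr ((p - 1) / p)\<close>, which is what absorbing it into the energy requires.\<close>

lemma cutoff_exists:
  fixes a b R p :: real
  assumes ab: "0 < a" "a < b" "b \<le> R" and p: "p > 1"
  defines "N \<equiv> real (nat \<lceil>p\<rceil>)"
  obtains \<eta> :: "'a::euclidean_space \<Rightarrow> real" and H where
    "\<And>x. GDERIV \<eta> x :> H x" "continuous_on UNIV H" "\<And>x. \<eta> x \<ge> 0"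
    "\<And>x. norm x \<le> a \<or> norm x \<ge> 2 * R \<Longrightarrow> \<eta> x = 0" "\<And>x. b \<le> norm x \<Longrightarrow> norm x \<le> R \<Longrightarrow> \<eta> x = 1"
    "\<And>x. b \<le> norm x \<Longrightarrow> norm (H x) \<le> 6 * N / R * \<eta> x powr ((p - 1) / p)"
    "\<And>x. norm x \<le> b \<Longrightarrow> norm (H x) \<le> 8 * N * b / (b\<^sup>2 - a\<^sup>2) * \<eta> x powr ((p - 1) / p)"
    "\<And>x. H x \<noteq> 0 \<Longrightarrow> norm x \<le> 2 * R"
proof -
  \<comment> \<open>Quadratic in the norm, hence differentiable everywhere: \<alpha> goes from 0 to
    1 as the norm goes from \<open>a\<close> to \<open>b\<close>, and \<beta> from 1 to 0 as it goes
    from \<open>R\<close> to \<open>2 * R\<close>.\<close>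
  define \<alpha> where "\<alpha> x = (x \<bullet> x - a\<^sup>2) / (b\<^sup>2 - a\<^sup>2)" for x :: 'a
  define \<beta> where "\<beta> x = (4 * R\<^sup>2 - x \<bullet> x) / (3 * R\<^sup>2)" for x :: 'a
  define A where "A = b\<^sup>2 - a\<^sup>2"
  have R: "R > 0" using ab by linarith
  have A: "A > 0" unfolding A_def using ab by (simp add: power_strict_mono)
  have sq: "x \<bullet> x = (norm x)\<^sup>2" for x :: 'a by (rule dot_square_norm)
  have G\<alpha>: "GDERIV \<alpha> x :> (2 / A) *\<^sub>R x" for x
    unfolding gderiv_def \<alpha>_def[abs_def] A_def[symmetric] using A
    by (auto intro!: derivative_eq_intros simp: inner_commute field_simps)
  have G\<beta>: "GDERIV \<beta> x :> (- 2 / (3 * R\<^sup>2)) *\<^sub>R x" for x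
    unfolding gderiv_def \<beta>_def[abs_def] using R
    by (auto intro!: derivative_eq_intros simp: inner_commute field_simps)
  have c\<alpha>: "continuous_on UNIV \<alpha>" and c\<beta>: "continuous_on UNIV \<beta>"
    by (rule GDERIV_continuous_on[OF G\<alpha>], rule GDERIV_continuous_on[OF G\<beta>])
  have cs: "continuous_on UNIV smoothstep"
    by (rule DERIV_continuous_on_UNIV[OF DERIV_smoothstep])
  define \<zeta> where "\<zeta> x = smoothstep (\<alpha> x) * smoothstep (\<beta> x)" for x
  define Z where "Z x = smoothstep (\<alpha> x) *\<^sub>R (smoothstep' (\<beta> x) *\<^sub>R ((- 2 / (3 * R\<^sup>2)) *\<^sub>R x))
      + smoothstep (\<beta> x) *\<^sub>R (smoothstep' (\<alpha> x) *\<^sub>R ((2 / A) *\<^sub>R x))" for x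
  have GZ: "GDERIV \<zeta> x :> Z x" for x
    unfolding \<zeta>_def[abs_def] Z_def
    by (rule GDERIV_mult[OF GDERIV_DERIV_compose[OF G\<alpha> DERIV_smoothstep] GDERIV_DERIV_compose[OF G\<beta> DERIV_smoothstep]])
  have c\<zeta>: "continuous_on UNIV \<zeta>" by (rule GDERIV_continuous_on[OF GZ])
  have cZ: "continuous_on UNIV Z"
    unfolding Z_def[abs_def]
    by (intro continuous_intros continuous_on_compose2[OF cs c\<alpha>] continuous_on_compose2[OF cs c\<beta>]
        continuous_on_compose2[OF continuous_on_smoothstep' c\<alpha>] continuous_on_compose2[OF continuous_on_smoothstep' c\<beta>]) auto
  have \<zeta>01: "0 \<le> \<zeta> x" "\<zeta> x \<le> 1" for x
    unfolding \<zeta>_def using smoothstep_bounds by (auto intro: mult_le_one)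
  have \<alpha>1: "\<alpha> x \<ge> 1" if "norm x \<ge> b" for x
  proof -
    have "b\<^sup>2 \<le> (norm x)\<^sup>2" using that ab by (intro power_mono) auto
    then show ?thesis using A by (simp add: \<alpha>_def sq A_def)
  qed
  have \<alpha>0: "\<alpha> x \<le> 0" if "norm x \<le> a" for x
  proof -
    have "(norm x)\<^sup>2 \<le> a\<^sup>2" using that ab by (intro power_mono) auto
    then show ?thesis using A by (simp add: \<alpha>_def sq A_def divide_nonpos_pos)
  qed
  have \<beta>1: "\<beta> x \<ge> 1" if "norm x \<le> R" for x
  proof -
    have "(norm x)\<^sup>2 \<le> R\<^sup>2" using that by (intro power_mono) auto
    then show ?thesis using R by (simp add: \<beta>_def sq)
  qed
  have \<beta>0: "\<beta> x \<le> 0" if "norm x \<ge> 2 * R" for x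
  proof -
    have "(2 * R)\<^sup>2 \<le> (norm x)\<^sup>2" using that R by (intro power_mono) auto
    then show ?thesis using R by (simp add: \<beta>_def sq divide_nonpos_pos)
  qed
  have zZ: "Z x = 0" if "norm x \<ge> 2 * R" for x
  proof -
    have "\<alpha> x \<ge> 1" using that ab R by (intro \<alpha>1) linarith
    then show ?thesis using \<beta>0[OF that] by (simp add: Z_def smoothstep_le_0 smoothstep_ge_1)
  qed
  \<comment> \<open>Beyond radius \<open>b\<close> only the outer factor varies; the slope 16 / (3
    R) is rounded up to 6 / R.\<close>
  have Z1: "norm (Z x) \<le> 6 / R" if x: "norm x \<ge> b" for x
  proof (cases "norm x \<ge> 2 * R")
    case False
    have "norm (Z x) = \<bar>smoothstep' (\<beta> x)\<bar> * (2 / (3 * R\<^sup>2) * norm x)"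
      using \<alpha>1[OF x] R by (simp add: Z_def smoothstep_ge_1 abs_mult)
    also have "\<dots> \<le> 4 * (2 / (3 * R\<^sup>2) * (2 * R))"
      using False R by (intro mult_mono smoothstep'_bound) auto
    also have "\<dots> \<le> 6 / R" using R by (simp add: field_simps power2_eq_square)
    finally show ?thesis .
  qed (use zZ R in simp)
  \<comment> \<open>Within radius \<open>b\<close>, which is at most \<open>R\<close>, only the
    inner factor varies.\<close>
  have Z2: "norm (Z x) \<le> 8 * b / A" if x: "norm x \<le> b" for x
  proof -
    have "norm (Z x) = \<bar>smoothstep' (\<alpha> x)\<bar> * (2 / A * norm x)"
      using \<beta>1[of x] x ab A by (simp add: Z_def smoothstep_ge_1 abs_mult)
    also have "\<dots> \<le> 4 * (2 / A * b)"
      using x A by (intro mult_mono smoothstep'_bound) auto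
    finally show ?thesis by simp
  qed
  define m where "m = nat \<lceil>p\<rceil>"
  have m: "real m \<ge> p" "m \<ge> 2" using p by (auto simp: m_def le_nat_iff less_ceiling_iff)
  have N: "N = real m" by (simp add: N_def m_def)
  define H where "H x = (real m * \<zeta> x ^ (m - 1)) *\<^sub>R Z x" for x
  have GH: "GDERIV (\<lambda>x. \<zeta> x ^ m) x :> H x" for x
  proof -
    have "DERIV (\<lambda>t. t ^ m) (\<zeta> x) :> real m * \<zeta> x ^ (m - 1)" using DERIV_pow[of m "\<zeta> x"] by simp
    from GDERIV_DERIV_compose[OF GZ this] show ?thesis by (simp add: H_def)
  qed
  have cH: "continuous_on UNIV H" unfolding H_def[abs_def] by (intro continuous_intros c\<zeta> cZ)
  have Hle: "norm (H x) \<le> N * norm (Z x) * (\<zeta> x ^ m) powr ((p - 1) / p)" for x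
  proof (cases "\<zeta> x = 0")
    case True
    then show ?thesis using m by (simp add: H_def power_0_left)
  next
    case False
    then have pos: "\<zeta> x > 0" using \<zeta>01[of x] by linarith
    have "real m / p \<ge> 1" using m(1) p by simp
    \<comment> \<open>This amounts to m >= p, which is why the exponent is p rounded up.\<close>
    then have ex: "real m * ((p - 1) / p) \<le> real (m - 1)" using m p by (simp add: of_nat_diff field_simps)
    have "\<zeta> x ^ (m - 1) = \<zeta> x powr real (m - 1)" using pos by (rule powr_realpow[symmetric])
    also have "\<dots> \<le> \<zeta> x powr (real m * ((p - 1) / p))" using pos \<zeta>01[of x] ex by (intro powr_mono') auto
    also have "\<dots> = (\<zeta> x powr real m) powr ((p - 1) / p)" by (simp only: powr_powr)
    also have "\<zeta> x powr real m = \<zeta> x ^ m" using pos by (rule powr_realpow)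
    finally have "\<zeta> x ^ (m - 1) \<le> (\<zeta> x ^ m) powr ((p - 1) / p)" .
    then have "N * norm (Z x) * \<zeta> x ^ (m - 1) \<le> N * norm (Z x) * (\<zeta> x ^ m) powr ((p - 1) / p)"
      by (intro mult_left_mono) (auto simp: N)
    moreover have "norm (H x) = N * norm (Z x) * \<zeta> x ^ (m - 1)"
      using pos by (simp add: H_def N)
    ultimately show ?thesis by simp
  qed
  show ?thesis
  proof (rule that[of "\<lambda>x. \<zeta> x ^ m" H])
    show "\<zeta> x ^ m \<ge> 0" for x using \<zeta>01 by simp
    show "\<zeta> x ^ m = 0" if "norm x \<le> a \<or> norm x \<ge> 2 * R" for x
      using that \<alpha>0[of x] \<beta>0[of x] m by (auto simp: \<zeta>_def smoothstep_le_0)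
    show "\<zeta> x ^ m = 1" if "b \<le> norm x" "norm x \<le> R" for x
      using \<alpha>1[OF that(1)] \<beta>1[OF that(2)] by (simp add: \<zeta>_def smoothstep_ge_1)
    show "norm (H x) \<le> 6 * N / R * (\<zeta> x ^ m) powr ((p - 1) / p)" if "b \<le> norm x" for x
    proof -
      have "N * norm (Z x) * (\<zeta> x ^ m) powr ((p - 1) / p) \<le> N * (6 / R) * (\<zeta> x ^ m) powr ((p - 1) / p)"
        using Z1[OF that] by (intro mult_right_mono mult_left_mono) (auto simp: N)
      then show ?thesis using Hle[of x] by (simp add: mult_ac)
    qed
    show "norm (H x) \<le> 8 * N * b / (b\<^sup>2 - a\<^sup>2) * (\<zeta> x ^ m) powr ((p - 1) / p)" if "norm x \<le> b" for x
    proof -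
      have "N * norm (Z x) * (\<zeta> x ^ m) powr ((p - 1) / p) \<le> N * (8 * b / A) * (\<zeta> x ^ m) powr ((p - 1) / p)"
        using Z2[OF that] by (intro mult_right_mono mult_left_mono) (auto simp: N)
      then show ?thesis using Hle[of x] by (simp add: mult_ac A_def)
    qed
    show "norm x \<le> 2 * R" if "H x \<noteq> 0" for x
      using zZ[of x] that by (cases "norm x \<ge> 2 * R") (auto simp: H_def)
  qed (use GH cH in auto)
qed


section \<open>Truncated half-spaces and the maximum principle in the exterior domain\<close>

lemma convex_halfspace_ball: "convex ({z::'a::euclidean_space. s < z \<bullet> e} \<inter> ball 0 R)"
  using convex_halfspace_gt[of s e] by (intro convex_Int convex_ball) (simp add: inner_commute)

lemma open_halfspace_ball: "open ({z::'a::euclidean_space. s < z \<bullet> e} \<inter> ball 0 R)"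
  by (intro open_Int open_ball open_Collect_less continuous_intros)

lemma closure_halfspace_ball: "closure ({z::'a::euclidean_space. s < z \<bullet> e} \<inter> ball 0 R) \<subseteq> {z. s \<le> z \<bullet> e \<and> norm z \<le> R}"
proof (rule closure_minimal)
  show "closed {z. s \<le> z \<bullet> e \<and> norm z \<le> R}"
    by (intro closed_Collect_conj closed_Collect_le continuous_intros)
qed auto

lemma compact_annulus: "compact {x::'a::euclidean_space. a \<le> norm x \<and> norm x \<le> b}"
proof -
  have "closed {x::'a. a \<le> norm x \<and> norm x \<le> b}"
    by (intro closed_Collect_conj closed_Collect_le continuous_intros)
  moreover have "bounded {x::'a. a \<le> norm x \<and> norm x \<le> b}" by (auto simp: bounded_iff)
  ultimately show ?thesis by (simp add: compact_eq_bounded_closed)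
qed

locale exterior_p_harmonic = weak_p_harmonic "- cball 0 1" u g p
  for u :: "real ^ 'n::finite \<Rightarrow> real" and g p +
  fixes M :: real
  assumes p_gt_dim: "p > real CARD('n)"
    and u_bounded: "\<And>x. norm x > 1 \<Longrightarrow> \<bar>u x\<bar> \<le> M"
begin

text \<open>The equation is odd in \<open>u\<close>, so upper bounds also give lower ones.\<close>

lemma exterior_uminus: "exterior_p_harmonic (\<lambda>x. - u x) (\<lambda>x. - g x) p M"
proof (unfold_locales)
  show "open (- cball 0 1 :: (real^'n) set)" by auto
  show "continuous_on (- cball 0 1) (\<lambda>x. - u x)" by (intro continuous_intros continuous_u)
  show "integrable lborel (\<lambda>x. indicator K x * norm (- g x) powr p)" if "compact K" "K \<subseteq> - cball 0 1" for K
    using g_Lp[OF that] by simp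
  show "(LINT x|lborel. - u x * partial i \<phi> x) = - (LINT x|lborel. (- g x) $ i * \<phi> x)"
    if "\<phi> \<in> test_functions (- cball 0 1)" for \<phi> i
    using weak_gradient_eq[OF that, of i] by simp
  show "(LINT x|lborel. (norm (- g x) powr (p - 2) *\<^sub>R - g x) \<bullet> grad \<phi> x) = 0"
    if "\<phi> \<in> test_functions (- cball 0 1)" for \<phi>
    using weak_equation[OF that] by simp
  show "\<bar>- u x\<bar> \<le> M" if "norm x > 1" for x using u_bounded[OF that] by simp
qed (use p_gt_1 p_gt_dim in auto)

text \<open>The margin \<delta> gives a collar outside the sphere where the squared truncation above
  K + \<delta> is zero, so only the outer layer of the cutoff enters the energy bound. In the limit
  Morrey's inequality forces the truncation to agree at \<open>x\<close> and at a point of the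
  collar, where it vanishes.\<close>

lemma exterior_maximum_principle:
  assumes r: "r > 1" and K: "\<And>x. norm x = r \<Longrightarrow> u x \<le> K" and x: "norm x \<ge> r"
  shows "u x \<le> K"
proof (rule field_le_epsilon)
  fix \<delta> :: real assume \<delta>: "\<delta> > 0"
  let ?U = "{y \<in> - cball 0 1. u y < K + \<delta>}"
  have "open (- cball 0 1 \<inter> u -` {..< K + \<delta>})"
    by (intro continuous_open_preimage continuous_u) auto
  moreover have "- cball 0 1 \<inter> u -` {..< K + \<delta>} = ?U" by auto
  ultimately have "open ?U" by simp
  moreover have "sphere 0 r \<subseteq> ?U" using K \<delta> r by fastforce
  \<comment> \<open>Compactness of the sphere turns continuity of \<open>u\<close> into a collar of
    uniform width.\<close>
  ultimately obtain e where e: "e > 0" "\<And>y z. norm y = r \<Longrightarrow> norm (y - z) \<le> e \<Longrightarrow> z \<in> ?U"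
    using compact_open_neighborhood[of "sphere 0 r" ?U] by (metis (no_types, lifting) compact_sphere mem_sphere_0 subset_iff)
  define r' where "r' = r + e"
  have r': "r < r'" using e(1) by (simp add: r'_def)
  have near: "u z < K + \<delta>" if z: "r \<le> norm z" "norm z \<le> r'" for z
  proof -
    \<comment> \<open>The radial projection to the sphere, at distance \<open>norm z - r\<close>
      from \<open>z\<close>.\<close>
    let ?y = "(r / norm z) *\<^sub>R z"
    have nz: "norm z > 0" using z r by linarith
    then have "norm ?y = r" using r by simp
    moreover have "norm (?y - z) \<le> e"
    proof -
      have "?y - z = (r / norm z - 1) *\<^sub>R z" by (simp add: algebra_simps)
      then have "norm (?y - z) = \<bar>(r / norm z - 1) * norm z\<bar>" by (simp add: abs_mult)
      also have "(r / norm z - 1) * norm z = r - norm z" using nz by (simp add: field_simps)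
      finally show ?thesis using z by (simp add: r'_def)
    qed
    ultimately show ?thesis using e(2) by blast
  qed
  show "u x \<le> K + \<delta>"
  proof (cases "norm x \<le> r'")
    case True
    then show ?thesis using near[OF x] by simp
  next
    case False
    define e0 where "e0 = (1 / norm x) *\<^sub>R x"
    have nx: "norm x > r'" "norm x > 0" using False r r' by auto
    have e0: "norm e0 = 1" "x \<bullet> e0 = norm x"
      using nx by (auto simp: e0_def dot_square_norm power2_eq_square)
    \<comment> \<open>The point where the ray through \<open>x\<close> leaves the collar; it shares
      with \<open>x\<close> a half-space whose boundary is orthogonal to the ray.\<close>
    define y where "y = r' *\<^sub>R e0"
    have y: "norm y = r'" "y \<bullet> e0 = r'" using e0 r r' by (auto simp: y_def dot_square_norm)
    \<comment> \<open>Strictly between the radii: the half-space still contains \<open>y\<close>,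
      while its closure stays beyond radius \<open>r\<close>.\<close>
    define s where "s = (r + r') / 2"
    have s: "r < s" "s < r'" using r' by (auto simp: s_def)
    define W where "W = {z. s < z \<bullet> e0} \<inter> ball 0 (2 * norm x)"
    have clW: "s \<le> norm z \<and> norm z \<le> 2 * norm x" if "z \<in> closure W" for z
    proof -
      have "s \<le> z \<bullet> e0" "norm z \<le> 2 * norm x" using that closure_halfspace_ball unfolding W_def by blast+
      moreover have "z \<bullet> e0 \<le> norm z" using Cauchy_Schwarz_ineq2[of z e0] e0 by simp
      ultimately show ?thesis by simp
    qed
    have W: "open W" "convex W" "bounded W" "closure W \<subseteq> - cball 0 1" "x \<in> W" "y \<in> W"
    proof -
      show "open W" unfolding W_def by (rule open_halfspace_ball)
      show "convex W" unfolding W_def by (rule convex_halfspace_ball)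
      show "bounded W" unfolding W_def by (rule bounded_Int) auto
      show "closure W \<subseteq> - cball 0 1" using clW s r by fastforce
      have "norm x < 2 * norm x" "norm y < 2 * norm x" "s < x \<bullet> e0" "s < y \<bullet> e0"
        using e0 y s nx by linarith+
      then show "x \<in> W" "y \<in> W" by (simp_all add: W_def)
    qed
    define \<Phi> where "\<Phi> t = pos_sq (t - (K + \<delta>))" for t
    define \<Phi>' where "\<Phi>' t = 2 * max 0 (t - (K + \<delta>))" for t
    have D\<Phi>: "DERIV \<Phi> t :> \<Phi>' t" for t
    proof -
      have "DERIV (\<lambda>t. pos_sq (t - (K + \<delta>))) t :> 2 * max 0 (t - (K + \<delta>)) * (1 - 0)"
        by (intro DERIV_chain2[OF DERIV_pos_sq] DERIV_diff DERIV_ident DERIV_const)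
      then show ?thesis by (simp add: \<Phi>_def[abs_def] \<Phi>'_def)
    qed
    have c\<Phi>': "continuous_on UNIV \<Phi>'" unfolding \<Phi>'_def[abs_def] by (intro continuous_intros)
    define T where "T = M + \<bar>K + \<delta>\<bar> + 1"
    have M0: "M \<ge> 0" using u_bounded[of x] nx r r' by force
    have T: "T > 0" using M0 by (simp add: T_def)
    have \<tau>: "0 \<le> max 0 (u z - (K + \<delta>))" "max 0 (u z - (K + \<delta>)) \<le> T" if "norm z > 1" for z
      using u_bounded[OF that] M0 by (auto simp: T_def)
    \<comment> \<open>From t^2 = t^((p + 1) / p) t^((p - 1) / p) with t <= T; the second factor is
      the one supplied by \<open>\<Phi>'\<close>.\<close>
    define L where "L = T powr (p + 1)"
    define N where "N = real (nat \<lceil>p\<rceil>)"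
    define C where "C = 4 powr p * ((2 * T) powr (p - 1) * (2 powr p * L * (6 * N) powr p * (unit_ball_vol (real CARD('n)) * 2 ^ CARD('n))))"
    let ?A = "(1 - real CARD('n) / p) / (2 * (4 * norm x)) * \<bar>\<Phi> (u x) - \<Phi> (u y)\<bar>"
    have bound: "?A powr p * measure lborel W \<le> C * R powr (real CARD('n) - p)" if R: "R \<ge> 2 * norm x" for R
    proof -
      have R0: "R > 0" "r' \<le> R" using R nx by linarith+
      have "0 < r" "r < r'" "r' \<le> R" using r r' R0 by auto
      from cutoff_exists[OF this p_gt_1, where 'a="real^'n"]
      obtain \<eta> :: "real^'n \<Rightarrow> real" and H where \<eta>: "\<And>x. GDERIV \<eta> x :> H x" "continuous_on UNIV H" "\<And>x. \<eta> x \<ge> 0"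
        "\<And>x. norm x \<le> r \<or> norm x \<ge> 2 * R \<Longrightarrow> \<eta> x = 0" "\<And>x. r' \<le> norm x \<Longrightarrow> norm x \<le> R \<Longrightarrow> \<eta> x = 1"
        "\<And>x. r' \<le> norm x \<Longrightarrow> norm (H x) \<le> 6 * N / R * \<eta> x powr ((p - 1) / p)"
        "\<And>x. H x \<noteq> 0 \<Longrightarrow> norm x \<le> 2 * R"
        unfolding N_def by metis
      let ?S = "{x::real^'n. r \<le> norm x \<and> norm x \<le> 2 * R}"
      have S: "compact ?S" "?S \<subseteq> - cball 0 1" using r by (auto simp: compact_annulus)
      have zS: "\<eta> z = 0" if "z \<notin> ?S" for z using \<eta>(4)[of z] that by auto
      have vol: "measure lborel (cball 0 (2 * R) :: (real^'n) set) = unit_ball_vol (real CARD('n)) * 2 ^ CARD('n) * R ^ CARD('n)"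
        using R0 by (simp add: content_cball power_mult_distrib)
      have "?A powr p * measure lborel W
        \<le> 4 powr p * ((2 * T) powr (p - 1) * (2 powr p * L * (6 * N / R) powr p * measure lborel (cball 0 (2 * R) :: (real^'n) set)))"
      proof (rule caccioppoli_morrey[OF D\<Phi> c\<Phi>' D\<Phi> c\<Phi>' \<eta>(1,2) S zS \<eta>(3) _ _ _ _ W(1-3) _ _ _ p_gt_dim W(5,6)])
        show "4 * norm x > 0" "(2 * T) powr (p - 1) \<ge> 0" using nx by simp_all
        show "closure W \<subseteq> ?S" using clW s R R0(1) by fastforce
        show "norm (a - b) \<le> 4 * norm x" if "a \<in> W" "b \<in> W" for a b
          using that norm_triangle_ineq4[of a b] by (auto simp: W_def)
        show "L \<ge> 0" by (simp add: L_def)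
        show "6 * N / R \<ge> 0" using R0 by (simp add: N_def)
        show "\<Phi>' (u z) \<ge> 0 \<and> \<bar>\<Phi> (u z)\<bar> \<le> L powr (1 / p) * \<Phi>' (u z) powr ((p - 1) / p)" if "z \<in> ?S" for z
        proof
          define t where "t = max 0 (u z - (K + \<delta>))"
          have t: "0 \<le> t" "t \<le> T" using \<tau>[of z] that r by (auto simp: t_def)
          show "\<Phi>' (u z) \<ge> 0" by (simp add: \<Phi>'_def t_def)
          have "\<bar>\<Phi> (u z)\<bar> = t powr 2" using t by (simp add: \<Phi>_def pos_sq_def powr_numeral t_def)
          also have "\<dots> = t powr ((p + 1) / p) * t powr ((p - 1) / p)"
            using p_gt_1 by (subst powr_add[symmetric]) (simp add: field_simps)
          also have "\<dots> \<le> T powr ((p + 1) / p) * (2 * t) powr ((p - 1) / p)"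
            using t p_gt_1 by (intro mult_mono powr_mono2) auto
          also have "T powr ((p + 1) / p) = L powr (1 / p)" by (simp add: L_def powr_powr)
          finally show "\<bar>\<Phi> (u z)\<bar> \<le> L powr (1 / p) * \<Phi>' (u z) powr ((p - 1) / p)" by (simp add: \<Phi>'_def t_def)
        qed
        show "norm z \<le> 2 * R \<and> norm (H z) \<le> 6 * N / R * \<eta> z powr ((p - 1) / p)"
          if "z \<in> ?S" "\<Phi> (u z) \<noteq> 0" "H z \<noteq> 0" for z
        proof -
          \<comment> \<open>A nonzero truncation excludes the collar, so only the outer gradient
            bound of the cutoff is needed.\<close>
          have "u z > K + \<delta>" using that(2) by (auto simp: \<Phi>_def pos_sq_def max_def split: if_splits)
          then have "norm z > r'" using near[of z] that(1) by force
          then show ?thesis using \<eta>(6,7)[of z] that by simp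
        qed
        show "\<bar>\<Phi>' (u z)\<bar> powr p \<le> (2 * T) powr (p - 1) * (\<eta> z * \<Phi>' (u z))" if zW: "z \<in> closure W" for z
        proof (cases "\<Phi>' (u z) = 0")
          case False
          have z: "s \<le> norm z" "norm z \<le> 2 * norm x" using clW[OF zW] by auto
          have "u z > K + \<delta>" using False by (auto simp: \<Phi>'_def max_def split: if_splits)
          then have "norm z > r'" using near[of z] z s by force
          then have \<eta>1: "\<eta> z = 1" using z R by (intro \<eta>(5)) auto
          have b: "0 \<le> \<Phi>' (u z)" "\<Phi>' (u z) \<le> 2 * T" using \<tau>[of z] z s r by (auto simp: \<Phi>'_def)
          have "\<bar>\<Phi>' (u z)\<bar> powr p = \<Phi>' (u z) powr (p - 1) * \<Phi>' (u z)" using b False by (simp add: powr_diff)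
          also have "\<dots> \<le> (2 * T) powr (p - 1) * \<Phi>' (u z)" using b p_gt_1 by (intro mult_right_mono powr_mono2) auto
          finally show ?thesis by (simp add: \<eta>1)
        qed simp
      qed
      also have "\<dots> = C * R powr (real CARD('n) - p)"
      proof -
        have "R powr (real CARD('n) - p) = R ^ CARD('n) / R powr p" using R0 by (simp add: powr_diff powr_realpow)
        moreover have "(6 * N / R) powr p = (6 * N) powr p / R powr p" using R0 by (simp add: powr_divide N_def)
        ultimately show ?thesis unfolding vol C_def by simp
      qed
      finally show ?thesis .
    qed
    \<comment> \<open>\<open>R\<close> tends to infinity while \<open>W\<close>, \<open>x\<close>
      and \<open>y\<close> stay fixed.\<close>
    have "?A powr p * measure lborel W \<le> C * 0"
    proof (rule tendsto_lowerbound)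
      have "((\<lambda>R. R powr (real CARD('n) - p)) \<longlongrightarrow> 0) at_top"
        using p_gt_dim by (intro tendsto_neg_powr filterlim_ident) simp
      then show "((\<lambda>R. C * R powr (real CARD('n) - p)) \<longlongrightarrow> C * 0) at_top" by (rule tendsto_mult_left)
      show "\<forall>\<^sub>F R in at_top. ?A powr p * measure lborel W \<le> C * R powr (real CARD('n) - p)"
        using eventually_ge_at_top[of "2 * norm x"] by eventually_elim (rule bound)
    qed simp
    moreover have "measure lborel W > 0" using measure_lborel_open_pos[OF W(1,3)] W(5) by blast
    ultimately have "?A powr p \<le> 0" by (simp add: mult_le_0_iff)
    then have "?A = 0" by simp
    then have "\<Phi> (u x) = \<Phi> (u y)" using nx p_gt_dim p_gt_1 by simp
    moreover have "\<Phi> (u y) = 0" using near[of y] y r' by (simp add: \<Phi>_def pos_sq_def)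
    ultimately show ?thesis by (auto simp: \<Phi>_def pos_sq_def max_def split: if_splits)
  qed
qed

lemma exterior_minimum_principle:
  assumes r: "r > 1" and K: "\<And>x. norm x = r \<Longrightarrow> K \<le> u x" and x: "norm x \<ge> r"
  shows "K \<le> u x"
proof -
  interpret neg: exterior_p_harmonic "\<lambda>x. - u x" "\<lambda>x. - g x" p M by (rule exterior_uminus)
  show ?thesis using neg.exterior_maximum_principle[OF r, of "- K" x] K x by simp
qed

end

section \<open>Harnack inequality and decay of oscillation\<close>

text \<open>\<open>pos_floor \<delta>\<close> agrees with the identity on \<open>{\<delta>..}\<close> but stays positive on the whole line, so that its
  logarithm and negative powers are globally \<open>C\<^sup>1\<close>.\<close>

definition pos_floor :: "real \<Rightarrow> real \<Rightarrow> real" where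
  "pos_floor \<delta> s = s + pos_sq (\<delta> - s) / (2 * \<delta>)"

definition pos_floor' :: "real \<Rightarrow> real \<Rightarrow> real" where
  "pos_floor' \<delta> s = 1 - max 0 (\<delta> - s) / \<delta>"

lemma DERIV_pos_floor:
  assumes "\<delta> > 0" shows "DERIV (pos_floor \<delta>) s :> pos_floor' \<delta> s"
proof -
  have "DERIV (\<lambda>s. s + pos_sq (\<delta> - s) / (2 * \<delta>)) s :> 1 + (2 * max 0 (\<delta> - s) * (0 - 1)) / (2 * \<delta>)"
    by (intro DERIV_add DERIV_ident DERIV_cdivide DERIV_chain2[OF DERIV_pos_sq] DERIV_diff DERIV_const)
  then show ?thesis using assms by (simp add: pos_floor_def[abs_def] pos_floor'_def)
qed

lemma pos_floor_eq: "s \<ge> \<delta> \<Longrightarrow> pos_floor \<delta> s = s" "s \<ge> \<delta> \<Longrightarrow> pos_floor' \<delta> s = 1"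
  by (simp_all add: pos_floor_def pos_floor'_def pos_sq_def)

lemma pos_floor_pos:
  assumes "\<delta> > 0" shows "pos_floor \<delta> s > 0"
proof (cases "s \<ge> \<delta>")
  case False
  then have "pos_floor \<delta> s = (s\<^sup>2 + \<delta>\<^sup>2) / (2 * \<delta>)"
    using assms by (simp add: pos_floor_def pos_sq_def field_simps power2_eq_square)
  moreover have "s\<^sup>2 + \<delta>\<^sup>2 > 0" using assms by (simp add: add_nonneg_pos)
  ultimately show ?thesis using assms by simp
qed (use assms in \<open>simp add: pos_floor_eq\<close>)

lemma continuous_on_pos_floor': "\<delta> > 0 \<Longrightarrow> continuous_on UNIV (pos_floor' \<delta>)"
  unfolding pos_floor'_def[abs_def] by (intro continuous_intros) auto

text \<open>Bound for the difference of \<open>ln (K + \<delta> - u)\<close> at two points of the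
  sphere of radius \<rho> at a nonobtuse angle. The leading quotient comes from Morrey with diameter
  bound 4 \<rho>, the powers of p - 1 from differentiating v^(1 - p), the factor 100 from the
  gradient of the cutoff at scale R = 2 \<rho>, and \<open>16 ^ n\<close> from the ratio of a ball
  of radius 2 R to one of radius \<rho> / 4.\<close>

definition log_oscillation :: "nat \<Rightarrow> real \<Rightarrow> real" where
  "log_oscillation n p = 8 / (1 - real n / p) *
    (4 powr p * (1 / (p - 1) * (2 powr p * (p - 1) powr (1 - p) * (100 * real (nat \<lceil>p\<rceil>)) powr p * (16 ^ n / 2 powr p)))) powr (1 / p)"

lemma log_oscillation_nonneg:
  assumes "p > 1" "p > real n" shows "log_oscillation n p \<ge> 0"
  using assms unfolding log_oscillation_def by (intro mult_nonneg_nonneg divide_nonneg_nonneg) auto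

context exterior_p_harmonic
begin

text \<open>With v = K + \<delta> - u, \<Phi>(u) = v^(1 - p) and F(u) = ln v, the p-th power of the
  modulus of \<open>F' (u z)\<close> is \<open>\<Phi>' (u z) / (p - 1)\<close>, so the energy of the
  logarithm is bounded independently of \<open>u\<close>. The angle condition puts \<open>x\<close>
  and \<open>y\<close> into one convex set away from the hole.\<close>

lemma log_oscillation_acute:
  assumes r: "r > 1" and K: "\<And>x. norm x \<ge> r \<Longrightarrow> u x \<le> K" and \<delta>: "\<delta> > 0"
    and x: "norm x = 8 * r" and y: "norm y = 8 * r" and xy: "x \<bullet> y \<ge> 0"
  shows "\<bar>ln (K + \<delta> - u x) - ln (K + \<delta> - u y)\<bar> \<le> log_oscillation CARD('n) p"
proof -
  define \<rho> where "\<rho> = 8 * r"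
  have \<rho>: "\<rho> > 0" "norm x = \<rho>" "norm y = \<rho>" using r x y by (auto simp: \<rho>_def)
  have xx: "x \<bullet> x = \<rho>\<^sup>2" "y \<bullet> y = \<rho>\<^sup>2" using \<rho> by (auto simp: dot_square_norm)
  define N where "N = real (nat \<lceil>p\<rceil>)"
  define R where "R = 2 * \<rho>"
  have R: "R = 16 * r" "R > 0" using \<rho> by (auto simp: R_def \<rho>_def)
  \<comment> \<open>The threshold is half of what \<open>x\<close> and \<open>y\<close> attain at
    least, which leaves room for a ball of radius \<rho> / 4 around \<open>x\<close>. As
    \<open>norm (x + y) <= 2 * \<rho>\<close>, points of the closure have norm at least \<rho> / 4 =
    2 r, where the cutoff is already 1.\<close>
  define W where "W = {z. \<rho>\<^sup>2 / 2 < z \<bullet> (x + y)} \<inter> ball 0 (2 * \<rho>)"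
  have nxy: "norm (x + y) \<le> 2 * \<rho>" using norm_triangle_ineq[of x y] \<rho> by simp
  have clW: "2 * r \<le> norm z \<and> norm z \<le> R" if "z \<in> closure W" for z
  proof -
    have z: "\<rho>\<^sup>2 / 2 \<le> z \<bullet> (x + y)" "norm z \<le> 2 * \<rho>" using that closure_halfspace_ball unfolding W_def by blast+
    have "z \<bullet> (x + y) \<le> norm z * norm (x + y)" using Cauchy_Schwarz_ineq2[of z "x + y"] by simp
    also have "\<dots> \<le> norm z * (2 * \<rho>)" using nxy by (intro mult_left_mono) auto
    finally have "\<rho>\<^sup>2 / 2 \<le> norm z * (2 * \<rho>)" using z(1) by linarith
    then have "\<rho> * (\<rho> / 4) \<le> \<rho> * norm z" by (simp add: power2_eq_square mult.commute)
    then have "\<rho> / 4 \<le> norm z" using \<rho>(1) by (simp only: mult_le_cancel_left_pos)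
    then show ?thesis using z(2) by (simp add: \<rho>_def R_def)
  qed
  have ballW: "ball x (\<rho> / 4) \<subseteq> W"
  proof
    fix z assume "z \<in> ball x (\<rho> / 4)"
    then have h: "norm (z - x) < \<rho> / 4" by (simp add: dist_norm norm_minus_commute)
    have "\<bar>(z - x) \<bullet> (x + y)\<bar> \<le> norm (z - x) * norm (x + y)" by (rule Cauchy_Schwarz_ineq2)
    also have "\<dots> \<le> norm (z - x) * (2 * \<rho>)" using nxy by (intro mult_left_mono) auto
    also have "\<dots> < \<rho> / 4 * (2 * \<rho>)" using h \<rho>(1) by (intro mult_strict_right_mono) auto
    finally have "\<bar>(z - x) \<bullet> (x + y)\<bar> < \<rho>\<^sup>2 / 2" by (simp add: power2_eq_square)
    moreover have "z \<bullet> (x + y) = (z - x) \<bullet> (x + y) + \<rho>\<^sup>2 + x \<bullet> y"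
      using xx by (simp add: inner_diff_left inner_add_right)
    ultimately have "z \<bullet> (x + y) > \<rho>\<^sup>2 / 2" using xy by (simp add: abs_less_iff)
    moreover have "norm z < 2 * \<rho>" using norm_triangle_sub[of z x] h \<rho> by linarith
    ultimately show "z \<in> W" by (simp add: W_def)
  qed
  have W: "open W" "convex W" "bounded W" "closure W \<subseteq> - cball 0 1" "x \<in> W" "y \<in> W"
  proof -
    show "open W" unfolding W_def by (rule open_halfspace_ball)
    show "convex W" unfolding W_def by (rule convex_halfspace_ball)
    show "bounded W" unfolding W_def by (rule bounded_Int) auto
    show "closure W \<subseteq> - cball 0 1" using clW r by fastforce
    show "x \<in> W" using ballW \<rho>(1) by auto
    have "\<rho>\<^sup>2 > 0" using \<rho>(1) by simp
    moreover have "y \<bullet> (x + y) = x \<bullet> y + \<rho>\<^sup>2" using xx by (simp add: inner_add_right inner_commute)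
    ultimately have "\<rho>\<^sup>2 / 2 < y \<bullet> (x + y)" using xy by linarith
    then show "y \<in> W" using \<rho> by (simp add: W_def)
  qed
  define v where "v z = K + \<delta> - u z" for z
  have v: "v z \<ge> \<delta>" "pos_floor \<delta> (K + \<delta> - u z) = v z" "pos_floor' \<delta> (K + \<delta> - u z) = 1" "v z > 0"
    if "norm z \<ge> r" for z
    using K[OF that] \<delta> by (auto simp: v_def pos_floor_eq)
  define k where "k t = pos_floor \<delta> (K + \<delta> - t)" for t
  define k' where "k' t = - pos_floor' \<delta> (K + \<delta> - t)" for t
  have Dk: "DERIV k t :> k' t" for t
  proof -
    have "DERIV (\<lambda>t. pos_floor \<delta> (K + \<delta> - t)) t :> pos_floor' \<delta> (K + \<delta> - t) * (0 - 1)"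
      by (intro DERIV_chain2[OF DERIV_pos_floor[OF \<delta>]] DERIV_diff DERIV_ident DERIV_const)
    then show ?thesis by (simp add: k_def[abs_def] k'_def)
  qed
  have kpos: "k t > 0" for t unfolding k_def by (rule pos_floor_pos[OF \<delta>])
  have ck: "continuous_on UNIV k" by (rule DERIV_continuous_on_UNIV[OF Dk])
  have ck': "continuous_on UNIV k'"
    unfolding k'_def[abs_def] by (intro continuous_intros continuous_on_compose2[OF continuous_on_pos_floor'[OF \<delta>]]) auto
  define \<Phi> where "\<Phi> t = k t powr (1 - p)" for t
  define \<Phi>' where "\<Phi>' t = (1 - p) * k t powr (- p) * k' t" for t
  have D\<Phi>: "DERIV \<Phi> t :> \<Phi>' t" for t
  proof -
    have "DERIV (\<lambda>s. s powr (1 - p)) (k t) :> (1 - p) * k t powr (1 - p - 1)"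
      by (rule has_real_derivative_powr[OF kpos])
    from DERIV_chain2[OF this Dk] show ?thesis by (simp add: \<Phi>_def[abs_def] \<Phi>'_def)
  qed
  have c\<Phi>': "continuous_on UNIV \<Phi>'"
    unfolding \<Phi>'_def[abs_def] using kpos by (intro continuous_intros ck ck') (metis less_irrefl)
  define F where "F t = ln (k t)" for t
  define F' where "F' t = inverse (k t) * k' t" for t
  have DF: "DERIV F t :> F' t" for t
    unfolding F_def[abs_def] F'_def by (rule DERIV_chain2[OF DERIV_ln[OF kpos] Dk])
  have cF': "continuous_on UNIV F'"
    unfolding F'_def[abs_def] using kpos by (intro continuous_intros ck ck') (metis less_irrefl)
  have ku: "k (u z) = v z" "k' (u z) = - 1" if "norm z \<ge> r" for z
    using v[OF that] by (auto simp: k_def k'_def)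
  have "0 < r" "r < 2 * r" "2 * r \<le> R" using r R by auto
  from cutoff_exists[OF this p_gt_1, where 'a="real^'n"]
  obtain \<eta> :: "real^'n \<Rightarrow> real" and H where \<eta>: "\<And>x. GDERIV \<eta> x :> H x" "continuous_on UNIV H" "\<And>x. \<eta> x \<ge> 0"
    "\<And>x. norm x \<le> r \<or> norm x \<ge> 2 * R \<Longrightarrow> \<eta> x = 0" "\<And>x. 2 * r \<le> norm x \<Longrightarrow> norm x \<le> R \<Longrightarrow> \<eta> x = 1"
    "\<And>x. 2 * r \<le> norm x \<Longrightarrow> norm (H x) \<le> 6 * N / R * \<eta> x powr ((p - 1) / p)"
    "\<And>x. norm x \<le> 2 * r \<Longrightarrow> norm (H x) \<le> 8 * N * (2 * r) / ((2 * r)\<^sup>2 - r\<^sup>2) * \<eta> x powr ((p - 1) / p)"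
    "\<And>x. H x \<noteq> 0 \<Longrightarrow> norm x \<le> 2 * R"
    unfolding N_def by metis
  have N0: "N \<ge> 0" by (simp add: N_def)
  \<comment> \<open>With R = 16 r the inner slope 16 N / (3 r) equals 256 N / (3 R), so the factor
    100 covers both layers.\<close>
  have HR: "norm (H z) \<le> 100 * N / R * \<eta> z powr ((p - 1) / p)" for z
  proof (cases "2 * r \<le> norm z")
    case True
    have "6 * N / R * \<eta> z powr ((p - 1) / p) \<le> 100 * N / R * \<eta> z powr ((p - 1) / p)"
      using N0 R by (intro mult_right_mono divide_right_mono) auto
    then show ?thesis using \<eta>(6)[OF True] by linarith
  next
    case False
    have "8 * N * (2 * r) / ((2 * r)\<^sup>2 - r\<^sup>2) \<le> 100 * N / R"
      using r N0 by (simp add: R power2_eq_square field_simps)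
    then have "8 * N * (2 * r) / ((2 * r)\<^sup>2 - r\<^sup>2) * \<eta> z powr ((p - 1) / p) \<le> 100 * N / R * \<eta> z powr ((p - 1) / p)"
      by (intro mult_right_mono) auto
    then show ?thesis using \<eta>(7)[of z] False by linarith
  qed
  let ?S = "{x::real^'n. r \<le> norm x \<and> norm x \<le> 2 * R}"
  have S: "compact ?S" "?S \<subseteq> - cball 0 1" using r by (auto simp: compact_annulus)
  have zS: "\<eta> z = 0" if "z \<notin> ?S" for z using \<eta>(4)[of z] that by auto
  \<comment> \<open>The value that turns the growth condition on \<Phi> into an equality.\<close>
  define L where "L = (p - 1) powr (1 - p)"
  have \<Phi>u: "\<Phi> (u z) = v z powr (1 - p)" "\<Phi>' (u z) = (p - 1) * v z powr (- p)" if "norm z \<ge> r" for z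
    using ku[OF that] by (auto simp: \<Phi>_def \<Phi>'_def algebra_simps)
  let ?vol = "unit_ball_vol (real CARD('n))"
  have vol: "measure lborel (cball 0 (2 * R) :: (real^'n) set) = ?vol * (2 * R) ^ CARD('n)"
    using R by (simp add: content_cball)
  let ?\<kappa> = "1 - real CARD('n) / p"
  let ?\<Delta> = "\<bar>F (u x) - F (u y)\<bar>"
  have \<kappa>: "?\<kappa> > 0" using p_gt_dim p_gt_1 by simp
  have M: "(?\<kappa> / (2 * (4 * \<rho>)) * ?\<Delta>) powr p * measure lborel W
    \<le> 4 powr p * (1 / (p - 1) * (2 powr p * L * (100 * N / R) powr p * measure lborel (cball 0 (2 * R) :: (real^'n) set)))"
  proof (rule caccioppoli_morrey[OF D\<Phi> c\<Phi>' DF cF' \<eta>(1,2) S zS \<eta>(3) _ _ _ _ W(1-3) _ _ _ p_gt_dim W(5,6)])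
    show "4 * \<rho> > 0" "1 / (p - 1) \<ge> 0" using \<rho> p_gt_1 by simp_all
    show "closure W \<subseteq> ?S" using clW r R by fastforce
    show "norm (a - b) \<le> 4 * \<rho>" if "a \<in> W" "b \<in> W" for a b
      using that norm_triangle_ineq4[of a b] by (auto simp: W_def)
    show "L \<ge> 0" by (simp add: L_def)
    show "100 * N / R \<ge> 0" using R N0 by simp
    show "\<Phi>' (u z) \<ge> 0 \<and> \<bar>\<Phi> (u z)\<bar> \<le> L powr (1 / p) * \<Phi>' (u z) powr ((p - 1) / p)" if "z \<in> ?S" for z
    proof
      have z: "norm z \<ge> r" using that by simp
      show "\<Phi>' (u z) \<ge> 0" using p_gt_1 by (simp add: \<Phi>u[OF z])
      have "\<Phi>' (u z) powr ((p - 1) / p) = (p - 1) powr ((p - 1) / p) * v z powr (1 - p)"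
        using p_gt_1 v(4)[OF z] by (simp add: \<Phi>u[OF z] powr_mult powr_powr)
      moreover have "L powr (1 / p) = (p - 1) powr (- ((p - 1) / p))"
        by (simp add: L_def powr_powr) (metis minus_diff_eq minus_divide_left)
      moreover have "(p - 1) powr (- ((p - 1) / p)) * (p - 1) powr ((p - 1) / p) = 1"
        using p_gt_1 by (simp flip: powr_add)
      ultimately have "L powr (1 / p) * \<Phi>' (u z) powr ((p - 1) / p) = v z powr (1 - p)"
        by (simp flip: mult.assoc)
      then show "\<bar>\<Phi> (u z)\<bar> \<le> L powr (1 / p) * \<Phi>' (u z) powr ((p - 1) / p)" by (simp add: \<Phi>u[OF z])
    qed
    show "norm z \<le> 2 * R \<and> norm (H z) \<le> 100 * N / R * \<eta> z powr ((p - 1) / p)"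
      if "z \<in> ?S" "\<Phi> (u z) \<noteq> 0" "H z \<noteq> 0" for z
      using that HR[of z] by simp
    show "\<bar>F' (u z)\<bar> powr p \<le> 1 / (p - 1) * (\<eta> z * \<Phi>' (u z))" if "z \<in> closure W" for z
    proof -
      have z: "2 * r \<le> norm z" "norm z \<le> R" using clW[OF that] by auto
      then have \<eta>1: "\<eta> z = 1" by (rule \<eta>(5))
      have zr: "norm z \<ge> r" using z r by simp
      have "\<bar>F' (u z)\<bar> = 1 / v z" using v(4)[OF zr] by (simp add: F'_def ku[OF zr] abs_mult divide_inverse)
      moreover have "(1 / v z) powr p = 1 / v z powr p" using v(4)[OF zr] by (simp add: powr_divide)
      moreover have "v z powr (- p) = 1 / v z powr p" by (rule powr_minus_divide)
      ultimately have "\<bar>F' (u z)\<bar> powr p = v z powr (- p)" by simp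
      then show ?thesis using \<eta>1 p_gt_1 by (simp add: \<Phi>u[OF zr])
    qed
  qed
  \<comment> \<open>A lower bound for the volume of \<open>W\<close> that scales like the n-th power
    of \<rho>.\<close>
  have "?vol * (\<rho> / 4) ^ CARD('n) = measure lborel (ball x (\<rho> / 4))"
    using \<rho>(1) by (simp add: content_ball)
  also have "\<dots> \<le> measure lborel W"
    using ballW W(1) emeasure_bounded_finite[OF W(3)] by (intro measure_mono_fmeasurable) (auto simp: fmeasurable_def)
  finally have mW: "?vol * (\<rho> / 4) ^ CARD('n) \<le> measure lborel W" .
  have "(?\<kappa> / (8 * \<rho>) * ?\<Delta>) powr p * (?vol * (\<rho> / 4) ^ CARD('n)) \<le> (?\<kappa> / (8 * \<rho>) * ?\<Delta>) powr p * measure lborel W"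
    using mW by (rule mult_left_mono) simp
  also have "\<dots> \<le> 4 powr p * (1 / (p - 1) * (2 powr p * L * (100 * N / R) powr p * (?vol * (2 * R) ^ CARD('n))))"
    using M unfolding vol by simp
  finally have "(?\<kappa> / (8 * \<rho>) * ?\<Delta>) powr p * (\<rho> / 4) ^ CARD('n) * ?vol
    \<le> 4 powr p * (1 / (p - 1) * (2 powr p * L * (100 * N / R) powr p * (2 * R) ^ CARD('n))) * ?vol" by (simp add: mult_ac)
  then have le: "(?\<kappa> / (8 * \<rho>) * ?\<Delta>) powr p * (\<rho> / 4) ^ CARD('n)
    \<le> 4 powr p * (1 / (p - 1) * (2 powr p * L * (100 * N / R) powr p * (2 * R) ^ CARD('n)))"
    by (rule mult_right_le_imp_le) simp
  define Q where "Q = 4 powr p * (1 / (p - 1) * (2 powr p * L * (100 * N) powr p * (16 ^ CARD('n) / 2 powr p)))"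
  have "(2 * R) ^ CARD('n) = 16 ^ CARD('n) * (\<rho> / 4) ^ CARD('n)"
  proof -
    have "2 * R = 16 * (\<rho> / 4)" by (simp add: R_def)
    then show ?thesis by (simp only: power_mult_distrib)
  qed
  moreover have "(100 * N / R) powr p = (100 * N) powr p / 2 powr p / \<rho> powr p"
  proof -
    have "(100 * N / R) powr p = (100 * N) powr p / (2 * \<rho>) powr p"
      unfolding R_def by (rule powr_divide)
    moreover have "(2 * \<rho>) powr p = 2 powr p * \<rho> powr p" by (rule powr_mult)
    ultimately show ?thesis by simp
  qed
  moreover have "(?\<kappa> / (8 * \<rho>) * ?\<Delta>) powr p = (?\<kappa> / 8 * ?\<Delta>) powr p / \<rho> powr p"
    using \<kappa> \<rho> by (simp add: powr_divide[symmetric])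
  \<comment> \<open>Both sides carry the same power of \<rho>, which cancels; hence a constant
    independent of the radius.\<close>
  ultimately have "(?\<kappa> / 8 * ?\<Delta>) powr p * ((\<rho> / 4) ^ CARD('n) / \<rho> powr p) \<le> Q * ((\<rho> / 4) ^ CARD('n) / \<rho> powr p)"
    using le by (simp add: Q_def mult_ac)
  then have "(?\<kappa> / 8 * ?\<Delta>) powr p \<le> Q"
    by (rule mult_right_le_imp_le) (use \<rho> in simp)
  then have "((?\<kappa> / 8 * ?\<Delta>) powr p) powr (1 / p) \<le> Q powr (1 / p)"
    using p_gt_1 by (intro powr_mono2) auto
  moreover have "((?\<kappa> / 8 * ?\<Delta>) powr p) powr (1 / p) = ?\<kappa> / 8 * ?\<Delta>"
    using \<kappa> p_gt_1 by (simp add: powr_powr)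
  ultimately have "?\<kappa> * ?\<Delta> \<le> 8 * Q powr (1 / p)" by simp
  then have "?\<Delta> \<le> 8 / ?\<kappa> * Q powr (1 / p)" using \<kappa> by (simp add: pos_le_divide_eq mult.commute)
  moreover have "F (u x) = ln (K + \<delta> - u x)" "F (u y) = ln (K + \<delta> - u y)"
    using ku[of x] ku[of y] x y r by (auto simp: F_def v_def)
  ultimately show ?thesis by (simp add: log_oscillation_def Q_def L_def N_def)
qed

text \<open>Two points are joined through \<open>w\<close> orthogonal to \<open>x\<close>, its sign
  chosen so that the angle with \<open>y\<close> is not obtuse either; this doubles the logarithmic
  bound. The bound is the same for every \<delta> > 0, so \<delta> may tend to 0.\<close>

lemma harnack_sphere:
  assumes n: "CARD('n) \<ge> 2" and r: "r > 1" and K: "\<And>x. norm x \<ge> r \<Longrightarrow> u x \<le> K"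
    and x: "norm x = 8 * r" and y: "norm y = 8 * r"
  shows "K - u x \<le> exp (2 * log_oscillation CARD('n) p) * (K - u y)"
proof -
  let ?\<Lambda> = "log_oscillation CARD('n) p"
  obtain w where w: "norm w = 8 * r" "w \<bullet> x \<ge> 0" "w \<bullet> y \<ge> 0"
  proof -
    \<comment> \<open>A nonzero orthogonal vector requires dimension at least 2.\<close>
    obtain e where e: "e \<noteq> 0" "orthogonal x e"
      using orthogonal_to_vector_exists[of x] n by (metis DIM_cart DIM_real mult.right_neutral)
    define w where "w = (8 * r / norm e) *\<^sub>R e"
    have w: "norm w = 8 * r" "w \<bullet> x = 0" using e r by (auto simp: w_def orthogonal_def inner_commute)
    show ?thesis
    proof (cases "w \<bullet> y \<ge> 0")
      case True
      then show ?thesis using that[of w] w by simp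
    next
      case False
      then show ?thesis using that[of "- w"] w by simp
    qed
  qed
  have step: "K + \<delta> - u x \<le> exp (2 * ?\<Lambda>) * (K + \<delta> - u y)" if \<delta>: "\<delta> > 0" for \<delta>
  proof -
    have pos: "K + \<delta> - u z > 0" if "norm z = 8 * r" for z
      using K[of z] that r \<delta> by simp
    have "\<bar>ln (K + \<delta> - u w) - ln (K + \<delta> - u x)\<bar> \<le> ?\<Lambda>" "\<bar>ln (K + \<delta> - u w) - ln (K + \<delta> - u y)\<bar> \<le> ?\<Lambda>"
      by (rule log_oscillation_acute[OF r K \<delta> w(1)]; use x y w in simp)+
    then have "ln (K + \<delta> - u x) \<le> 2 * ?\<Lambda> + ln (K + \<delta> - u y)" by linarith
    then have "exp (ln (K + \<delta> - u x)) \<le> exp (2 * ?\<Lambda> + ln (K + \<delta> - u y))" by simp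
    then show ?thesis using pos[OF x] pos[OF y] by (simp add: exp_add)
  qed
  show ?thesis
  proof (rule tendsto_le)
    show "((\<lambda>\<delta>. exp (2 * ?\<Lambda>) * (K + \<delta> - u y)) \<longlongrightarrow> exp (2 * ?\<Lambda>) * (K - u y)) (at_right 0)"
      by (auto intro!: tendsto_eq_intros)
    show "((\<lambda>\<delta>. K + \<delta> - u x) \<longlongrightarrow> K - u x) (at_right 0)" by (auto intro!: tendsto_eq_intros)
    show "\<forall>\<^sub>F \<delta> in at_right 0. K + \<delta> - u x \<le> exp (2 * ?\<Lambda>) * (K + \<delta> - u y)"
      using eventually_at_right_less[of 0] by eventually_elim (rule step)
  qed simp
qed

text \<open>The extremes over the sphere are attained by compactness and bound \<open>u\<close>
  further out by the maximum and minimum principles.\<close>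

lemma sphere_range:
  assumes r: "r > 1" and \<omega>: "\<And>x y. norm x = r \<Longrightarrow> norm y = r \<Longrightarrow> \<bar>u x - u y\<bar> \<le> \<omega>"
  obtains m K where "K - m \<le> \<omega>" "\<And>x. norm x \<ge> r \<Longrightarrow> m \<le> u x" "\<And>x. norm x \<ge> r \<Longrightarrow> u x \<le> K"
proof -
  have c: "continuous_on (sphere 0 r) u"
    using r by (intro continuous_on_subset[OF continuous_u]) auto
  have ne: "sphere (0::real^'n) r \<noteq> {}" using r by simp
  obtain a where a: "a \<in> sphere 0 r" "\<And>z. z \<in> sphere 0 r \<Longrightarrow> u z \<le> u a"
    using continuous_attains_sup[OF compact_sphere ne c] by blast
  obtain b where b: "b \<in> sphere 0 r" "\<And>z. z \<in> sphere 0 r \<Longrightarrow> u b \<le> u z"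
    using continuous_attains_inf[OF compact_sphere ne c] by blast
  show ?thesis
  proof (rule that[of "u a" "u b"])
    show "u a - u b \<le> \<omega>" using \<omega>[of a b] a b by auto
    show "u b \<le> u x" if "norm x \<ge> r" for x
      by (rule exterior_minimum_principle[OF r _ that]) (use b in auto)
    show "u x \<le> u a" if "norm x \<ge> r" for x
      by (rule exterior_maximum_principle[OF r _ that]) (use a in auto)
  qed
qed

lemma oscillation_exterior:
  assumes r: "r > 1" and \<omega>: "\<And>x y. norm x = r \<Longrightarrow> norm y = r \<Longrightarrow> \<bar>u x - u y\<bar> \<le> \<omega>"
    and x: "norm x \<ge> r" and y: "norm y \<ge> r"
  shows "\<bar>u x - u y\<bar> \<le> \<omega>"
proof -
  obtain m K where "K - m \<le> \<omega>" "m \<le> u x" "u x \<le> K" "m \<le> u y" "u y \<le> K"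
    using sphere_range[OF r \<omega>] x y by metis
  then show ?thesis by linarith
qed

text \<open>The Harnack inequality makes K - u comparable at any two points of the larger sphere, so
  \<open>u\<close> cannot come close to both ends of its range there; the maximum principle carries
  the reduced oscillation outwards.\<close>

lemma oscillation_decay:
  assumes n: "CARD('n) \<ge> 2" and r: "r > 1" and \<omega>: "\<And>x y. norm x = r \<Longrightarrow> norm y = r \<Longrightarrow> \<bar>u x - u y\<bar> \<le> \<omega>"
    and x: "norm x \<ge> 8 * r" and y: "norm y \<ge> 8 * r"
  shows "\<bar>u x - u y\<bar> \<le> (1 - exp (- (2 * log_oscillation CARD('n) p))) * \<omega>"
proof (rule oscillation_exterior[of "8 * r"])
  let ?\<Lambda> = "2 * log_oscillation CARD('n) p"
  obtain m K where mK: "K - m \<le> \<omega>" "\<And>x. norm x \<ge> r \<Longrightarrow> m \<le> u x" "\<And>x. norm x \<ge> r \<Longrightarrow> u x \<le> K"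
    using sphere_range[OF r \<omega>] by metis
  \<comment> \<open>A one-sided estimate; exchanging \<open>x\<close> and \<open>y\<close> gives the
    absolute value.\<close>
  have *: "u y - u x \<le> (1 - exp (- ?\<Lambda>)) * \<omega>" if "norm x = 8 * r" "norm y = 8 * r" for x y
  proof -
    have "K - u x \<le> exp ?\<Lambda> * (K - u y)" using harnack_sphere[OF n r mK(3) that] .
    then have "exp (- ?\<Lambda>) * (K - u x) \<le> exp (- ?\<Lambda>) * (exp ?\<Lambda> * (K - u y))" by (rule mult_left_mono) simp
    then have 1: "exp (- ?\<Lambda>) * (K - u x) \<le> K - u y" by (simp flip: mult.assoc exp_add)
    have e: "exp (- ?\<Lambda>) \<le> 1" using log_oscillation_nonneg[OF p_gt_1 p_gt_dim] by simp
    have "u y - u x \<le> (1 - exp (- ?\<Lambda>)) * (K - u x)" using 1 by (simp add: algebra_simps)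
    also have "\<dots> \<le> (1 - exp (- ?\<Lambda>)) * \<omega>"
      using e mK(1) mK(2)[of x] that r by (intro mult_left_mono) auto
    finally show ?thesis .
  qed
  show "\<bar>u x - u y\<bar> \<le> (1 - exp (- ?\<Lambda>)) * \<omega>" if "norm x = 8 * r" "norm y = 8 * r" for x y
    using *[OF that] *[OF that(2,1)] by linarith
qed (use r x y in auto)

end


text \<open>The weak gradient is only Lebesgue measurable; a Borel representative is chosen so that Fubini's theorem
  for \<^const>\<open>lborel\<close> applies.\<close>

lemma p_harmonic_on_imp_weak_p_harmonic:
  fixes u :: "real ^ 'n::finite \<Rightarrow> real"
  assumes harm: "p_harmonic_on p \<Omega> u" and cont: "continuous_on \<Omega> u" and p: "p > 1"
  shows "\<exists>g. weak_p_harmonic \<Omega> (\<lambda>x. indicator \<Omega> x * u x) g p"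
proof -
  obtain Du where op: "open \<Omega>" and W: "W1p_loc p \<Omega> u Du"
    and eq: "\<And>\<phi>. \<phi> \<in> test_functions \<Omega> \<Longrightarrow> (LINT x:\<Omega>|lebesgue. (norm (Du x) powr (p - 2) *\<^sub>R Du x) \<bullet> grad \<phi> x) = 0"
    using harm unfolding p_harmonic_on_def by blast
  have wg: "\<And>\<phi> i. \<phi> \<in> test_functions \<Omega> \<Longrightarrow>
      (LINT x:\<Omega>|lebesgue. u x * partial i \<phi> x) = - (LINT x:\<Omega>|lebesgue. (Du x $ i) * \<phi> x)"
    and Dp: "Lp_loc p \<Omega> Du" using W unfolding W1p_loc_def weak_gradient_def by blast+
  have Dm: "(\<lambda>x. indicator \<Omega> x *\<^sub>R Du x) \<in> borel_measurable lebesgue"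
    using Dp unfolding Lp_loc_def set_borel_measurable_def by blast
  \<comment> \<open>Borel representatives are available for real functions, so they are chosen
    coordinate by coordinate.\<close>
  have ex: "\<exists>h\<in>borel_measurable lborel. AE x in lborel. (indicator \<Omega> x *\<^sub>R Du x) $ i = h x" for i
    by (rule completion_ex_borel_measurable_real)
      (rule measurable_compose[OF Dm], intro borel_measurable_continuous_onI continuous_intros)
  have "\<forall>i. \<exists>h. h \<in> borel_measurable lborel \<and> (AE x in lborel. (indicator \<Omega> x *\<^sub>R Du x) $ i = h x)"
    using ex by blast
  from choice[OF this] obtain h where h: "\<And>i. h i \<in> borel_measurable lborel"
    "\<And>i. AE x in lborel. (indicator \<Omega> x *\<^sub>R Du x) $ i = h i x" by blast
  define g where "g x = (\<chi> i. h i x)" for x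
  have gm[measurable]: "g \<in> borel_measurable borel"
  proof (subst borel_measurable_euclidean_space, intro ballI)
    fix b :: "real^'n" assume "b \<in> Basis"
    then obtain i where "b = axis i 1" by (auto simp: Basis_vec_def)
    then show "(\<lambda>x. g x \<bullet> b) \<in> borel_measurable borel" using h(1)[of i] by (simp add: g_def inner_axis)
  qed
  have gD: "AE x in lebesgue. indicator \<Omega> x *\<^sub>R Du x = g x"
  proof -
    have "AE x in lborel. \<forall>i\<in>UNIV. (indicator \<Omega> x *\<^sub>R Du x) $ i = h i x"
      using h(2) by (intro AE_finite_allI) auto
    then have "AE x in lborel. indicator \<Omega> x *\<^sub>R Du x = g x"
      by eventually_elim (simp add: g_def vec_eq_iff)
    then show ?thesis by (rule AE_completion)
  qed
  have [measurable]: "\<Omega> \<in> sets borel" using op by simp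
  \<comment> \<open>Outside the domain \<open>u\<close> is arbitrary; its extension by zero is
    Borel.\<close>
  have [measurable]: "(\<lambda>x. indicator \<Omega> x * u x) \<in> borel_measurable borel"
    using borel_measurable_continuous_on_indicator[OF _ cont] by simp
  have test0: "\<phi> x = 0" if "\<phi> \<in> test_functions \<Omega>" "x \<notin> \<Omega>" for \<phi> x
    using that closure_subset[of "{x. \<phi> x \<noteq> 0}"] unfolding test_functions_def by blast
  have testm: "\<phi> \<in> borel_measurable borel" "partial i \<phi> \<in> borel_measurable borel" "grad \<phi> \<in> borel_measurable borel"
    if "\<phi> \<in> test_functions \<Omega>" for \<phi> i
  proof -
    have s: "smooth \<phi>" using that by (simp add: test_functions_def)
    then show "\<phi> \<in> borel_measurable borel" "partial i \<phi> \<in> borel_measurable borel" "grad \<phi> \<in> borel_measurable borel"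
      by (auto intro!: borel_measurable_continuous_onI smooth_continuous smooth_partial smooth_continuous_grad)
  qed
  \<comment> \<open>Transfers a Lebesgue integral over the domain to the whole space, for a Borel
    function that agrees almost everywhere with the extension by zero.\<close>
  have AE_int: "(LINT x:\<Omega>|lebesgue. f x) = (LINT x|lborel. k x)"
    if k: "k \<in> borel_measurable borel" and fm: "(\<lambda>x. indicator \<Omega> x *\<^sub>R f x) \<in> borel_measurable lebesgue" and fk: "AE x in lebesgue. indicator \<Omega> x *\<^sub>R f x = k x" for f k :: "real^'n \<Rightarrow> real"
  proof -
    have km: "k \<in> borel_measurable lebesgue" using k by (simp add: measurable_completion)
    have "(LINT x:\<Omega>|lebesgue. f x) = (LINT x|lebesgue. k x)"
      unfolding set_lebesgue_integral_def using fk fm km by (intro integral_cong_AE)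
    also have "\<dots> = (LINT x|lborel. k x)" using k by (intro integral_completion) simp
    finally show ?thesis .
  qed
  have "weak_p_harmonic \<Omega> (\<lambda>x. indicator \<Omega> x * u x) g p"
  proof
    show "continuous_on \<Omega> (\<lambda>x. indicator \<Omega> x * u x)"
      using cont by (rule continuous_on_eq) simp
    show "integrable lborel (\<lambda>x. indicator K x * norm (g x) powr p)" if K: "compact K" "K \<subseteq> \<Omega>" for K
    proof -
      have [measurable]: "K \<in> sets borel" using K(1) by (rule borel_compact)
      have "integrable lebesgue (\<lambda>x. indicator K x *\<^sub>R norm (Du x) powr p)"
        using Dp K unfolding Lp_loc_def set_integrable_def by blast
      moreover have "AE x in lebesgue. indicator K x *\<^sub>R norm (Du x) powr p = indicator K x * norm (g x) powr p"
        using gD by eventually_elim (use K(2) in \<open>auto simp: indicator_def\<close>)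
      moreover have km: "(\<lambda>x. indicator K x * norm (g x) powr p) \<in> borel_measurable lborel" by measurable
      ultimately have "integrable lebesgue (\<lambda>x. indicator K x * norm (g x) powr p)"
        using measurable_completion[OF km] by (subst integrable_cong_AE[symmetric]) auto
      then show ?thesis using integrable_completion[OF km] by simp
    qed
    show "(LINT x|lborel. indicator \<Omega> x * u x * partial i \<phi> x) = - (LINT x|lborel. g x $ i * \<phi> x)"
      if \<phi>: "\<phi> \<in> test_functions \<Omega>" for \<phi> i
    proof -
      note [measurable] = testm[OF \<phi>]
      have testL: "\<phi> \<in> borel_measurable lebesgue" "grad \<phi> \<in> borel_measurable lebesgue"
        using testm[OF \<phi>] by (simp_all add: measurable_completion)
      have "(LINT x:\<Omega>|lebesgue. u x * partial i \<phi> x) = (LINT x|lborel. indicator \<Omega> x * u x * partial i \<phi> x)"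
      proof (rule AE_int)
        have "(\<lambda>x. indicator \<Omega> x * u x * partial i \<phi> x) \<in> borel_measurable lborel" by measurable
        from measurable_completion[OF this]
        show "(\<lambda>x. indicator \<Omega> x *\<^sub>R (u x * partial i \<phi> x)) \<in> borel_measurable lebesgue" by (simp add: mult.assoc)
      qed (auto intro!: AE_I2)
      moreover have "(LINT x:\<Omega>|lebesgue. (Du x $ i) * \<phi> x) = (LINT x|lborel. g x $ i * \<phi> x)"
      proof (rule AE_int)
        show "AE x in lebesgue. indicator \<Omega> x *\<^sub>R (Du x $ i * \<phi> x) = g x $ i * \<phi> x"
          using gD
        proof eventually_elim
          case (elim x)
          then show ?case using test0[OF \<phi>, of x] by (cases "x \<in> \<Omega>") auto
        qed
        have "(\<lambda>x. (indicator \<Omega> x *\<^sub>R Du x) $ i) \<in> borel_measurable lebesgue"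
          by (rule measurable_compose[OF Dm], intro borel_measurable_continuous_onI continuous_intros)
        then have "(\<lambda>x. (indicator \<Omega> x *\<^sub>R Du x) $ i * \<phi> x) \<in> borel_measurable lebesgue"
          by (intro borel_measurable_times testL)
        then show "(\<lambda>x. indicator \<Omega> x *\<^sub>R (Du x $ i * \<phi> x)) \<in> borel_measurable lebesgue" by (simp add: mult.assoc)
        show "(\<lambda>x. g x $ i * \<phi> x) \<in> borel_measurable borel"
          using h(1)[of i] by (simp add: g_def)
      qed
      ultimately show ?thesis using wg[OF \<phi>, of i] by simp
    qed
    show "(LINT x|lborel. (norm (g x) powr (p - 2) *\<^sub>R g x) \<bullet> grad \<phi> x) = 0"
      if \<phi>: "\<phi> \<in> test_functions \<Omega>" for \<phi>
    proof -
      note [measurable] = testm[OF \<phi>]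
      have testL: "\<phi> \<in> borel_measurable lebesgue" "grad \<phi> \<in> borel_measurable lebesgue"
        using testm[OF \<phi>] by (simp_all add: measurable_completion)
      have "(LINT x:\<Omega>|lebesgue. (norm (Du x) powr (p - 2) *\<^sub>R Du x) \<bullet> grad \<phi> x)
        = (LINT x|lborel. (norm (g x) powr (p - 2) *\<^sub>R g x) \<bullet> grad \<phi> x)"
      proof (rule AE_int)
        show "AE x in lebesgue. indicator \<Omega> x *\<^sub>R ((norm (Du x) powr (p - 2) *\<^sub>R Du x) \<bullet> grad \<phi> x)
            = (norm (g x) powr (p - 2) *\<^sub>R g x) \<bullet> grad \<phi> x"
          using gD
        proof eventually_elim
          case (elim x)
          then show ?case by (cases "x \<in> \<Omega>") auto
        qed
        have "(\<lambda>x. (norm (indicator \<Omega> x *\<^sub>R Du x) powr (p - 2) *\<^sub>R (indicator \<Omega> x *\<^sub>R Du x)) \<bullet> grad \<phi> x) \<in> borel_measurable lebesgue"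
          using Dm testL(2) by measurable
        moreover have "(norm (indicator \<Omega> x *\<^sub>R Du x) powr (p - 2) *\<^sub>R (indicator \<Omega> x *\<^sub>R Du x)) \<bullet> grad \<phi> x
            = indicator \<Omega> x *\<^sub>R ((norm (Du x) powr (p - 2) *\<^sub>R Du x) \<bullet> grad \<phi> x)" for x
          by (simp add: indicator_def)
        ultimately show "(\<lambda>x. indicator \<Omega> x *\<^sub>R ((norm (Du x) powr (p - 2) *\<^sub>R Du x) \<bullet> grad \<phi> x)) \<in> borel_measurable lebesgue"
          by (simp only:)
      qed measurable
      then show ?thesis using eq[OF \<phi>] by simp
    qed
  qed (use op p gm in auto)
  then show ?thesis by blast
qed

theorem theorem1p2:
  fixes p :: real
  assumes "CARD('n::finite) \<ge> 2" and "p > real CARD('n)"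
  shows "\<exists>\<alpha> > 0. \<exists>A > 0. \<forall>u :: real ^ 'n \<Rightarrow> real.
    p_harmonic_on p (- cball 0 1) u \<and> continuous_on (- cball 0 1) u \<and> bounded (u ` (- cball 0 1)) \<longrightarrow>
    (\<forall>r \<ge> 1.
      Sup {\<bar>u x - u y\<bar> | x y. x \<in> - cball 0 1 \<and> y \<in> - cball 0 1 \<and> norm x \<ge> r \<and> norm y \<ge> r}
        \<le> A * (SUP x \<in> - cball 0 1. \<bar>u x\<bar>) / r powr \<alpha>)"
proof -
  let ?\<Lambda> = "2 * log_oscillation CARD('n) p"
  \<comment> \<open>Only \<open>?\<Lambda> >= 0\<close> is known, so
    \<open>1 - exp (- ?\<Lambda>)\<close> might be 0; halving the exponential gives a larger
    contraction factor that is positive, as its logarithm requires, and still below 1.\<close>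
  define \<theta> where "\<theta> = 1 - exp (- ?\<Lambda>) / 2"
  have p1: "p > 1" using assms by linarith
  have "exp (- ?\<Lambda>) \<le> 1" using log_oscillation_nonneg[OF p1 assms(2)] by simp
  moreover have "exp (- ?\<Lambda>) > 0" by simp
  ultimately have \<theta>: "0 < \<theta>" "\<theta> < 1" "1 - exp (- ?\<Lambda>) \<le> \<theta>" unfolding \<theta>_def by linarith+
  \<comment> \<open>Solves \<theta> = 8^(-\<alpha>): each increase of the radius by the factor 8
    costs one factor \<theta>.\<close>
  define \<alpha> where "\<alpha> = - log 8 \<theta>"
  have \<alpha>: "\<alpha> > 0" using \<theta> by (simp add: \<alpha>_def)
  have main: "Sup {\<bar>u x - u y\<bar> | x y. x \<in> - cball 0 1 \<and> y \<in> - cball 0 1 \<and> norm x \<ge> r \<and> norm y \<ge> r}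
        \<le> 2 / \<theta> * (SUP x \<in> - cball 0 1. \<bar>u x\<bar>) / r powr \<alpha>"
    if harm: "p_harmonic_on p (- cball 0 1) u" and cont: "continuous_on (- cball 0 1) u"
      and bdd: "bounded (u ` (- cball 0 1))" and r: "r \<ge> 1" for u :: "real ^ 'n \<Rightarrow> real" and r
  proof -
    define M where "M = (SUP x \<in> - cball 0 1. \<bar>u x\<bar>)"
    have "bdd_above ((\<lambda>x. \<bar>u x\<bar>) ` (- cball 0 1))"
      using bdd unfolding bounded_iff bdd_above_def by auto
    then have uM: "\<bar>u x\<bar> \<le> M" if "norm x > 1" for x
      unfolding M_def using that by (intro cSUP_upper) auto
    \<comment> \<open>A witness that the exterior is nonempty: it makes \<open>M\<close> nonnegative
      and, at the end, the set under the supremum nonempty.\<close>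
    obtain e :: "real^'n" where e: "norm e = r + 1" using r vector_choose_size[of "r + 1"] by auto
    have M0: "M \<ge> 0" using uM[of e] e r by simp
    let ?v = "\<lambda>x. indicator (- cball 0 1) x * u x"
    obtain g where "weak_p_harmonic (- cball 0 1) ?v g p"
      using p_harmonic_on_imp_weak_p_harmonic[OF harm cont p1] by blast
    then interpret weak_p_harmonic "- cball 0 1" ?v g p .
    interpret exterior_p_harmonic ?v g p M
      by unfold_locales (use assms uM in auto)
    \<comment> \<open>The starting radius \<open>s\<close> exceeds 1 because the estimates need
      spheres inside the open domain; the initial oscillation is at most
      \<open>2 * M\<close>.\<close>
    have iter: "\<bar>?v x - ?v y\<bar> \<le> \<theta> ^ k * (2 * M)"
      if "s > 1" "norm x \<ge> 8 ^ k * s" "norm y \<ge> 8 ^ k * s" for k s x y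
      using that
    proof (induction k arbitrary: x y)
      case 0
      then have "norm x > 1" "norm y > 1" by auto
      then show ?case using uM[of x] uM[of y] by simp
    next
      case (Suc k)
      have "(1::real) * 1 < 8 ^ k * s" using Suc.prems(1) by (intro mult_le_less_imp_less) auto
      then have "\<bar>?v x - ?v y\<bar> \<le> (1 - exp (- ?\<Lambda>)) * (\<theta> ^ k * (2 * M))"
        using Suc.prems by (intro oscillation_decay[OF assms(1), of "8 ^ k * s"] Suc.IH) auto
      also have "\<dots> \<le> \<theta> * (\<theta> ^ k * (2 * M))"
        using \<theta> M0 by (intro mult_right_mono) auto
      finally show ?case by (simp add: mult.assoc)
    qed
    have bound: "\<bar>u x - u y\<bar> \<le> 2 / \<theta> * M / r powr \<alpha>"
      if x: "norm x > 1" "norm x \<ge> r" and y: "norm y > 1" "norm y \<ge> r" for x y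
    \<comment> \<open>At \<open>r = 1\<close> there is no admissible starting radius above 1, and
      the trivial bound \<open>2 * M\<close> suffices.\<close>
    proof (cases "r = 1")
      case True
      have "\<bar>u x - u y\<bar> \<le> 2 * M" using uM[OF x(1)] uM[OF y(1)] by linarith
      also have "\<dots> \<le> 2 / \<theta> * M" using \<theta> M0 by (intro mult_right_mono) (auto simp: field_simps)
      finally show ?thesis using True by simp
    next
      case False
      then have r1: "r > 1" using r by simp
      \<comment> \<open>The largest number of steps with \<open>8 ^ k\<close> strictly below
        \<open>r\<close>, so that the starting radius \<open>r / 8 ^ k\<close> exceeds 1. The
        rounding costs at most one factor 1 / \<theta>, hence the constant
        \<open>2 / \<theta>\<close>.\<close>
      define k where "k = nat (\<lceil>log 8 r\<rceil> - 1)"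
      have "log 8 r > 0" using r1 by simp
      then have "real k = of_int \<lceil>log 8 r\<rceil> - 1" by (simp add: k_def)
      then have k: "real k < log 8 r" "log 8 r - 1 \<le> real k" by linarith+
      have "8 ^ k = 8 powr real k" by (simp add: powr_realpow)
      also have "\<dots> < 8 powr (log 8 r)" using k(1) by (intro powr_less_mono) auto
      also have "\<dots> = r" using r1 by simp
      finally have s: "r / 8 ^ k > 1" by simp
      have "\<bar>?v x - ?v y\<bar> \<le> \<theta> ^ k * (2 * M)"
        by (rule iter[OF s]) (use x y in auto)
      moreover have "?v x = u x" "?v y = u y" using x y by auto
      moreover have "\<theta> ^ k \<le> 1 / \<theta> / r powr \<alpha>"
      proof -
        have "\<theta> ^ k = \<theta> powr real k" using \<theta> by (simp add: powr_realpow)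
        also have "\<dots> \<le> \<theta> powr (log 8 r - 1)" using k(2) \<theta> by (intro powr_mono') auto
        also have "\<dots> = \<theta> powr (log 8 r) / \<theta>" using \<theta> by (simp add: powr_diff)
        also have "\<theta> powr (log 8 r) = r powr (- \<alpha>)"
          using \<theta> r1 by (simp add: powr_def \<alpha>_def log_def)
        finally show ?thesis by (simp add: powr_minus divide_inverse mult.commute)
      qed
      then have "\<theta> ^ k * (2 * M) \<le> 1 / \<theta> / r powr \<alpha> * (2 * M)" using M0 by (intro mult_right_mono) auto
      ultimately show ?thesis by simp
    qed
    show ?thesis
      unfolding M_def[symmetric]
    proof (rule cSup_least)
      have "e \<in> - cball 0 1" "norm e \<ge> r" using e r by auto
      then show "{\<bar>u x - u y\<bar> | x y. x \<in> - cball 0 1 \<and> y \<in> - cball 0 1 \<and> norm x \<ge> r \<and> norm y \<ge> r} \<noteq> {}" by blast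
    qed (use bound in auto)
  qed
  show ?thesis using \<alpha> \<theta>(1) main by (intro exI[of _ \<alpha>] exI[of _ "2 / \<theta>"] conjI allI impI) auto
qed

end
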